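(* Let $\alpha \in \mathbb{R}$ and let $M = M(n) = n/2 + \alpha n^{1/2} + o(n^{1/2}) \in \mathbb{N}$ (as $n\to\infty$). Then there is a continuous and almost surely positive random variable $T_\alpha$ such that, as $n \to \infty$, \[ n^{-1/2}\, T_{n,M} \overset{d}{\longrightarrow} T_\alpha , \] where $T_{n,M}$ is the dispersion time of the dispersion process with $M$ particles on the complete graph with loops on $n$ vertices.
   Context: Dispersion process on the complete graph with loops on vertex set $\{1,\dots,n\}$ with $M\ge 2$ particles $\mathcal P=\{p_1,\dots,p_M\}$: write $p_{i,t}$ for the position of particle $p_i$ at step $t\in\mathbb{N}_0=\{0,1,2,\dots\}$, and $\mathcal U_t$, $\mathcal H_t$ for the sets of unhappy and happy particles at step $t$, with $U_t=|\mathcal U_t|$, $H_t=|\mathcal H_t|=M-U_t$. Initially $p_{i,0}=1$ for all $i$, $\mathcal U_0=\mathcal P$, $\mathcal H_0=\emptyset$. Let $G_{i,t}$ be independent uniform random elements of $\{1,\dots,n\}$. For $t\ge 0$ set $p_{i,t+1}=p_{i,t}$ if $p_i\in\mathcal H_t$ and $p_{i,t+1}=G_{i,t+1}$ if $p_i\in\mathcal U_t$; then $\mathcal H_{t+1}=\{p_i: p_{i,t+1}\neq p_{j,t+1}\text{ for all } j\neq i\}$ and $\mathcal U_{t+1}=\mathcal P\setminus\mathcal H_{t+1}$. The dispersion time is $T_{n,M}=\inf\{t\in\mathbb{N}_0: U_t=0\}$. The symbol $\overset{d}{\longrightarrow}$ denotes convergence in distribution. A real random variable is called continuous if its distribution function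 is continuous. *)

theory Defs
  imports "HOL-Probability.Probability" "HOL-Library.Landau_Symbols"
begin

(* A realisation of the dispersion process is a deterministic function of the choices g:
   g i t is the vertex to which particle i jumps at step t, should it be unhappy at step t - 1.
   Particles are numbered 1, ..., M. Positions of indices outside {1..M} carry no meaning. *)

function position :: "nat \<Rightarrow> (nat \<Rightarrow> nat \<Rightarrow> nat) \<Rightarrow> nat \<Rightarrow> nat \<Rightarrow> nat"
  and happy :: "nat \<Rightarrow> (nat \<Rightarrow> nat \<Rightarrow> nat) \<Rightarrow> nat \<Rightarrow> nat set"
where
  "position M g 0 i = 1"
| "position M g (Suc t) i = (if i \<in> happy M g t then position M g t i else g i (Suc t))"
| "happy M g 0 = {}"
| "happy M g (Suc t) =
     {i \<in> {1..M}. \<forall>j\<in>{1..M}. j \<noteq> i \<longrightarrow> position M g (Suc t) i \<noteq> position M g (Suc t) j}"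
  by pat_completeness auto
termination
  by (relation "Wellfounded.measure (case_sum (\<lambda>(M, g, t, i). 2 * t) (\<lambda>(M, g, t). 2 * t + 1))") auto

definition unhappy :: "nat \<Rightarrow> (nat \<Rightarrow> nat \<Rightarrow> nat) \<Rightarrow> nat \<Rightarrow> nat set" where
  "unhappy M g t = {1..M} - happy M g t"

(* The infimum of the empty set is infinity in enat. *)
definition dispersion_time :: "nat \<Rightarrow> (nat \<Rightarrow> nat \<Rightarrow> nat) \<Rightarrow> enat" where
  "dispersion_time M g = Inf (enat ` {t. card (unhappy M g t) = 0})"

(* Loops of the complete graph are reflected in the jumps being uniform on all of {1..n},
   the current vertex included. *)
locale dispersion_process = prob_space \<Omega>
  for \<Omega> :: "'a measure" and n M :: nat and G :: "nat \<Rightarrow> nat \<Rightarrow> 'a \<Rightarrow> nat" +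
  assumes two_particles: "2 \<le> M"
    and indep_choices:
      "indep_vars (\<lambda>_. count_space {1..n}) (\<lambda>(i, t). G i t) ({1..M} \<times> {1..})"
    and uniform_choices:
      "i \<in> {1..M} \<Longrightarrow> 1 \<le> t \<Longrightarrow>
        distr \<Omega> (count_space {1..n}) (G i t) = uniform_count_measure {1..n}"

end

theory Submission
  imports Defs "HOL-Real_Asymp.Real_Asymp"
begin

text \<open>
  Only the number \<open>u\<close> of unhappy particles matters. In one round these \<open>u\<close> particles are thrown one after
  another onto the \<open>n\<close> vertices, \<open>M - u\<close> of which carry one happy particle each. During the throws the
  number \<open>s\<close> of vertices with exactly one particle goes up when an empty vertex is hit and down when a
  singly occupied one is hit, and at the end \<open>M - s\<close> particles are unhappy. As \<open>M\<close> is close to \<open>n/2\<close>, the two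
  events have almost the same probability \<open>1/2\<close>, and \<open>s\<close> is a nearly simple random walk of \<open>u\<close> steps. Its
  mean and variance show that one round changes \<open>u\<close> by \<open>u (2M/n - 1) - 7 u^2 / (4 n)\<close> on average, with
  variance about \<open>u\<close>. Hence \<open>u / sqrt n\<close>, watched at times \<open>t / sqrt n\<close>, behaves like the diffusion with generator
  \<open>L f = x f'' / 2 + (2 \<alpha> x - 7/4 x^2) f'\<close>, started from infinity, and \<open>T_\<alpha>\<close> is its absorption time at \<open>0\<close>.

  The diffusion itself is never constructed. The argument rests on one function for each real \<open>\<theta>\<close>: the
  solution \<open>\<phi>\<close> of \<open>L \<phi> = - i \<theta> \<phi>\<close> with \<open>\<phi> = 1\<close> at infinity (lemma \<open>characteristic_solutions\<close>). Along the chain,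
  \<open>exp (i \<theta> t / sqrt n) \<phi> (u / sqrt n)\<close> is a martingale up to small errors, because one round acts on smooth
  functions like \<open>1 + L / sqrt n\<close> (lemma \<open>one_step_generator\<close>). The chain starts near infinity, where
  \<open>\<phi>\<close> is close to \<open>1\<close>, and it is absorbed at \<open>0\<close>; optional stopping therefore gives
  \<open>\<phi> 0 * E (exp (i \<theta> T / sqrt n)) \<longlonglongrightarrow> 1\<close> (lemma \<open>char_limit\<close>). The errors of all rounds add up to a
  vanishing quantity because suitable Lyapunov functions pay for them (lemmas \<open>lyapunov_time\<close> and
  \<open>lyapunov_error\<close>): at a bounded level the chain is absorbed in the next
  round with at least a positive probability independent of \<open>n\<close>, and from high levels it comes down quickly.

  The expected absorption time is of order \<open>sqrt n\<close>, so the laws of \<open>T / sqrt n\<close> are tight, and a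
  subsequential limit has characteristic function \<open>1 / \<phi> 0\<close>. Levy's continuity theorem turns this into
  convergence for every admissible choice of \<open>M\<close> and of the probability spaces. An energy estimate for \<open>\<phi>\<close>
  shows that the modulus of \<open>\<phi> 0\<close> grows at least like \<open>sqrt (abs \<theta>)\<close> (lemma \<open>modulus_growth\<close>), so the characteristic function vanishes at infinity
  and the limit law has no atoms (lemma \<open>no_atom_of_char_decay\<close>). This is the continuity of its distribution function;
  as the limit is nonnegative, it also yields positivity.
\<close>

section \<open>A singular boundary value problem on the half-line\<close>

lemma decreasing_from_zero_limit_nonneg:
  fixes f f' :: "real \<Rightarrow> real"
  assumes "\<And>y. 0 < y \<Longrightarrow> (f has_real_derivative f' y) (at y)"
    and "\<And>y. 0 < y \<Longrightarrow> f' y \<le> 0" and "(f \<longlongrightarrow> 0) at_top" and "0 < x"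
  shows "0 \<le> f x"
proof -
  have "f z \<le> f x" if "x \<le> z" for z
    using that assms(1,2,4) by (intro DERIV_nonpos_imp_nonincreasing[of x z f]) (meson order_less_le_trans)+
  then have "\<forall>\<^sub>F z in at_top. f z \<le> f x"
    by (auto simp: eventually_at_top_linorder)
  with assms(3) show ?thesis
    by (intro tendsto_upperbound[where F = at_top and f = f]) auto
qed

lemma decreasing_bounded_below_convergent_at_top:
  fixes f :: "real \<Rightarrow> real"
  assumes "\<And>x y. a \<le> x \<Longrightarrow> x \<le> y \<Longrightarrow> f y \<le> f x" and "\<And>x. a \<le> x \<Longrightarrow> b \<le> f x"
  shows "\<exists>l. (f \<longlongrightarrow> l) at_top"
proof -
  define l where "l = Inf (f ` {a..})"
  have bdd: "bdd_below (f ` {a..})" using assms(2) by (auto intro!: bdd_belowI)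
  have "(f \<longlongrightarrow> l) at_top"
  proof (rule order_tendstoI)
    fix c assume "c < l"
    have "l \<le> f x" if "a \<le> x" for x
      unfolding l_def using that bdd by (intro cInf_lower) auto
    then show "\<forall>\<^sub>F x in at_top. c < f x"
      using \<open>c < l\<close> by (auto simp: eventually_at_top_linorder intro!: exI[of _ a] elim: order.strict_trans2)
  next
    fix c assume "l < c"
    then obtain x where "a \<le> x" "f x < c"
      unfolding l_def using cInf_lessD[of "f ` {a..}" c] by auto
    then show "\<forall>\<^sub>F x in at_top. f x < c"
      using assms(1) by (auto simp: eventually_at_top_linorder intro!: exI[of _ x]) (meson order.strict_trans1)
  qed
  then show ?thesis by blast
qed

text \<open>
  The tail integral of \<open>g\<close>, described by its derivative and its limit alone; no improper integral is needed.
\<close>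

definition decaying_primitive :: "(real \<Rightarrow> real) \<Rightarrow> real \<Rightarrow> real" where
  "decaying_primitive g = (SOME G. (\<forall>y>0. (G has_real_derivative - g y) (at y)) \<and> (G \<longlongrightarrow> 0) at_top)"

text \<open>
  If \<open>F\<close> is a primitive of \<open>g\<close>, then \<open>F + D\<close> decreases and \<open>F - D\<close> increases, so \<open>F\<close> converges at infinity,
  and the difference to the limit is bounded by \<open>D\<close>.
\<close>

lemma decaying_primitive_dominated:
  fixes g D D' :: "real \<Rightarrow> real"
  assumes g: "\<And>y. 0 < y \<Longrightarrow> isCont g y"
    and D: "\<And>y. 0 < y \<Longrightarrow> (D has_real_derivative D' y) (at y)"
    and le: "\<And>y. 0 < y \<Longrightarrow> \<bar>g y\<bar> \<le> - D' y"
    and lim: "(D \<longlongrightarrow> 0) at_top"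
  shows "\<And>y. 0 < y \<Longrightarrow> (decaying_primitive g has_real_derivative - g y) (at y)"
    and "(decaying_primitive g \<longlongrightarrow> 0) at_top"
    and "\<And>y. 0 < y \<Longrightarrow> \<bar>decaying_primitive g y\<bar> \<le> D y"
proof -
  have "\<exists>F. \<forall>x. ereal 0 < ereal x \<longrightarrow> ereal x < \<infinity> \<longrightarrow> (F has_vector_derivative g x) (at x)"
    using g by (intro einterval_antiderivative) auto
  then obtain F where F: "\<And>x. 0 < x \<Longrightarrow> (F has_real_derivative g x) (at x)"
    by (auto simp: has_real_derivative_iff_has_vector_derivative)
  have D0: "0 \<le> D y" if "0 < y" for y
    by (rule decreasing_from_zero_limit_nonneg[OF D _ lim that]) (use le in fastforce)+
  have signs: "g x + D' x \<le> 0" "0 \<le> g x - D' x" if "0 < x" for x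
    using le[OF that] by auto
  have dec: "F y + D y \<le> F x + D x" if "0 < x" "x \<le> y" for x y
  proof (rule DERIV_nonpos_imp_nonincreasing[OF that(2)])
    fix z assume "x \<le> z" "z \<le> y"
    then show "\<exists>y. ((\<lambda>x. F x + D x) has_real_derivative y) (at z) \<and> y \<le> 0"
      using that signs[of z] DERIV_add[OF F[of z] D[of z]] by auto
  qed
  have inc: "F x - D x \<le> F y - D y" if "0 < x" "x \<le> y" for x y
  proof (rule DERIV_nonneg_imp_nondecreasing[OF that(2)])
    fix z assume "x \<le> z" "z \<le> y"
    then show "\<exists>y. ((\<lambda>x. F x - D x) has_real_derivative y) (at z) \<and> y \<ge> 0"
      using that signs[of z] DERIV_diff[OF F[of z] D[of z]] by auto
  qed
  have "\<exists>l. ((\<lambda>x. F x + D x) \<longlongrightarrow> l) at_top"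
  proof (rule decreasing_bounded_below_convergent_at_top[of 1 _ "F 1 - D 1"])
    fix x :: real assume "1 \<le> x"
    then show "F 1 - D 1 \<le> F x + D x" using inc[of 1 x] D0[of x] by simp
  qed (use dec in auto)
  then obtain l where l: "((\<lambda>x. F x + D x) \<longlongrightarrow> l) at_top" by blast
  have "((\<lambda>x. F x + D x - D x) \<longlongrightarrow> l - 0) at_top"
    by (intro tendsto_intros l lim)
  then have Fl: "(F \<longlongrightarrow> l) at_top" by simp
  have "\<exists>G. (\<forall>y>0. (G has_real_derivative - g y) (at y)) \<and> (G \<longlongrightarrow> 0) at_top"
  proof (intro exI conjI allI impI)
    show "((\<lambda>y. l - F y) has_real_derivative - g y) (at y)" if "0 < y" for y
      using F[OF that] by (auto intro!: derivative_eq_intros)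
    have "((\<lambda>y. l - F y) \<longlongrightarrow> l - l) at_top" by (intro tendsto_intros Fl)
    then show "((\<lambda>y. l - F y) \<longlongrightarrow> 0) at_top" by simp
  qed
  from someI_ex[OF this] have T: "\<And>y. 0 < y \<Longrightarrow> (decaying_primitive g has_real_derivative - g y) (at y)" "(decaying_primitive g \<longlongrightarrow> 0) at_top"
    unfolding decaying_primitive_def by blast+
  show "\<And>y. 0 < y \<Longrightarrow> (decaying_primitive g has_real_derivative - g y) (at y)" "(decaying_primitive g \<longlongrightarrow> 0) at_top"
    using T by auto
  fix y :: real assume y: "0 < y"
  have "((\<lambda>y. D y - decaying_primitive g y) \<longlongrightarrow> 0 - 0) at_top" "((\<lambda>y. D y + decaying_primitive g y) \<longlongrightarrow> 0 + 0) at_top"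
    by (intro tendsto_intros T lim)+
  then have lims: "((\<lambda>y. D y - decaying_primitive g y) \<longlongrightarrow> 0) at_top" "((\<lambda>y. D y + decaying_primitive g y) \<longlongrightarrow> 0) at_top" by auto
  have "0 \<le> D y - decaying_primitive g y"
    by (rule decreasing_from_zero_limit_nonneg[OF _ _ lims(1) y, where f' = "\<lambda>y. D' y - - g y"])
       (use signs DERIV_diff[OF D T(1)] in \<open>auto simp: add.commute\<close>)
  moreover have "0 \<le> D y + decaying_primitive g y"
    by (rule decreasing_from_zero_limit_nonneg[OF _ _ lims(2) y, where f' = "\<lambda>y. D' y + - g y"])
       (use signs DERIV_add[OF D T(1)] in \<open>auto\<close>)
  ultimately show "\<bar>decaying_primitive g y\<bar> \<le> D y" by simp
qed

lemma decaying_primitive_nonneg: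
  assumes "\<And>y. 0 < y \<Longrightarrow> (decaying_primitive g has_real_derivative - g y) (at y)"
    and "(decaying_primitive g \<longlongrightarrow> 0) at_top" and "\<And>y. 0 < y \<Longrightarrow> 0 \<le> g y" and "0 < y"
  shows "0 \<le> decaying_primitive g y"
  by (rule decreasing_from_zero_limit_nonneg[OF assms(1) _ assms(2,4)]) (use assms(3) in auto)

context fixes \<alpha> :: real begin

text \<open>
  The integrating factor that puts the generator into divergence form:
  \<open>L f = x / (2 * weight) * (weight * f')'\<close>.
\<close>

definition weight :: "real \<Rightarrow> real" where
  "weight x = exp (4 * \<alpha> * x - 7/4 * x\<^sup>2)"

lemma weight_pos [simp]: "0 < weight x" by (simp add: weight_def)

lemma weight_nonneg [simp]: "0 \<le> weight x" by (simp add: weight_def)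
lemma weight_nonzero [simp]: "weight x \<noteq> 0" by (simp add: weight_def)

lemma weight_deriv: "(weight has_real_derivative (4 * \<alpha> - 7/2 * x) * weight x) (at x)"
  unfolding weight_def by (auto intro!: derivative_eq_intros simp: algebra_simps)

text \<open>
  For \<open>\<alpha> > 0\<close> the weight increases on an initial interval. The constant is chosen so large that the factor
  with \<open>tame_const\<close> in the envelope below makes up for this growth.
\<close>

definition tame_const :: real where "tame_const = 4 * \<bar>\<alpha>\<bar> * (1 + 8 * \<bar>\<alpha>\<bar>)\<^sup>2"

definition slope_const :: real where "slope_const = 16 * exp tame_const"

text \<open>
  A constant times \<open>y powr (-1/2) * (1 + y) powr (-3/2)\<close>: integrable at \<open>0\<close> and at infinity, and of order
  \<open>1 / y^2\<close> at infinity, which is the speed at which the diffusion comes down.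
\<close>

definition slope_bound :: "real \<Rightarrow> real" where
  "slope_bound y = slope_const * exp (- ln y / 2 - 3/2 * ln (1 + y))"

text \<open>
  An explicit supersolution for the tail integral of \<open>2 * weight y / y\<close>.
\<close>

definition envelope :: "real \<Rightarrow> real" where
  "envelope y = exp (- tame_const * (y / (1 + y))) * slope_bound y * weight y"

text \<open>
  The tail integral of \<open>slope_bound\<close>. It is finite at \<open>0\<close>: this expresses that infinity is an entrance
  boundary and that \<open>0\<close> is reached in finite time.
\<close>

definition height :: "real \<Rightarrow> real" where
  "height y = 2 * slope_const * (1 - sqrt (y / (1 + y)))"

lemma tame_const_nonneg: "0 \<le> tame_const" by (simp add: tame_const_def)
lemma slope_const_pos [simp]: "0 < slope_const" by (simp add: slope_const_def)
lemma slope_const_nonneg [simp]: "0 \<le> slope_const" by (simp add: slope_const_def)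
lemma slope_bound_pos [simp]: "0 < slope_bound y" by (simp add: slope_bound_def)

lemma height_deriv: assumes "0 < y" shows "(height has_real_derivative - slope_bound y) (at y)"
proof -
  have e: "sqrt (x / (1 + x)) = exp (ln x / 2 - ln (1 + x) / 2)" if "0 < x" for x :: real
  proof -
    have "sqrt (x / (1 + x)) = (x / (1 + x)) powr (1/2)" using that by (simp add: powr_half_sqrt)
    also have "\<dots> = exp (ln x / 2 - ln (1 + x) / 2)"
      using that by (simp add: powr_def ln_div diff_divide_distrib)
    finally show ?thesis .
  qed
  have "((\<lambda>y. 2 * slope_const * (1 - exp (ln y / 2 - ln (1 + y) / 2))) has_real_derivative
      - (2 * slope_const * (exp (ln y / 2 - ln (1 + y) / 2) * (1 / y / 2 - 1 / (1 + y) / 2)))) (at y)"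
    using assms
    apply (auto intro!: derivative_eq_intros)
    apply (simp add: divide_simps)
    done
  also have "1 / y / 2 - 1 / (1 + y) / 2 = 1 / (2 * (y * (1 + y)))"
    using assms by (simp add: field_simps)
  also have "1 / (2 * (y * (1 + y))) = exp (- ln y - ln (1 + y)) / 2"
    using assms by (simp add: exp_diff exp_minus field_simps)
  also have "- (2 * slope_const * (exp (ln y / 2 - ln (1 + y) / 2) * (exp (- ln y - ln (1 + y)) / 2))) = - slope_bound y"
    by (simp add: slope_bound_def exp_add[symmetric] field_simps)
  finally show ?thesis
    by (rule has_field_derivative_transform_within[OF _ assms]) (auto simp: height_def e dist_real_def)
qed

lemma height_bounds: assumes "0 \<le> y" shows "0 \<le> height y" "height y \<le> 2 * slope_const"
proof -
  have "sqrt (y / (1 + y)) \<le> sqrt 1" using assms by (intro real_sqrt_le_mono) (simp add: field_simps)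
  then show "0 \<le> height y" unfolding height_def using slope_const_pos
    by (intro mult_nonneg_nonneg) (auto intro: less_imp_le simp del: real_sqrt_le_1_iff)
  show "height y \<le> 2 * slope_const" using assms by (simp add: height_def mult_le_cancel_left1)
qed

lemma height_lim: "(height \<longlongrightarrow> 0) at_top"
proof -
  have "((\<lambda>y::real. y / (1 + y)) \<longlongrightarrow> 1) at_top" by real_asymp
  then have "((\<lambda>y. 2 * slope_const * (1 - sqrt (y / (1 + y)))) \<longlongrightarrow> 2 * slope_const * (1 - sqrt 1)) at_top"
    by (intro tendsto_intros)
  then show ?thesis by (simp add: height_def[abs_def])
qed

lemma slope_bound_le: assumes "0 < y" shows "slope_bound y \<le> slope_const / y" "slope_bound y \<le> slope_const / y\<^sup>2"
proof -
  have l: "ln y \<le> ln (1 + y)" "0 \<le> ln (1 + y)" using assms by auto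
  have "exp (- ln y / 2 - 3/2 * ln (1 + y)) \<le> exp (- ln y)" using l by simp
  also have "\<dots> = 1 / y" using assms by (simp add: exp_minus inverse_eq_divide)
  finally show "slope_bound y \<le> slope_const / y"
    unfolding slope_bound_def using slope_const_pos by (metis less_imp_le mult_left_mono mult.right_neutral times_divide_eq_right)
  have "exp (- ln y / 2 - 3/2 * ln (1 + y)) \<le> exp (- (2 * ln y))" using l by simp
  also have "exp (- (2 * ln y)) = 1 / y\<^sup>2"
  proof -
    have "exp (- (2 * ln y)) = exp (- ln y) * exp (- ln y)" by (simp flip: exp_add)
    then show ?thesis using assms by (simp add: exp_minus power2_eq_square inverse_eq_divide)
  qed
  finally show "slope_bound y \<le> slope_const / y\<^sup>2"
    unfolding slope_bound_def using slope_const_pos by (metis less_imp_le mult_left_mono mult.right_neutral times_divide_eq_right)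
qed

lemma envelope_deriv:
  assumes "0 < y"
  shows "(envelope has_real_derivative - envelope y * (7/2 * y - 4 * \<alpha> + 1 / (2 * y) + 3 / (2 * (1 + y)) + tame_const / (1 + y)\<^sup>2)) (at y)"
proof -
  have "((\<lambda>y. slope_const * exp (- tame_const * (y / (1 + y)) + (- ln y / 2 - 3/2 * ln (1 + y)) + (4 * \<alpha> * y - 7/4 * y\<^sup>2)))
     has_real_derivative slope_const * exp (- tame_const * (y / (1 + y)) + (- ln y / 2 - 3/2 * ln (1 + y)) + (4 * \<alpha> * y - 7/4 * y\<^sup>2)) *
      (- (tame_const / (1 + y)\<^sup>2) + (- (1 / y / 2) - 3/2 * (1 / (1 + y))) + (4 * \<alpha> - 7/4 * (2 * y)))) (at y)"
  proof -
    have "((\<lambda>y. y / (1 + y)) has_real_derivative 1 / (1 + y)\<^sup>2) (at y)"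
      using assms by (auto intro!: derivative_eq_intros simp: power2_eq_square field_simps)
    moreover have "((\<lambda>y. - ln y / 2 - 3/2 * ln (1 + y)) has_real_derivative - (1 / y / 2) - 3/2 * (1 / (1 + y))) (at y)"
      using assms by (auto intro!: derivative_eq_intros simp: divide_simps)
    moreover have "((\<lambda>y. 4 * \<alpha> * y - 7/4 * y\<^sup>2) has_real_derivative 4 * \<alpha> - 7/4 * (2 * y)) (at y)"
      by (auto intro!: derivative_eq_intros)
    ultimately have "((\<lambda>y. - tame_const * (y / (1 + y)) + (- ln y / 2 - 3/2 * ln (1 + y)) + (4 * \<alpha> * y - 7/4 * y\<^sup>2))
      has_real_derivative - tame_const * (1 / (1 + y)\<^sup>2) + (- (1 / y / 2) - 3/2 * (1 / (1 + y))) + (4 * \<alpha> - 7/4 * (2 * y))) (at y)"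
      by (intro DERIV_add DERIV_cmult)
    from DERIV_cmult[OF DERIV_chain'[OF this DERIV_exp], of slope_const] show ?thesis by (simp add: mult_ac)
  qed
  moreover have "envelope = (\<lambda>y. slope_const * exp (- tame_const * (y / (1 + y)) + (- ln y / 2 - 3/2 * ln (1 + y)) + (4 * \<alpha> * y - 7/4 * y\<^sup>2)))"
    unfolding envelope_def[abs_def] slope_bound_def[abs_def] weight_def[abs_def] exp_add by (simp add: mult_ac)
  moreover have "(- (tame_const / (1 + y)\<^sup>2) + (- (1 / y / 2) - 3/2 * (1 / (1 + y))) + (4 * \<alpha> - 7/4 * (2 * y)))
     = - (7/2 * y - 4 * \<alpha> + 1 / (2 * y) + 3 / (2 * (1 + y)) + tame_const / (1 + y)\<^sup>2)"
  proof -
    have "1 / y / 2 = 1 / (2 * y)" "3/2 * (1 / (1 + y)) = 3 / (2 * (1 + y))" by simp_all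
    moreover have "- T + (- A - B) + (4 * \<alpha> - 7/4 * (2 * y)) = - (7/2 * y - 4 * \<alpha> + A + B + T)" for A B T
      by simp
    ultimately show ?thesis by (simp only:)
  qed
  ultimately show ?thesis by (simp add: algebra_simps)
qed

text \<open>
  Below \<open>8 * abs \<alpha>\<close> the term with \<open>tame_const\<close> outweighs \<open>4 * \<alpha>\<close>, and above it \<open>7/2 * y\<close> does. Either way minus the
  logarithmic derivative of the envelope is at least \<open>(y + 1 / y) / 4\<close>.
\<close>

lemma envelope_dominates:
  assumes "0 < y"
  shows "2 * weight y / y \<le> envelope y * (7/2 * y - 4 * \<alpha> + 1 / (2 * y) + 3 / (2 * (1 + y)) + tame_const / (1 + y)\<^sup>2)"
proof -
  have br: "1/4 * (y + 1 / y) \<le> 7/2 * y - 4 * \<alpha> + 1 / (2 * y) + 3 / (2 * (1 + y)) + tame_const / (1 + y)\<^sup>2"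
  proof (cases "y < 8 * \<bar>\<alpha>\<bar>")
    case True
    have "(1 + y)\<^sup>2 \<le> (1 + 8 * \<bar>\<alpha>\<bar>)\<^sup>2" using True assms by (intro power_mono) auto
    then have "4 * \<bar>\<alpha>\<bar> * (1 + y)\<^sup>2 \<le> tame_const" unfolding tame_const_def by (intro mult_left_mono) auto
    then have "4 * \<bar>\<alpha>\<bar> \<le> tame_const / (1 + y)\<^sup>2" using assms by (simp add: pos_le_divide_eq)
    moreover have "1/4 * (y + 1 / y) \<le> 7/2 * y + 1 / (2 * y)" "0 \<le> 3 / (2 * (1 + y))"
      using assms by (auto simp: field_simps)
    ultimately show ?thesis by linarith
  next
    case False
    have "0 \<le> tame_const / (1 + y)\<^sup>2" "0 \<le> 3 / (2 * (1 + y))" using tame_const_nonneg assms by auto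
    moreover have "1/4 * (1 / y) \<le> 1 / (2 * y)" using assms by (simp add: field_simps)
    moreover have "4 * \<alpha> \<le> 1/2 * y" using False by linarith
    moreover have "1/4 * (y + 1 / y) = 1/4 * y + 1/4 * (1 / y)" by (simp add: algebra_simps)
    ultimately show ?thesis using assms by linarith
  qed
  have "exp (- tame_const) \<le> exp (- tame_const * (y / (1 + y)))"
    using assms tame_const_nonneg by (simp add: field_simps)
  moreover have "slope_bound y \<ge> slope_const / (1 + y)\<^sup>2"
  proof -
    have "exp (- (2 * ln (1 + y))) = exp (- ln (1 + y)) * exp (- ln (1 + y))" by (simp flip: exp_add)
    then have "1 / (1 + y)\<^sup>2 = exp (- (2 * ln (1 + y)))"
      using assms by (simp add: exp_minus power2_eq_square inverse_eq_divide)
    also have "\<dots> \<le> exp (- ln y / 2 - 3/2 * ln (1 + y))"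
    proof -
      have "ln y \<le> ln (1 + y)" using assms by simp
      then show ?thesis unfolding exp_le_cancel_iff by linarith
    qed
    finally show ?thesis
      unfolding slope_bound_def using slope_const_pos by (metis less_imp_le mult_left_mono mult.right_neutral times_divide_eq_right)
  qed
  ultimately have "exp (- tame_const) * (slope_const / (1 + y)\<^sup>2) * weight y \<le> envelope y"
    unfolding envelope_def using assms by (intro mult_mono) (auto intro: less_imp_le)
  moreover have "exp (- tame_const) * (slope_const / (1 + y)\<^sup>2) = 16 / (1 + y)\<^sup>2"
    by (simp add: slope_const_def exp_minus)
  ultimately have d: "16 / (1 + y)\<^sup>2 * weight y \<le> envelope y" by (simp only:)
  have "2 / y \<le> 16 / (1 + y)\<^sup>2 * (1/4 * (y + 1 / y))"
  proof -
    have "(1 + y)\<^sup>2 \<le> 2 * (y\<^sup>2 + 1)" using sum_squares_bound[of 1 y] by (simp add: power2_eq_square algebra_simps)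
    then have "2 * (1 + y)\<^sup>2 \<le> 4 * (y\<^sup>2 + 1)" by simp
    then have "2 * (1 + y)\<^sup>2 / (y * (1 + y)\<^sup>2) \<le> 4 * (y\<^sup>2 + 1) / (y * (1 + y)\<^sup>2)"
      using assms by (intro divide_right_mono) auto
    moreover have "2 * (1 + y)\<^sup>2 / (y * (1 + y)\<^sup>2) = 2 / y" using assms by simp
    moreover have "y + 1 / y = (y\<^sup>2 + 1) / y" using assms by (simp add: field_simps power2_eq_square)
    moreover have "16 / A * (1/4 * (B / y)) = 4 * B / (y * A)" for A B by simp
    ultimately show ?thesis by (simp only:)
  qed
  then have "2 / y * weight y \<le> 16 / (1 + y)\<^sup>2 * (1/4 * (y + 1 / y)) * weight y"
    by (intro mult_right_mono) (auto intro: less_imp_le)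
  also have "\<dots> = (16 / (1 + y)\<^sup>2 * weight y) * (1/4 * (y + 1 / y))" by (simp only: mult_ac)
  also have "\<dots> \<le> envelope y * (7/2 * y - 4 * \<alpha> + 1 / (2 * y) + 3 / (2 * (1 + y)) + tame_const / (1 + y)\<^sup>2)"
    using d br assms by (intro mult_mono) (auto simp: envelope_def intro: less_imp_le)
  finally show ?thesis by simp
qed

lemma envelope_le: assumes "0 < y" shows "envelope y \<le> slope_bound y * weight y"
  unfolding envelope_def using assms tame_const_nonneg
  by (intro mult_right_mono) (auto simp: mult_le_cancel_right1 intro: less_imp_le)

lemma envelope_lim: "(envelope \<longlongrightarrow> 0) at_top"
proof -
  have W: "(weight \<longlongrightarrow> 0) at_top"
    unfolding weight_def[abs_def] by real_asymp
  have "((\<lambda>y. slope_const / y * weight y) \<longlongrightarrow> 0 * 0) at_top"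
    by (intro tendsto_intros W) real_asymp
  then have L: "((\<lambda>y. slope_const / y * weight y) \<longlongrightarrow> 0) at_top" by simp
  show ?thesis
  proof (rule Lim_null_comparison[OF _ L])
    show "\<forall>\<^sub>F x in at_top. norm (envelope x) \<le> slope_const / x * weight x"
    proof (rule eventually_mono[OF eventually_gt_at_top[of 0]])
      fix x :: real assume "0 < x"
      then have "envelope x \<le> slope_const / x * weight x"
        using envelope_le[of x] mult_right_mono[OF slope_bound_le(1)[of x], of "weight x"] by simp
      moreover have "0 \<le> envelope x" by (simp add: envelope_def less_imp_le)
      ultimately show "norm (envelope x) \<le> slope_const / x * weight x" by simp
    qed
  qed
qed

text \<open>
  The Taylor coefficients of \<open>\<phi>\<close> in the spectral parameter: \<open>mode (k + 1)\<close> is the solution of \<open>L f = mode k\<close>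
  that vanishes at infinity. The flux is minus the weighted derivative of the next mode.
\<close>

fun mode :: "nat \<Rightarrow> real \<Rightarrow> real" where
  "mode 0 = (\<lambda>_. 1)"
| "mode (Suc k) = decaying_primitive (\<lambda>y. decaying_primitive (\<lambda>z. 2 * weight z / z * mode k z) y / weight y)"

definition flux :: "nat \<Rightarrow> real \<Rightarrow> real" where
  "flux k = decaying_primitive (\<lambda>z. 2 * weight z / z * mode k z)"

lemma mode_Suc: "mode (Suc k) = decaying_primitive (\<lambda>y. flux k y / weight y)"
  by (simp add: flux_def)

lemma weight_bound: "weight x \<le> exp (16/7 * \<alpha>\<^sup>2)"
proof -
  have "0 \<le> 7/4 * (x - 8/7 * \<alpha>)\<^sup>2" by simp
  then show ?thesis unfolding weight_def exp_le_cancel_iff by (simp add: power2_eq_square algebra_simps)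
qed

lemma isCont_weight: "isCont weight y" using weight_deriv DERIV_isCont by blast

lemma flux_0:
  shows "\<And>y. 0 < y \<Longrightarrow> (flux 0 has_real_derivative - (2 * weight y / y)) (at y)"
    and "(flux 0 \<longlongrightarrow> 0) at_top"
    and "\<And>y. 0 < y \<Longrightarrow> 0 \<le> flux 0 y"
    and "\<And>y. 0 < y \<Longrightarrow> flux 0 y \<le> slope_bound y * weight y"
proof -
  have T: "\<And>y. 0 < y \<Longrightarrow> (flux 0 has_real_derivative - (2 * weight y / y)) (at y)"
    "(flux 0 \<longlongrightarrow> 0) at_top" "\<And>y. 0 < y \<Longrightarrow> \<bar>flux 0 y\<bar> \<le> envelope y"
  proof -
    have c: "isCont (\<lambda>y. 2 * weight y / y) y" if "0 < y" for y
      using that isCont_weight by (auto intro!: continuous_intros)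
    have le: "\<bar>2 * weight y / y\<bar> \<le> - (- envelope y * (7/2 * y - 4 * \<alpha> + 1 / (2 * y) + 3 / (2 * (1 + y)) + tame_const / (1 + y)\<^sup>2))"
      if "0 < y" for y
    proof -
      have "\<bar>2 * weight y / y\<bar> = 2 * weight y / y" using that by (simp add: abs_mult)
      then show ?thesis using envelope_dominates[OF that] by simp
    qed
    have f: "flux 0 = decaying_primitive (\<lambda>y. 2 * weight y / y)" by (simp add: flux_def)
    note T = decaying_primitive_dominated[OF c envelope_deriv le envelope_lim]
    show "\<And>y. 0 < y \<Longrightarrow> (flux 0 has_real_derivative - (2 * weight y / y)) (at y)"
      "(flux 0 \<longlongrightarrow> 0) at_top" "\<And>y. 0 < y \<Longrightarrow> \<bar>flux 0 y\<bar> \<le> envelope y"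
      unfolding f using T by blast+
  qed
  show "\<And>y. 0 < y \<Longrightarrow> (flux 0 has_real_derivative - (2 * weight y / y)) (at y)" "(flux 0 \<longlongrightarrow> 0) at_top"
    using T by auto
  show "\<And>y. 0 < y \<Longrightarrow> 0 \<le> flux 0 y"
    by (rule decreasing_from_zero_limit_nonneg[OF T(1) _ T(2)]) (auto simp: less_imp_le)
  show "\<And>y. 0 < y \<Longrightarrow> flux 0 y \<le> slope_bound y * weight y"
    using T(3) envelope_le by (meson abs_le_D1 order_trans)
qed

text \<open>
  The inverse of \<open>L\<close> integrates from infinity, so it is of Volterra type: since \<open>height\<close> decreases, its value
  at \<open>y\<close> bounds the integrand on the whole of \<open>[y, \<infinity>)\<close>, and each step gains the factor \<open>height / (k + 1)\<close>.
  Therefore the power series in the spectral parameter converges everywhere.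
\<close>

lemma mode_flux:
  shows "\<And>y. 0 < y \<Longrightarrow> isCont (mode k) y"
    and "\<And>y. 0 < y \<Longrightarrow> 0 \<le> mode k y"
    and "\<And>y. 0 < y \<Longrightarrow> mode k y \<le> height y ^ k / fact k"
    and "\<And>y. 0 < y \<Longrightarrow> (flux k has_real_derivative - (2 * weight y / y * mode k y)) (at y)"
    and "(flux k \<longlongrightarrow> 0) at_top"
    and "\<And>y. 0 < y \<Longrightarrow> 0 \<le> flux k y"
    and "\<And>y. 0 < y \<Longrightarrow> flux k y \<le> height y ^ k / fact k * flux 0 y"
    and "\<And>y. 0 < y \<Longrightarrow> (mode (Suc k) has_real_derivative - (flux k y / weight y)) (at y)"
    and "(mode (Suc k) \<longlongrightarrow> 0) at_top"
proof -
  have F: "(\<forall>y>0. (flux k has_real_derivative - (2 * weight y / y * mode k y)) (at y)) \<and>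
      (flux k \<longlongrightarrow> 0) at_top \<and> (\<forall>y>0. 0 \<le> flux k y \<and> flux k y \<le> height y ^ k / fact k * flux 0 y)"
    if c: "\<forall>y>0. isCont (mode k) y \<and> 0 \<le> mode k y \<and> mode k y \<le> height y ^ k / fact k" for k
  proof -
    define D' where "D' y = real k * height y ^ (k - 1) * - slope_bound y / fact k * flux 0 y
      + - (2 * weight y / y) * (height y ^ k / fact k)" for y
    have D: "((\<lambda>y. height y ^ k / fact k * flux 0 y) has_real_derivative D' y) (at y)" if "0 < y" for y
      using DERIV_mult[OF DERIV_cdivide[OF DERIV_power[OF height_deriv[OF that], of k], of "fact k"] flux_0(1)[OF that]]
      by (simp add: D'_def mult_ac)
    have le: "\<bar>2 * weight y / y * mode k y\<bar> \<le> - D' y" if "0 < y" for y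
    proof -
      have "2 * weight y / y * mode k y \<le> 2 * weight y / y * (height y ^ k / fact k)"
        using c that by (intro mult_left_mono) (auto intro: less_imp_le)
      moreover have "0 \<le> real k * height y ^ (k - 1) * slope_bound y / fact k * flux 0 y"
        using height_bounds[of y] flux_0(3)[OF that] that slope_bound_pos[of y] by (intro mult_nonneg_nonneg divide_nonneg_nonneg) (auto intro: less_imp_le)
      moreover have "0 \<le> 2 * weight y / y * mode k y" using c that weight_pos[of y] by (intro mult_nonneg_nonneg) (auto intro: less_imp_le)
      moreover have "- D' y = real k * height y ^ (k - 1) * slope_bound y / fact k * flux 0 y + 2 * weight y / y * (height y ^ k / fact k)"
        unfolding D'_def using that by (simp add: field_simps)
      ultimately show ?thesis by linarith
    qed
    have lim: "((\<lambda>y. height y ^ k / fact k * flux 0 y) \<longlongrightarrow> 0) at_top"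
      using tendsto_mult[OF tendsto_divide[OF tendsto_power[OF height_lim] tendsto_const] flux_0(2), of "fact k" k] by simp
    have cont: "isCont (\<lambda>y. 2 * weight y / y * mode k y) y" if "0 < y" for y
      using c that isCont_weight by (auto intro!: continuous_intros)
    note T = decaying_primitive_dominated[OF cont D le lim, folded flux_def]
    have "0 \<le> flux k y" if "0 < y" for y
      unfolding flux_def
      by (rule decaying_primitive_nonneg[OF T(1)[unfolded flux_def] T(2)[unfolded flux_def] _ that])
        (use c in \<open>auto intro!: mult_nonneg_nonneg simp: less_imp_le\<close>)
    then show ?thesis using T by (auto dest: abs_le_D1)
  qed
  have M: "(\<forall>y>0. (mode (Suc k) has_real_derivative - (flux k y / weight y)) (at y)) \<and>
      (mode (Suc k) \<longlongrightarrow> 0) at_top \<and> (\<forall>y>0. 0 \<le> mode (Suc k) y \<and> mode (Suc k) y \<le> height y ^ Suc k / fact (Suc k))"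
    if c: "\<forall>y>0. isCont (mode k) y \<and> 0 \<le> mode k y \<and> mode k y \<le> height y ^ k / fact k" for k
  proof -
    note F = F[OF c]
    define D' where "D' y = - (height y ^ k * slope_bound y / fact k)" for y
    have D: "((\<lambda>y. height y ^ Suc k / fact (Suc k)) has_real_derivative D' y) (at y)" if "0 < y" for y
    proof -
      have "((\<lambda>y. height y ^ Suc k / fact (Suc k)) has_real_derivative (real (Suc k) * (height y ^ k * - slope_bound y)) / fact (Suc k)) (at y)"
        using DERIV_cdivide[OF DERIV_power[OF height_deriv[OF that], of "Suc k"], of "fact (Suc k)"] by (simp add: mult_ac)
      moreover have "(real (Suc k) * (height y ^ k * - slope_bound y)) / fact (Suc k) = D' y"
        unfolding D'_def fact_Suc by (simp add: field_simps del: of_nat_Suc)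
      ultimately show ?thesis by (simp only:)
    qed
    have le: "\<bar>flux k y / weight y\<bar> \<le> - D' y" if "0 < y" for y
    proof -
      have "flux k y \<le> height y ^ k / fact k * flux 0 y" using F that by auto
      also have "height y ^ k / fact k * flux 0 y \<le> height y ^ k / fact k * (slope_bound y * weight y)"
        using flux_0(4)[OF that] height_bounds(1)[of y] that by (intro mult_left_mono) auto
      finally have "flux k y / weight y \<le> height y ^ k / fact k * slope_bound y"
        by (simp add: pos_divide_le_eq mult_ac)
      moreover have "0 \<le> flux k y / weight y" using F that by (auto intro: divide_nonneg_pos)
      ultimately show ?thesis unfolding D'_def by (simp add: mult_ac)
    qed
    have lim: "((\<lambda>y. height y ^ Suc k / fact (Suc k)) \<longlongrightarrow> 0) at_top"
      using tendsto_divide[OF tendsto_power[OF height_lim] tendsto_const, of "fact (Suc k)" "Suc k"] by simp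
    have cont: "isCont (\<lambda>y. flux k y / weight y) y" if "0 < y" for y
      using F that isCont_weight DERIV_isCont weight_pos[of y] by (intro isCont_divide) (auto, blast)
    note T = decaying_primitive_dominated[OF cont D le lim, folded mode_Suc]
    have "0 \<le> mode (Suc k) y" if "0 < y" for y
      unfolding mode_Suc
      by (rule decaying_primitive_nonneg[OF T(1)[unfolded mode_Suc] T(2)[unfolded mode_Suc] _ that])
        (use F in \<open>auto intro: divide_nonneg_pos\<close>)
    then show ?thesis using T by (auto dest: abs_le_D1)
  qed
  have C: "\<forall>y>0. isCont (mode k) y \<and> 0 \<le> mode k y \<and> mode k y \<le> height y ^ k / fact k" for k
  proof (induction k)
    case (Suc k)
    from M[OF this] show ?case using DERIV_isCont by blast
  qed auto
  show "\<And>y. 0 < y \<Longrightarrow> isCont (mode k) y" "\<And>y. 0 < y \<Longrightarrow> 0 \<le> mode k y"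
    "\<And>y. 0 < y \<Longrightarrow> mode k y \<le> height y ^ k / fact k" using C[of k] by auto
  show "\<And>y. 0 < y \<Longrightarrow> (flux k has_real_derivative - (2 * weight y / y * mode k y)) (at y)"
    "(flux k \<longlongrightarrow> 0) at_top" "\<And>y. 0 < y \<Longrightarrow> 0 \<le> flux k y"
    "\<And>y. 0 < y \<Longrightarrow> flux k y \<le> height y ^ k / fact k * flux 0 y" using F[OF C[of k]] by auto
  show "\<And>y. 0 < y \<Longrightarrow> (mode (Suc k) has_real_derivative - (flux k y / weight y)) (at y)"
    "(mode (Suc k) \<longlongrightarrow> 0) at_top" using M[OF C[of k]] by auto
qed

definition mode_series :: "(nat \<Rightarrow> real) \<Rightarrow> real \<Rightarrow> real" where
  "mode_series c x = (\<Sum>k. c k * mode k x)"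

definition flux_series :: "(nat \<Rightarrow> real) \<Rightarrow> real \<Rightarrow> real" where
  "flux_series c x = (\<Sum>k. c k * flux k x)"

definition geometric :: "real \<Rightarrow> real \<Rightarrow> (nat \<Rightarrow> real) \<Rightarrow> bool" where
  "geometric b r c \<longleftrightarrow> 0 \<le> b \<and> 0 \<le> r \<and> (\<forall>k. \<bar>c k\<bar> \<le> b * r ^ k)"

text \<open>
  The generator maps the series with coefficients \<open>c\<close> to the series with coefficients \<open>shift c\<close>.
\<close>

definition shift :: "(nat \<Rightarrow> real) \<Rightarrow> nat \<Rightarrow> real" where
  "shift c k = c (Suc k)"

lemma geometric_shift: "geometric b r c \<Longrightarrow> geometric (b * r) r (shift c)"
  by (auto simp: geometric_def shift_def mult_ac) (metis power_Suc mult.assoc mult.commute)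

lemma geometric_terms:
  assumes "geometric b r c" "0 < x"
  shows "\<bar>c k * mode k x\<bar> \<le> b * ((r * height x) ^ k / fact k)"
    and "\<bar>c k * flux k x\<bar> \<le> b * ((r * height x) ^ k / fact k) * flux 0 x"
    and "(r * height x) ^ k / fact k \<le> (r * (2 * slope_const)) ^ k / fact k"
proof -
  have c: "\<bar>c k\<bar> \<le> b * r ^ k" "0 \<le> b" "0 \<le> r" using assms by (auto simp: geometric_def)
  have "\<bar>c k\<bar> * mode k x \<le> b * r ^ k * (height x ^ k / fact k)"
    using c mode_flux(2,3)[OF assms(2)] by (intro mult_mono) auto
  then show "\<bar>c k * mode k x\<bar> \<le> b * ((r * height x) ^ k / fact k)"
    using mode_flux(2)[OF assms(2)] by (simp add: abs_mult power_mult_distrib)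
  have "\<bar>c k\<bar> * flux k x \<le> b * r ^ k * (height x ^ k / fact k * flux 0 x)"
    using c mode_flux(6,7)[OF assms(2)] by (intro mult_mono) auto
  then show "\<bar>c k * flux k x\<bar> \<le> b * ((r * height x) ^ k / fact k) * flux 0 x"
    using mode_flux(6)[OF assms(2)] by (simp add: abs_mult power_mult_distrib)
  show "(r * height x) ^ k / fact k \<le> (r * (2 * slope_const)) ^ k / fact k"
    using c height_bounds[of x] assms by (intro divide_right_mono power_mono mult_left_mono mult_nonneg_nonneg) auto
qed

lemma exp_sums: "(\<lambda>k. x ^ k / fact k) sums exp (x::real)"
  using exp_converges[of x] by (simp add: divide_inverse mult.commute)

lemma geometric_bounds:
  assumes "geometric b r c" "0 < x"
  shows "summable (\<lambda>k. c k * mode k x)" and "summable (\<lambda>k. c k * flux k x)"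
    and "\<bar>mode_series c x\<bar> \<le> b * exp (r * (2 * slope_const))"
    and "\<bar>flux_series c x\<bar> \<le> b * exp (r * (2 * slope_const)) * flux 0 x"
    and "\<bar>mode_series c x - c 0\<bar> \<le> b * (exp (r * height x) - 1)"
proof -
  have c: "0 \<le> b" "0 \<le> r" using assms by (auto simp: geometric_def)
  have E: "(\<lambda>k. b * ((r * height x) ^ k / fact k)) sums (b * exp (r * height x))"
    by (intro sums_mult exp_sums)
  have E2: "(\<lambda>k. b * ((r * height x) ^ k / fact k) * flux 0 x) sums (b * exp (r * height x) * flux 0 x)"
    by (intro sums_mult2 sums_mult exp_sums)
  have le: "exp (r * height x) \<le> exp (r * (2 * slope_const))"
    using c height_bounds[of x] assms by (auto intro: mult_left_mono)
  have abs1: "summable (\<lambda>k. \<bar>c k * mode k x\<bar>)"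
    by (rule summable_comparison_test'[OF sums_summable[OF E], of 0]) (use geometric_terms(1)[OF assms] in auto)
  then show s1: "summable (\<lambda>k. c k * mode k x)" by (rule summable_rabs_cancel)
  have abs2: "summable (\<lambda>k. \<bar>c k * flux k x\<bar>)"
    by (rule summable_comparison_test'[OF sums_summable[OF E2], of 0]) (use geometric_terms(2)[OF assms] in auto)
  then show "summable (\<lambda>k. c k * flux k x)" by (rule summable_rabs_cancel)
  have "\<bar>mode_series c x\<bar> \<le> (\<Sum>k. \<bar>c k * mode k x\<bar>)" unfolding mode_series_def by (rule summable_rabs[OF abs1])
  also have "\<dots> \<le> b * exp (r * height x)"
    unfolding sums_unique[OF E] by (intro suminf_le abs1 sums_summable[OF E] geometric_terms(1)[OF assms])
  also have "\<dots> \<le> b * exp (r * (2 * slope_const))" using le c by (intro mult_left_mono)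
  finally show "\<bar>mode_series c x\<bar> \<le> b * exp (r * (2 * slope_const))" .
  have "\<bar>flux_series c x\<bar> \<le> (\<Sum>k. \<bar>c k * flux k x\<bar>)" unfolding flux_series_def by (rule summable_rabs[OF abs2])
  also have "\<dots> \<le> b * exp (r * height x) * flux 0 x"
    unfolding sums_unique[OF E2] by (intro suminf_le abs2 sums_summable[OF E2] geometric_terms(2)[OF assms])
  also have "\<dots> \<le> b * exp (r * (2 * slope_const)) * flux 0 x"
    using le c flux_0(3)[OF assms(2)] by (intro mult_left_mono mult_right_mono)
  finally show "\<bar>flux_series c x\<bar> \<le> b * exp (r * (2 * slope_const)) * flux 0 x" .
  have m0: "mode_series c x - c 0 = (\<Sum>k. c (Suc k) * mode (Suc k) x)"
    unfolding mode_series_def using suminf_split_head[OF s1] by simp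
  have abs3: "summable (\<lambda>k. \<bar>c (Suc k) * mode (Suc k) x\<bar>)" using abs1 by (subst summable_Suc_iff)
  have "\<bar>\<Sum>k. c (Suc k) * mode (Suc k) x\<bar> \<le> (\<Sum>k. \<bar>c (Suc k) * mode (Suc k) x\<bar>)" by (rule summable_rabs[OF abs3])
  also have "\<dots> \<le> (\<Sum>k. b * ((r * height x) ^ Suc k / fact (Suc k)))"
    by (intro suminf_le abs3 geometric_terms(1)[OF assms]) (use sums_summable[OF E] in \<open>subst summable_Suc_iff\<close>)
  also have "\<dots> = b * exp (r * height x) - b"
    using suminf_split_head[OF sums_summable[OF E]] sums_unique[OF E] by simp
  finally show "\<bar>mode_series c x - c 0\<bar> \<le> b * (exp (r * height x) - 1)" by (simp add: m0 algebra_simps)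
qed


text \<open>
  Termwise differentiation; the derivatives converge uniformly away from \<open>0\<close>.
\<close>

lemma flux_series_deriv:
  assumes g: "geometric b r c" and "0 < x"
  shows "(flux_series c has_real_derivative - (2 * weight x / x * mode_series c x)) (at x)"
proof -
  have c: "0 \<le> b" "0 \<le> r" using g by (auto simp: geometric_def)
  let ?S = "{x/2<..}"
  define B where "B = 2 * exp (16/7 * \<alpha>\<^sup>2) / (x/2)"
  have sm: "summable (\<lambda>k. B * (b * ((r * (2 * slope_const)) ^ k / fact k)))"
    by (intro summable_mult sums_summable[OF exp_sums])
  have w: "2 * weight y / y \<le> B" if "y \<in> ?S" for y
    unfolding B_def using that assms weight_bound[of y] by (intro frac_le) auto
  have unif: "uniformly_convergent_on ?S (\<lambda>n y. \<Sum>k<n. c k * - (2 * weight y / y * mode k y))"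
  proof (rule Weierstrass_m_test'[OF _ sm])
    fix k y assume y: "y \<in> ?S"
    then have "0 < y" using assms by auto
    have "norm (c k * - (2 * weight y / y * mode k y)) = 2 * weight y / y * \<bar>c k * mode k y\<bar>"
      using \<open>0 < y\<close> by (simp add: abs_mult)
    also have "\<dots> \<le> B * (b * ((r * (2 * slope_const)) ^ k / fact k))"
    proof (rule mult_mono[OF w[OF y]])
      show "\<bar>c k * mode k y\<bar> \<le> b * ((r * (2 * slope_const)) ^ k / fact k)"
        using geometric_terms(1,3)[OF g \<open>0 < y\<close>, of k] mult_left_mono[OF geometric_terms(3)[OF g \<open>0 < y\<close>, of k] c(1)] by linarith
    qed (use assms in \<open>auto simp: B_def\<close>)
    finally show "norm (c k * - (2 * weight y / y * mode k y)) \<le> B * (b * ((r * (2 * slope_const)) ^ k / fact k))" .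
  qed
  have "((\<lambda>x. \<Sum>k. c k * flux k x) has_field_derivative (\<Sum>k. c k * - (2 * weight x / x * mode k x))) (at x)"
  proof (rule has_field_derivative_series'(2)[OF _ _ unif])
    show "((\<lambda>x. c k * flux k x) has_real_derivative c k * - (2 * weight y / y * mode k y)) (at y within ?S)"
      if "y \<in> ?S" for k y
      using that assms by (intro DERIV_cmult has_field_derivative_at_within[OF mode_flux(4)]) auto
    show "x \<in> ?S" "x \<in> interior ?S" using assms by (auto simp: interior_open)
    show "summable (\<lambda>k. c k * flux k x)" by (rule geometric_bounds(2)[OF assms])
  qed auto
  moreover have "(\<Sum>k. c k * - (2 * weight x / x * mode k x)) = - (2 * weight x / x * mode_series c x)"
    unfolding mode_series_def using suminf_mult[OF geometric_bounds(1)[OF assms], of "- (2 * weight x / x)"]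
    by (simp add: mult_ac)
  ultimately show ?thesis by (simp add: flux_series_def[abs_def])
qed

lemma mode_series_deriv:
  assumes g: "geometric b r c" and "0 < x"
  shows "(mode_series c has_real_derivative - (flux_series (shift c) x / weight x)) (at x)"
proof -
  note g' = geometric_shift[OF g]
  have c: "0 \<le> b" "0 \<le> r" using g by (auto simp: geometric_def)
  let ?S = "{x/2<..}"
  define B where "B = slope_const / (x/2)"
  have sm: "summable (\<lambda>k. B * (b * r * ((r * (2 * slope_const)) ^ k / fact k)))"
    by (intro summable_mult sums_summable[OF exp_sums])
  define f' where "f' k y = (case k of 0 \<Rightarrow> 0 | Suc j \<Rightarrow> - (c (Suc j) * flux j y / weight y))" for k y
  have d: "((\<lambda>x. c k * mode k x) has_real_derivative f' k y) (at y)" if "0 < y" for k y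
  proof (cases k)
    case 0 then show ?thesis by (simp add: f'_def)
  next
    case (Suc j)
    then show ?thesis using DERIV_cmult[OF mode_flux(8)[OF that, of j], of "c k"]
      by (simp add: f'_def del: mode.simps)
  qed
  have bound: "norm (f' (Suc k) y) \<le> B * (b * r * ((r * (2 * slope_const)) ^ k / fact k))" if y: "y \<in> ?S" for k y
  proof -
    have "0 < y" using y assms by auto
    have "norm (f' (Suc k) y) = \<bar>shift c k * flux k y\<bar> / weight y"
      by (simp add: f'_def abs_mult shift_def)
    also have "\<dots> \<le> b * r * ((r * height y) ^ k / fact k) * flux 0 y / weight y"
      using geometric_terms(2)[OF g' \<open>0 < y\<close>] by (intro divide_right_mono) auto
    also have "\<dots> = b * r * ((r * height y) ^ k / fact k) * (flux 0 y / weight y)" by simp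
    also have "\<dots> \<le> b * r * ((r * (2 * slope_const)) ^ k / fact k) * B"
    proof (intro mult_mono mult_left_mono geometric_terms(3)[OF g \<open>0 < y\<close>])
      have "flux 0 y / weight y \<le> slope_bound y" using flux_0(4)[OF \<open>0 < y\<close>] by (simp add: pos_divide_le_eq)
      also have "\<dots> \<le> slope_const / y" by (rule slope_bound_le(1)[OF \<open>0 < y\<close>])
      also have "\<dots> \<le> B" unfolding B_def using y assms slope_const_pos by (intro divide_left_mono) auto
      finally show "flux 0 y / weight y \<le> B" .
      show "0 \<le> (r * height y) ^ k / fact k" using c height_bounds(1)[of y] \<open>0 < y\<close> by auto
    qed (use c flux_0(3)[OF \<open>0 < y\<close>] in auto)
    finally show ?thesis by (simp add: mult_ac)
  qed
  have unif: "uniformly_convergent_on ?S (\<lambda>n y. \<Sum>k<n. f' k y)"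
  proof (rule Weierstrass_m_test'[where M = "\<lambda>k. case k of 0 \<Rightarrow> 0 | Suc k \<Rightarrow> B * (b * r * ((r * (2 * slope_const)) ^ k / fact k))"])
    show "norm (f' k y) \<le> (case k of 0 \<Rightarrow> 0 | Suc k \<Rightarrow> B * (b * r * ((r * (2 * slope_const)) ^ k / fact k)))" if "y \<in> ?S" for k y
      using bound[OF that] by (cases k) (auto simp: f'_def)
    show "summable (\<lambda>k. case k of 0 \<Rightarrow> 0 | Suc k \<Rightarrow> B * (b * r * ((r * (2 * slope_const)) ^ k / fact k)))"
      using sm by (subst summable_Suc_iff[symmetric]) simp
  qed
  have D: "((\<lambda>x. \<Sum>k. c k * mode k x) has_field_derivative (\<Sum>k. f' k x)) (at x)"
  proof (rule has_field_derivative_series'(2)[OF _ _ unif])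
    show "((\<lambda>x. c k * mode k x) has_real_derivative f' k y) (at y within ?S)"
      if "y \<in> ?S" for k y
      using that assms by (intro has_field_derivative_at_within[OF d]) auto
    show "x \<in> ?S" "x \<in> interior ?S" using assms by (auto simp: interior_open)
    show "summable (\<lambda>k. c k * mode k x)" by (rule geometric_bounds(1)[OF assms])
  qed auto
  have e: "f' (Suc k) x = - (1 / weight x) * (shift c k * flux k x)" for k
    by (simp add: f'_def shift_def)
  have s: "summable (\<lambda>k. f' (Suc k) x)"
    unfolding e by (intro summable_mult geometric_bounds(2)[OF g' assms(2)])
  then have "(\<Sum>k. f' k x) = (\<Sum>k. f' (Suc k) x)"
    using suminf_split_head[of "\<lambda>k. f' k x"] by (subst (asm) summable_Suc_iff) (auto simp: f'_def)
  also have "\<dots> = - (1 / weight x) * flux_series (shift c) x"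
    unfolding e flux_series_def by (intro suminf_mult geometric_bounds(2)[OF g' assms(2)])
  finally show ?thesis using D by (simp add: mode_series_def[abs_def])
qed

lemma mode_series_lim: assumes "geometric b r c" shows "(mode_series c \<longlongrightarrow> c 0) at_top"
proof -
  have "((\<lambda>x. b * (exp (r * height x) - 1)) \<longlongrightarrow> b * (exp (r * 0) - 1)) at_top"
    by (intro tendsto_intros height_lim)
  then have L: "((\<lambda>x. b * (exp (r * height x) - 1)) \<longlongrightarrow> 0) at_top" by simp
  have "((\<lambda>x. mode_series c x - c 0) \<longlongrightarrow> 0) at_top"
    by (rule Lim_null_comparison[OF _ L], rule eventually_mono[OF eventually_gt_at_top[of 0]])
       (use geometric_bounds(5)[OF assms] in auto)
  then show ?thesis by (simp add: LIM_zero_iff)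
qed

lemma flux_series_lim: assumes "geometric b r c" shows "(flux_series c \<longlongrightarrow> 0) at_top"
proof -
  have L: "((\<lambda>x. b * exp (r * (2 * slope_const)) * flux 0 x) \<longlongrightarrow> 0) at_top"
    using tendsto_mult[OF tendsto_const flux_0(2), of "b * exp (r * (2 * slope_const))"] by simp
  show ?thesis
    by (rule Lim_null_comparison[OF _ L], rule eventually_mono[OF eventually_gt_at_top[of 0]])
       (use geometric_bounds(4)[OF assms] in auto)
qed


text \<open>
  A solution of \<open>L f = g\<close> that is bounded and continuous up to \<open>0\<close>, with the growth of its derivatives
  recorded. At \<open>0\<close> the first derivative may have a logarithmic singularity, so \<open>f\<close> need not be differentiable there;
  at infinity it is at most of order \<open>1 / x^2\<close>, which balances the quadratic drift.
\<close>

definition generator_solution :: "(real \<Rightarrow> real) \<Rightarrow> (real \<Rightarrow> real) \<Rightarrow> bool" where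
  "generator_solution f g \<longleftrightarrow> (\<exists>f1 f2 f3 C. 0 \<le> C \<and> continuous_on {0..} f \<and> (\<forall>x\<ge>0. \<bar>f x\<bar> \<le> C) \<and>
     (\<forall>x>0. (f has_real_derivative f1 x) (at x) \<and> (f1 has_real_derivative f2 x) (at x) \<and>
        (f2 has_real_derivative f3 x) (at x) \<and>
        \<bar>f1 x\<bar> \<le> C / x \<and> \<bar>f1 x\<bar> \<le> C / x\<^sup>2 \<and> \<bar>f2 x\<bar> \<le> C / x \<and> \<bar>f3 x\<bar> \<le> C * (1 / x\<^sup>2 + 1) \<and>
        x / 2 * f2 x + (2 * \<alpha> * x - 7/4 * x\<^sup>2) * f1 x = g x))"

definition series_solution :: "(nat \<Rightarrow> real) \<Rightarrow> real \<Rightarrow> real" where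
  "series_solution c x = (if x \<le> 0 then Lim (at_right 0) (mode_series c) else mode_series c x)"

lemma mode_series_deriv_bound:
  assumes "geometric b r c" "0 < x"
  shows "\<bar>flux_series (shift c) x / weight x\<bar> \<le> b * r * exp (r * (2 * slope_const)) * slope_bound x"
proof -
  have c: "0 \<le> b" "0 \<le> r" using assms by (auto simp: geometric_def)
  have "\<bar>flux_series (shift c) x / weight x\<bar> \<le> b * r * exp (r * (2 * slope_const)) * flux 0 x / weight x"
    using geometric_bounds(4)[OF geometric_shift[OF assms(1)] assms(2)] by (simp add: divide_right_mono)
  also have "\<dots> \<le> b * r * exp (r * (2 * slope_const)) * (slope_bound x * weight x) / weight x"
    using flux_0(4)[OF assms(2)] c by (intro divide_right_mono mult_left_mono) auto
  finally show ?thesis by simp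
qed

text \<open>
  The derivative is at most a multiple of \<open>slope_bound\<close>. Hence adding a multiple of \<open>height\<close> makes the
  series decreasing, and a bounded monotone function has a limit at \<open>0\<close>.
\<close>

lemma mode_series_lim_0:
  assumes "geometric b r c"
  shows "(mode_series c \<longlongrightarrow> series_solution c 0) (at_right 0)"
proof -
  define K where "K = b * r * exp (r * (2 * slope_const))"
  have K: "0 \<le> K" using assms by (auto simp: geometric_def K_def)
  have mono: "mode_series c y + K * height y \<le> mode_series c x + K * height x" if "0 < x" "x \<le> y" for x y
  proof (rule DERIV_nonpos_imp_nonincreasing[OF that(2)])
    fix z assume z: "x \<le> z" "z \<le> y"
    then have "0 < z" using that by auto
    have "((\<lambda>x. mode_series c x + K * height x) has_real_derivative - (flux_series (shift c) z / weight z) + K * - slope_bound z) (at z)"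
      by (intro DERIV_add DERIV_cmult mode_series_deriv[OF assms \<open>0 < z\<close>] height_deriv[OF \<open>0 < z\<close>])
    moreover have "- (flux_series (shift c) z / weight z) + K * - slope_bound z \<le> 0"
      using mode_series_deriv_bound[OF assms \<open>0 < z\<close>, folded K_def] by linarith
    ultimately show "\<exists>l. ((\<lambda>x. mode_series c x + K * height x) has_real_derivative l) (at z) \<and> l \<le> 0" by blast
  qed
  have "\<exists>l. ((\<lambda>t. - (mode_series c (inverse t) + K * height (inverse t))) \<longlongrightarrow> l) at_top"
  proof (rule decreasing_bounded_below_convergent_at_top[of 1 _ "- (b * exp (r * (2 * slope_const)) + K * (2 * slope_const))"])
    fix x y :: real assume xy: "1 \<le> x" "x \<le> y"
    then show "- (mode_series c (inverse y) + K * height (inverse y)) \<le> - (mode_series c (inverse x) + K * height (inverse x))"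
      using mono[of "inverse y" "inverse x"] by (simp add: le_imp_inverse_le)
  next
    fix x :: real assume "1 \<le> x"
    then have x: "0 < inverse x" by simp
    have "K * height (inverse x) \<le> K * (2 * slope_const)"
      using height_bounds(2)[of "inverse x"] x K by (intro mult_left_mono) auto
    then show "- (b * exp (r * (2 * slope_const)) + K * (2 * slope_const)) \<le> - (mode_series c (inverse x) + K * height (inverse x))"
      using geometric_bounds(3)[OF assms x] by linarith
  qed
  then obtain l where l: "((\<lambda>t. - (mode_series c (inverse t) + K * height (inverse t))) \<longlongrightarrow> l) at_top" by blast
  have 1: "((\<lambda>x. - (mode_series c x + K * height x)) \<longlongrightarrow> l) (at_right 0)"
    using filterlim_compose[OF l filterlim_inverse_at_top_right] by simp
  have 2: "(height \<longlongrightarrow> 2 * slope_const) (at_right 0)"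
    unfolding height_def[abs_def] by (auto intro!: tendsto_eq_intros)
  have "((\<lambda>x. - (- (mode_series c x + K * height x)) - K * height x) \<longlongrightarrow> - l - K * (2 * slope_const)) (at_right 0)"
    by (intro tendsto_intros 1 2)
  then have "(mode_series c \<longlongrightarrow> - l - K * (2 * slope_const)) (at_right 0)" by simp
  then show ?thesis unfolding series_solution_def using tendsto_Lim[of "at_right 0" "mode_series c"] by simp
qed

lemma series_solution_bound:
  assumes "geometric b r c" shows "\<bar>series_solution c x\<bar> \<le> b * exp (r * (2 * slope_const))"
proof (cases "x \<le> 0")
  case True
  have "((\<lambda>x. \<bar>mode_series c x\<bar>) \<longlongrightarrow> \<bar>series_solution c 0\<bar>) (at_right 0)"
    by (intro tendsto_intros mode_series_lim_0[OF assms])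
  then have "\<bar>series_solution c 0\<bar> \<le> b * exp (r * (2 * slope_const))"
    by (rule tendsto_upperbound)
       (use geometric_bounds(3)[OF assms] in \<open>auto intro!: eventually_at_rightI[of 0 1]\<close>)
  then show ?thesis using True by (simp add: series_solution_def)
qed (use geometric_bounds(3)[OF assms] in \<open>simp add: series_solution_def\<close>)

lemma continuous_on_series_solution:
  assumes "geometric b r c" shows "continuous_on {0..} (series_solution c)"
proof -
  have "continuous (at x within {0..}) (series_solution c)" if "0 \<le> x" for x
  proof (cases "x = 0")
    case True
    have "(series_solution c \<longlongrightarrow> series_solution c 0) (at_right 0)"
      by (rule Lim_transform_eventually[OF mode_series_lim_0[OF assms]])
         (auto simp: series_solution_def eventually_at_filter)
    then show ?thesis unfolding True continuous_within at_within_Ici_at_right .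
  next
    case False
    then have "0 < x" using that by simp
    have "isCont (mode_series c) x" using mode_series_deriv[OF assms \<open>0 < x\<close>] DERIV_isCont by blast
    moreover have "\<forall>\<^sub>F y in nhds x. series_solution c y = mode_series c y"
      using eventually_gt_at_top order_tendstoD(1)[OF tendsto_ident_at \<open>0 < x\<close>] 
      by (intro eventually_nhds_in_open[of "{0<..}" x, THEN eventually_mono]) (use \<open>0 < x\<close> in \<open>auto simp: series_solution_def\<close>)
    ultimately have "isCont (series_solution c) x" by (subst isCont_cong)
    then show ?thesis by (rule continuous_at_imp_continuous_at_within)
  qed
  then show ?thesis by (auto simp: continuous_on_eq_continuous_within)
qed

lemma div_const_mono: "0 \<le> a \<Longrightarrow> a \<le> b \<Longrightarrow> 0 < x \<Longrightarrow> (u::real) \<le> a / x \<Longrightarrow> u \<le> b / x"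
  by (meson divide_right_mono less_imp_le order_trans)

lemma generator_solution_series_solution:
  assumes g: "geometric b r c"
  shows "generator_solution (series_solution c) (mode_series (shift c))"
proof -
  have br: "0 \<le> b" "0 \<le> r" using g by (auto simp: geometric_def)
  note g' = geometric_shift[OF g] and g'' = geometric_shift[OF geometric_shift[OF g]]
  define E where "E = exp (r * (2 * slope_const))"
  have E: "0 \<le> E" by (simp add: E_def)
  define f1 where "f1 x = - (flux_series (shift c) x / weight x)" for x
  define f2 where "f2 x = 2 / x * mode_series (shift c) x - (4 * \<alpha> - 7/2 * x) * f1 x" for x
  define f3 where "f3 x = - 2 / x\<^sup>2 * mode_series (shift c) x + 2 / x * - (flux_series (shift (shift c)) x / weight x)
     + 7/2 * f1 x - (4 * \<alpha> - 7/2 * x) * f2 x" for x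
  define C1 where "C1 = b * r * E * slope_const"
  define C0 where "C0 = b * r * E"
  define C2 where "C2 = 2 * C0 + (4 * \<bar>\<alpha>\<bar> + 4) * C1"
  define C0' where "C0' = b * r * r * E * slope_const"
  define C3 where "C3 = 2 * C0 + 2 * C0' + 4 * C1 + (4 * \<bar>\<alpha>\<bar> + 4) * C2"
  have C: "0 \<le> C0" "0 \<le> C1" "0 \<le> C2" "0 \<le> C0'" "0 \<le> C3"
    using br E by (auto simp: C0_def C1_def C2_def C3_def C0'_def)
  have d1: "(series_solution c has_real_derivative f1 x) (at x)" if "0 < x" for x
    unfolding f1_def
    by (rule has_field_derivative_transform_within[OF mode_series_deriv[OF g that] that])
       (use that in \<open>auto simp: series_solution_def dist_real_def\<close>)
  have d2: "(f1 has_real_derivative f2 x) (at x)" if "0 < x" for x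
  proof -
    have "(f1 has_real_derivative - ((- (2 * weight x / x * mode_series (shift c) x) * weight x
        - flux_series (shift c) x * ((4 * \<alpha> - 7/2 * x) * weight x)) / (weight x * weight x))) (at x)"
      unfolding f1_def[abs_def]
      by (intro DERIV_minus DERIV_divide flux_series_deriv[OF g' that] weight_deriv) simp
    moreover have "- ((- (2 * weight x / x * mode_series (shift c) x) * weight x
        - flux_series (shift c) x * ((4 * \<alpha> - 7/2 * x) * weight x)) / (weight x * weight x)) = f2 x"
      using that by (simp add: f2_def f1_def field_simps)
    ultimately show ?thesis by simp
  qed
  have d3: "(f2 has_real_derivative f3 x) (at x)" if "0 < x" for x
  proof -
    have a: "((\<lambda>x. 2 / x) has_real_derivative - 2 / x\<^sup>2) (at x)"
      using that by (auto intro!: derivative_eq_intros simp: power2_eq_square)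
    have b: "((\<lambda>x. 4 * \<alpha> - 7/2 * x) has_real_derivative - (7/2)) (at x)"
      by (auto intro!: derivative_eq_intros)
    show ?thesis
      using DERIV_diff[OF DERIV_mult[OF a mode_series_deriv[OF g' that]] DERIV_mult[OF b d2[OF that]]]
      by (simp add: f2_def[abs_def] f3_def algebra_simps)
  qed
  have f1: "\<bar>f1 x\<bar> \<le> C1 / x" "\<bar>f1 x\<bar> \<le> C1 / x\<^sup>2" if "0 < x" for x
  proof -
    have "\<bar>f1 x\<bar> \<le> C0 * slope_bound x"
      using mode_series_deriv_bound[OF g that] by (simp add: f1_def C0_def E_def)
    moreover have "C0 * slope_bound x \<le> C0 * (slope_const / x)" "C0 * slope_bound x \<le> C0 * (slope_const / x\<^sup>2)"
      by (rule mult_left_mono[OF slope_bound_le(1)[OF that] C(1)], rule mult_left_mono[OF slope_bound_le(2)[OF that] C(1)])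
    ultimately show "\<bar>f1 x\<bar> \<le> C1 / x" "\<bar>f1 x\<bar> \<le> C1 / x\<^sup>2" by (auto simp: C1_def C0_def)
  qed
  have dr: "\<bar>(4 * \<alpha> - 7/2 * x) * u\<bar> \<le> 4 * \<bar>\<alpha>\<bar> * \<bar>u\<bar> + 4 * (x * \<bar>u\<bar>)" if "0 < x" for x u
  proof -
    have "\<bar>4 * \<alpha> - 7/2 * x\<bar> \<le> 4 * \<bar>\<alpha>\<bar> + 4 * x" using that by linarith
    then have "\<bar>4 * \<alpha> - 7/2 * x\<bar> * \<bar>u\<bar> \<le> (4 * \<bar>\<alpha>\<bar> + 4 * x) * \<bar>u\<bar>" by (intro mult_right_mono) auto
    then show ?thesis by (simp only: abs_mult distrib_right mult.assoc)
  qed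
  have m: "\<bar>mode_series (shift c) x\<bar> \<le> C0" if "0 < x" for x
    using geometric_bounds(3)[OF g' that] by (simp add: C0_def E_def)
  have f2: "\<bar>f2 x\<bar> \<le> C2 / x" if "0 < x" for x
  proof -
    have "\<bar>f2 x\<bar> \<le> \<bar>2 / x * mode_series (shift c) x\<bar> + \<bar>(4 * \<alpha> - 7/2 * x) * f1 x\<bar>"
      unfolding f2_def by (rule abs_triangle_ineq4)
    also have "\<bar>2 / x * mode_series (shift c) x\<bar> \<le> 2 / x * C0"
      unfolding abs_mult using m[OF that] that by (intro mult_mono) auto
    also have "\<bar>(4 * \<alpha> - 7/2 * x) * f1 x\<bar> \<le> 4 * \<bar>\<alpha>\<bar> * (C1 / x) + 4 * (x * (C1 / x\<^sup>2))"
      using dr[OF that, of "f1 x"] f1[OF that] mult_left_mono[OF f1(1)[OF that], of "4 * \<bar>\<alpha>\<bar>"]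
        mult_left_mono[OF f1(2)[OF that], of x] that by linarith
    also have "2 / x * C0 + (4 * \<bar>\<alpha>\<bar> * (C1 / x) + 4 * (x * (C1 / x\<^sup>2))) = C2 / x"
      using that by (simp add: C2_def field_simps power2_eq_square)
    finally show ?thesis by simp
  qed
  have f3: "\<bar>f3 x\<bar> \<le> C3 * (1 / x\<^sup>2 + 1)" if "0 < x" for x
  proof -
    have inv: "1 / x \<le> 1 / x\<^sup>2 + 1"
    proof (cases "x \<le> 1")
      case True
      then have "1 / x \<le> 1 / x\<^sup>2" using that by (intro divide_left_mono) (auto simp: power2_eq_square mult_le_cancel_right1)
      then show ?thesis by simp
    next
      case False
      then have "1 / x \<le> 1" by simp
      then show ?thesis by (meson add_increasing zero_le_divide_1_iff zero_le_power2)
    qed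
    have pos: "0 \<le> 1 / x\<^sup>2" by simp
    have fs: "\<bar>flux_series (shift (shift c)) x / weight x\<bar> \<le> C0' / x"
    proof -
      have "\<bar>flux_series (shift (shift c)) x / weight x\<bar> \<le> b * r * r * E * slope_bound x"
        using mode_series_deriv_bound[OF g' that] by (simp add: E_def)
      also have "\<dots> \<le> b * r * r * E * (slope_const / x)" using slope_bound_le(1)[OF that] br E by (intro mult_left_mono) auto
      finally show ?thesis by (simp add: C0'_def)
    qed
    have t1: "\<bar>- 2 / x\<^sup>2 * mode_series (shift c) x\<bar> \<le> 2 * C0 * (1 / x\<^sup>2)"
    proof -
      have "\<bar>- 2 / x\<^sup>2 * mode_series (shift c) x\<bar> = 2 / x\<^sup>2 * \<bar>mode_series (shift c) x\<bar>" by (simp add: abs_mult)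
      also have "\<dots> \<le> 2 / x\<^sup>2 * C0" using m[OF that] by (intro mult_left_mono) auto
      finally show ?thesis by simp
    qed
    have t2: "\<bar>2 / x * - (flux_series (shift (shift c)) x / weight x)\<bar> \<le> 2 * C0' * (1 / x\<^sup>2)"
    proof -
      have "\<bar>2 / x * - (flux_series (shift (shift c)) x / weight x)\<bar> = 2 / x * \<bar>flux_series (shift (shift c)) x / weight x\<bar>"
        using that by (simp add: abs_mult)
      also have "\<dots> \<le> 2 / x * (C0' / x)" using fs that by (intro mult_left_mono) auto
      finally show ?thesis by (simp add: power2_eq_square)
    qed
    have t3: "\<bar>7/2 * f1 x\<bar> \<le> 4 * C1 * (1 / x\<^sup>2)"
      using f1(2)[OF that] C(2) that by (simp add: abs_mult)
    have t4: "\<bar>(4 * \<alpha> - 7/2 * x) * f2 x\<bar> \<le> (4 * \<bar>\<alpha>\<bar> + 4) * C2 * (1 / x\<^sup>2 + 1)"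
    proof -
      have "4 * \<bar>\<alpha>\<bar> * \<bar>f2 x\<bar> \<le> 4 * \<bar>\<alpha>\<bar> * (C2 / x)" using f2[OF that] by (intro mult_left_mono) auto
      also have "\<dots> \<le> 4 * \<bar>\<alpha>\<bar> * C2 * (1 / x\<^sup>2 + 1)"
        using mult_left_mono[OF inv, of "4 * \<bar>\<alpha>\<bar> * C2"] C by simp
      finally have 1: "4 * \<bar>\<alpha>\<bar> * \<bar>f2 x\<bar> \<le> 4 * \<bar>\<alpha>\<bar> * C2 * (1 / x\<^sup>2 + 1)" .
      have "x * \<bar>f2 x\<bar> \<le> C2" using f2[OF that] that by (simp add: field_simps)
      also have "C2 \<le> C2 * (1 / x\<^sup>2 + 1)" using mult_left_mono[of 1 "1 / x\<^sup>2 + 1" C2] C by simp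
      finally have 2: "x * \<bar>f2 x\<bar> \<le> C2 * (1 / x\<^sup>2 + 1)" .
      have "(4 * \<bar>\<alpha>\<bar> + 4) * C2 * (1 / x\<^sup>2 + 1) = 4 * \<bar>\<alpha>\<bar> * C2 * (1 / x\<^sup>2 + 1) + 4 * (C2 * (1 / x\<^sup>2 + 1))"
        by (simp add: algebra_simps)
      then show ?thesis using dr[OF that, of "f2 x"] 1 2 by linarith
    qed
    have "\<bar>f3 x\<bar> \<le> 2 * C0 * (1 / x\<^sup>2) + 2 * C0' * (1 / x\<^sup>2) + 4 * C1 * (1 / x\<^sup>2) + (4 * \<bar>\<alpha>\<bar> + 4) * C2 * (1 / x\<^sup>2 + 1)"
      unfolding f3_def using t1 t2 t3 t4 by linarith
    also have "\<dots> \<le> C3 * (1 / x\<^sup>2 + 1)"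
      using C by (simp add: C3_def algebra_simps)
    finally show ?thesis .
  qed
  define C where "C = b * E + C1 + C2 + C3"
  have Cs: "0 \<le> C" "b * E \<le> C" "C1 \<le> C" "C2 \<le> C" "C3 \<le> C"
    unfolding C_def using C br E by auto
  show ?thesis unfolding generator_solution_def
  proof (rule exI[of _ f1], rule exI[of _ f2], rule exI[of _ f3], rule exI[of _ C], intro conjI allI impI)
    show "\<bar>series_solution c x\<bar> \<le> C" for x using series_solution_bound[OF g, of x] Cs by (simp add: E_def)
    fix x :: real assume x: "0 < x"
    show "\<bar>f1 x\<bar> \<le> C / x" "\<bar>f2 x\<bar> \<le> C / x"
      using div_const_mono[OF _ _ x f1(1)[OF x]] div_const_mono[OF _ _ x f2[OF x]] Cs C by auto
    show "\<bar>f1 x\<bar> \<le> C / x\<^sup>2" using div_const_mono[OF _ _ _ f1(2)[OF x]] Cs C x by auto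
    have "0 \<le> 1 / x\<^sup>2" by simp
    then show "\<bar>f3 x\<bar> \<le> C * (1 / x\<^sup>2 + 1)"
      using f3[OF x] mult_right_mono[OF Cs(5), of "1 / x\<^sup>2 + 1"] by linarith
    show "x / 2 * f2 x + (2 * \<alpha> * x - 7/4 * x\<^sup>2) * f1 x = mode_series (shift c) x"
      using x by (simp add: f2_def field_simps power2_eq_square)
  qed (use d1 d2 d3 Cs continuous_on_series_solution[OF g] in auto)
qed


text \<open>
  A constant minus the first mode. Up to an additive constant this is the expected absorption time of the
  diffusion as a function of its starting point.
\<close>

lemma bounded_lyapunov_exists: "\<exists>A. generator_solution A (\<lambda>_. -1) \<and> (\<forall>x\<ge>0. 0 \<le> A x)"
proof -
  define c :: "nat \<Rightarrow> real" where "c = (\<lambda>k. if k = 0 then 2 * slope_const else if k = 1 then -1 else 0)"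
  have g: "geometric (2 * slope_const + 1) 1 c" by (auto simp: geometric_def c_def)
  have sh: "mode_series (shift c) x = -1" if "0 < x" for x
  proof -
    have "(\<Sum>k. shift c k * mode k x) = (\<Sum>k\<in>{0}. shift c k * mode k x)"
      by (rule suminf_finite) (auto simp: shift_def c_def)
    then show ?thesis by (simp add: mode_series_def shift_def c_def)
  qed
  have "generator_solution (series_solution c) (\<lambda>_. -1)"
    using generator_solution_series_solution[OF g] sh unfolding generator_solution_def by (auto cong: conj_cong) 
  moreover have "0 \<le> series_solution c x" if "0 \<le> x" for x
  proof -
    have m: "0 \<le> mode_series c x" if "0 < x" for x
    proof -
      have "(\<Sum>k. c k * mode k x) = (\<Sum>k\<in>{0,1}. c k * mode k x)"
        by (rule suminf_finite) (auto simp: c_def)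
      then have "mode_series c x = 2 * slope_const - mode 1 x" by (simp add: mode_series_def c_def)
      moreover have "mode 1 x \<le> 2 * slope_const"
        using mode_flux(3)[OF that, of 1] height_bounds(2)[of x] that by simp
      ultimately show ?thesis by simp
    qed
    have "0 \<le> series_solution c 0"
      by (rule tendsto_lowerbound[OF mode_series_lim_0[OF g]]) (use m in \<open>auto intro!: eventually_at_rightI[of 0 1]\<close>)
    then show ?thesis using m[of x] that by (cases "x = 0") (auto simp: series_solution_def)
  qed
  ultimately show ?thesis by blast
qed

text \<open>
  Splitting the coefficients \<open>(- i \<theta>) ^ k\<close> of \<open>\<phi>\<close> into real and imaginary parts keeps all series real.
\<close>

definition re_coeff :: "real \<Rightarrow> nat \<Rightarrow> real" where "re_coeff \<theta> k = Re ((- \<i> * complex_of_real \<theta>) ^ k)"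
definition im_coeff :: "real \<Rightarrow> nat \<Rightarrow> real" where "im_coeff \<theta> k = Im ((- \<i> * complex_of_real \<theta>) ^ k)"

lemma geometric_re_coeff: "geometric 1 \<bar>\<theta>\<bar> (re_coeff \<theta>)" and geometric_im_coeff: "geometric 1 \<bar>\<theta>\<bar> (im_coeff \<theta>)"
  using abs_Re_le_cmod[of "(- \<i> * complex_of_real \<theta>) ^ k" for k]
    abs_Im_le_cmod[of "(- \<i> * complex_of_real \<theta>) ^ k" for k]
  by (auto simp: geometric_def re_coeff_def im_coeff_def norm_power norm_mult)

lemma shift_re_coeff: "shift (re_coeff \<theta>) = (\<lambda>k. \<theta> * im_coeff \<theta> k)" and shift_im_coeff: "shift (im_coeff \<theta>) = (\<lambda>k. - \<theta> * re_coeff \<theta> k)"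
  by (auto simp: shift_def re_coeff_def im_coeff_def fun_eq_iff)

lemma mode_series_cmult: "geometric b r c \<Longrightarrow> 0 < x \<Longrightarrow> mode_series (\<lambda>k. a * c k) x = a * mode_series c x"
  unfolding mode_series_def using suminf_mult[OF geometric_bounds(1), of b r c x a] by (simp add: mult.assoc)

lemma flux_0_pos: assumes "0 < x" shows "0 < flux 0 x"
proof -
  have "flux 0 (x + 1) < flux 0 x"
  proof (rule DERIV_neg_imp_decreasing[of x "x + 1" "flux 0"])
    fix y assume "x \<le> y" "y \<le> x + 1"
    then show "\<exists>l. (flux 0 has_real_derivative l) (at y) \<and> l < 0"
      using assms flux_0(1)[of y] by (intro exI[of _ "- (2 * weight y / y)"]) auto
  qed simp
  then show ?thesis using flux_0(3)[of "x + 1"] assms by simp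
qed

lemma flux_0_antimono: assumes "0 < x" "x \<le> y" shows "flux 0 y \<le> flux 0 x"
proof (rule DERIV_nonpos_imp_nonincreasing[OF assms(2)])
  fix z assume "x \<le> z" "z \<le> y"
  then show "\<exists>l. (flux 0 has_real_derivative l) (at z) \<and> l \<le> 0"
    using assms flux_0(1)[of z] by (intro exI[of _ "- (2 * weight z / z)"]) auto
qed

definition sq_modulus :: "real \<Rightarrow> real \<Rightarrow> real" where
  "sq_modulus \<theta> x = (mode_series (re_coeff \<theta>) x)\<^sup>2 + (mode_series (im_coeff \<theta>) x)\<^sup>2"

text \<open>
  Write \<open>\<phi> = X + i Y\<close> and \<open>q\<close> for its squared modulus. Because \<open>L \<phi> = - i \<theta> \<phi>\<close>, the function \<open>(weight * q')'\<close> equals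
  \<open>2 * weight\<close> times the squared modulus of \<open>\<phi>'\<close>; as \<open>En = - weight * q' / 2\<close> vanishes at infinity,
  \<open>q\<close> decreases to \<open>1\<close>. The weighted angular momentum \<open>Z\<close> of \<open>\<phi>\<close> has derivative \<open>2 * weight / x * \<theta> * q\<close>, so it is at
  least \<open>abs \<theta> * flux 0\<close> in modulus. By the Cauchy-Schwarz inequality the modulus of \<open>weight * \<phi>'\<close> is at least
  \<open>abs \<theta> * flux 0 / sqrt q\<close>. Integrating twice between \<open>1\<close> and \<open>3\<close>, the drop of \<open>q\<close> is at least of order
  \<open>\<theta>^2 / q 1\<close>, whence \<open>(q 1)^2\<close> is at least of order \<open>\<theta>^2\<close>.
\<close>

lemma modulus_growth:
  fixes \<theta> :: real
  defines "\<kappa> \<equiv> 2 * (flux 0 3)\<^sup>2 / (exp (16/7 * \<alpha>\<^sup>2))\<^sup>2"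
  shows "\<And>x. 0 < x \<Longrightarrow> 1 \<le> sq_modulus \<theta> x" and "\<And>x y. 0 < x \<Longrightarrow> x \<le> y \<Longrightarrow> sq_modulus \<theta> y \<le> sq_modulus \<theta> x"
    and "\<kappa> * \<theta>\<^sup>2 \<le> (sq_modulus \<theta> 1)\<^sup>2"
proof -
  define X where "X = mode_series (re_coeff \<theta>)"
  define Y where "Y = mode_series (im_coeff \<theta>)"
  define P where "P = flux_series (shift (re_coeff \<theta>))"
  define Q where "Q = flux_series (shift (im_coeff \<theta>))"
  have X': "(X has_real_derivative - (P x / weight x)) (at x)" if "0 < x" for x
    unfolding X_def P_def by (rule mode_series_deriv[OF geometric_re_coeff that])
  have Y': "(Y has_real_derivative - (Q x / weight x)) (at x)" if "0 < x" for x
    unfolding Y_def Q_def by (rule mode_series_deriv[OF geometric_im_coeff that])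
  have P': "(P has_real_derivative - (2 * weight x / x * (\<theta> * Y x))) (at x)" if "0 < x" for x
    using flux_series_deriv[OF geometric_shift[OF geometric_re_coeff] that, of \<theta>] mode_series_cmult[OF geometric_im_coeff that, of \<theta> \<theta>]
    by (simp add: P_def Y_def shift_re_coeff)
  have Q': "(Q has_real_derivative - (2 * weight x / x * (- \<theta> * X x))) (at x)" if "0 < x" for x
    using flux_series_deriv[OF geometric_shift[OF geometric_im_coeff] that, of \<theta>] mode_series_cmult[OF geometric_re_coeff that, of "- \<theta>" \<theta>]
    by (simp add: Q_def X_def shift_im_coeff)
  have lims: "(X \<longlongrightarrow> 1) at_top" "(Y \<longlongrightarrow> 0) at_top" "(P \<longlongrightarrow> 0) at_top" "(Q \<longlongrightarrow> 0) at_top"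
    using mode_series_lim[OF geometric_re_coeff, of \<theta>] mode_series_lim[OF geometric_im_coeff, of \<theta>]
      flux_series_lim[OF geometric_shift[OF geometric_re_coeff], of \<theta>] flux_series_lim[OF geometric_shift[OF geometric_im_coeff], of \<theta>]
    by (simp_all add: X_def Y_def P_def Q_def re_coeff_def im_coeff_def)
  define En where "En x = X x * P x + Y x * Q x" for x
  have En': "(En has_real_derivative - (((P x)\<^sup>2 + (Q x)\<^sup>2) / weight x)) (at x)" if "0 < x" for x
    unfolding En_def[abs_def]
    using DERIV_add[OF DERIV_mult[OF X'[OF that] P'[OF that]] DERIV_mult[OF Y'[OF that] Q'[OF that]]]
    by (rule DERIV_cong) (simp add: power2_eq_square add_divide_distrib algebra_simps)
  have En0: "0 \<le> En x" if "0 < x" for x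
  proof (rule decreasing_from_zero_limit_nonneg[OF En' _ _ that])
    show "- (((P y)\<^sup>2 + (Q y)\<^sup>2) / weight y) \<le> 0" for y by simp
    have "(En \<longlongrightarrow> 1 * 0 + 0 * 0) at_top"
      unfolding En_def[abs_def] by (intro tendsto_intros lims)
    then show "(En \<longlongrightarrow> 0) at_top" by simp
  qed
  define q where "q = sq_modulus \<theta>"
  have q_eq: "q x = (X x)\<^sup>2 + (Y x)\<^sup>2" for x by (simp add: q_def sq_modulus_def X_def Y_def)
  have q': "(q has_real_derivative - (2 * En x / weight x)) (at x)" if "0 < x" for x
    unfolding q_eq[abs_def]
    using DERIV_add[OF DERIV_power[OF X'[OF that], of 2] DERIV_power[OF Y'[OF that], of 2]]
    by (rule DERIV_cong) (simp add: En_def add_divide_distrib algebra_simps)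
  have q1: "1 \<le> q x" if "0 < x" for x
  proof -
    have "((\<lambda>x. q x - 1) \<longlongrightarrow> 1\<^sup>2 + 0\<^sup>2 - 1) at_top"
      unfolding q_eq by (intro tendsto_intros lims)
    then have L: "((\<lambda>x. q x - 1) \<longlongrightarrow> 0) at_top" by simp
    have "0 \<le> q x - 1"
    proof (rule decreasing_from_zero_limit_nonneg[OF _ _ L that])
      show "((\<lambda>x. q x - 1) has_real_derivative - (2 * En y / weight y)) (at y)" if "0 < y" for y
        using DERIV_diff[OF q'[OF that] DERIV_const[of 1]] by simp
      show "- (2 * En y / weight y) \<le> 0" if "0 < y" for y using En0[OF that] by simp
    qed
    then show ?thesis by simp
  qed
  then show "\<And>x. 0 < x \<Longrightarrow> 1 \<le> sq_modulus \<theta> x" by (simp add: q_def)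
  have qdec: "q y \<le> q x" if "0 < x" "x \<le> y" for x y
  proof (rule DERIV_nonpos_imp_nonincreasing[OF that(2)])
    fix z assume "x \<le> z" "z \<le> y"
    then show "\<exists>l. (q has_real_derivative l) (at z) \<and> l \<le> 0"
      using that q'[of z] En0[of z] by (intro exI[of _ "- (2 * En z / weight z)"]) auto
  qed
  then show "\<And>x y. 0 < x \<Longrightarrow> x \<le> y \<Longrightarrow> sq_modulus \<theta> y \<le> sq_modulus \<theta> x" by (simp add: q_def)
  define Z where "Z x = X x * Q x - Y x * P x" for x
  have Z': "(Z has_real_derivative 2 * weight x / x * \<theta> * q x) (at x)" if "0 < x" for x
    unfolding Z_def[abs_def]
    using DERIV_diff[OF DERIV_mult[OF X'[OF that] Q'[OF that]] DERIV_mult[OF Y'[OF that] P'[OF that]]]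
    by (rule DERIV_cong) (simp add: q_eq power2_eq_square algebra_simps add_divide_distrib)
  have Z: "\<theta>\<^sup>2 * flux 0 x \<le> - \<theta> * Z x" if "0 < x" for x
  proof -
    have "((\<lambda>x. - \<theta> * Z x - \<theta>\<^sup>2 * flux 0 x) \<longlongrightarrow> - \<theta> * (1 * 0 - 0 * 0) - \<theta>\<^sup>2 * 0) at_top"
      unfolding Z_def[abs_def] by (intro tendsto_intros lims flux_0(2))
    then have L: "((\<lambda>x. - \<theta> * Z x - \<theta>\<^sup>2 * flux 0 x) \<longlongrightarrow> 0) at_top" by simp
    have "0 \<le> - \<theta> * Z x - \<theta>\<^sup>2 * flux 0 x"
    proof (rule decreasing_from_zero_limit_nonneg[OF _ _ L that])
      show "((\<lambda>x. - \<theta> * Z x - \<theta>\<^sup>2 * flux 0 x) has_real_derivative - (2 * weight y / y * \<theta>\<^sup>2 * (q y - 1))) (at y)"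
        if "0 < y" for y
        using DERIV_diff[OF DERIV_cmult[OF Z'[OF that], of "- \<theta>"] DERIV_cmult[OF flux_0(1)[OF that], of "\<theta>\<^sup>2"]]
        by (rule DERIV_cong) (simp add: power2_eq_square algebra_simps add_divide_distrib diff_divide_distrib)
      show "- (2 * weight y / y * \<theta>\<^sup>2 * (q y - 1)) \<le> 0" if "0 < y" for y
        using q1[OF that] that by simp
    qed
    then show ?thesis by simp
  qed
  have PQ: "\<theta>\<^sup>2 * (flux 0 x)\<^sup>2 \<le> q x * ((P x)\<^sup>2 + (Q x)\<^sup>2)" if "0 < x" for x
  proof (cases "\<theta> = 0")
    case False
    have "(\<theta>\<^sup>2 * flux 0 x)\<^sup>2 \<le> (- \<theta> * Z x)\<^sup>2"
      using Z[OF that] flux_0(3)[OF that] by (intro power_mono) auto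
    then have "\<theta>\<^sup>2 * (\<theta>\<^sup>2 * (flux 0 x)\<^sup>2) \<le> \<theta>\<^sup>2 * (Z x)\<^sup>2" by (simp add: power_mult_distrib power2_eq_square mult_ac)
    then have "\<theta>\<^sup>2 * (flux 0 x)\<^sup>2 \<le> (Z x)\<^sup>2"
      by (rule mult_left_le_imp_le) (use False in simp)
    also have "(Z x)\<^sup>2 \<le> (Z x)\<^sup>2 + (X x * P x + Y x * Q x)\<^sup>2" by simp
    also have "\<dots> = q x * ((P x)\<^sup>2 + (Q x)\<^sup>2)"
      by (simp add: Z_def q_eq power2_eq_square algebra_simps)
    finally show ?thesis .
  qed (use that q1[OF that] in simp)
  define W where "W = exp (16/7 * \<alpha>\<^sup>2)"
  have W: "0 < W" "weight x \<le> W" for x using weight_bound by (auto simp: W_def)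
  have q11: "1 \<le> q 1" by (rule q1) simp
  define \<eta> where "\<eta> = \<theta>\<^sup>2 * (flux 0 3)\<^sup>2 / q 1"
  have eta: "\<eta> / W \<le> En 2"
  proof -
    obtain z where z: "2 < z" "z < 3" "En 3 - En 2 = (3 - 2) * - (((P z)\<^sup>2 + (Q z)\<^sup>2) / weight z)"
      using MVT2[of 2 3 En "\<lambda>x. - (((P x)\<^sup>2 + (Q x)\<^sup>2) / weight x)"] En' by auto
    have "\<theta>\<^sup>2 * (flux 0 3)\<^sup>2 \<le> \<theta>\<^sup>2 * (flux 0 z)\<^sup>2"
      using flux_0_antimono[of z 3] flux_0(3)[of 3] z by (intro mult_left_mono power_mono) auto
    also have "\<dots> \<le> q z * ((P z)\<^sup>2 + (Q z)\<^sup>2)" using z by (intro PQ) auto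
    also have "\<dots> \<le> q 1 * ((P z)\<^sup>2 + (Q z)\<^sup>2)" using qdec[of 1 z] z by (intro mult_right_mono) auto
    finally have "\<eta> \<le> (P z)\<^sup>2 + (Q z)\<^sup>2" unfolding \<eta>_def using q11 by (simp add: pos_divide_le_eq mult.commute)
    then have "\<eta> / W \<le> ((P z)\<^sup>2 + (Q z)\<^sup>2) / weight z"
      using W weight_pos[of z] by (intro frac_le) auto
    then show ?thesis using z En0[of 3] by simp
  qed
  have "2 * (\<eta> / W) / W \<le> q 1"
  proof -
    obtain z where z: "1 < z" "z < 2" "q 2 - q 1 = (2 - 1) * - (2 * En z / weight z)"
      using MVT2[of 1 2 q "\<lambda>x. - (2 * En x / weight x)"] q' by auto
    have "En 2 \<le> En z"
    proof (rule DERIV_nonpos_imp_nonincreasing[of z 2 En])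
      fix y assume "z \<le> y" "y \<le> 2"
      then show "\<exists>l. (En has_real_derivative l) (at y) \<and> l \<le> 0"
        using z En'[of y] by (intro exI[of _ "- (((P y)\<^sup>2 + (Q y)\<^sup>2) / weight y)"]) auto
    qed (use z in simp)
    then have "2 * (\<eta> / W) / W \<le> 2 * En z / weight z"
      using eta W weight_pos[of z] En0[of z] z by (intro frac_le) auto
    then show ?thesis using z q1[of 2] by simp
  qed
  then have "2 * (\<eta> / W) / W * q 1 \<le> q 1 * q 1" using q11 by (intro mult_right_mono) auto
  moreover have "2 * (\<eta> / W) / W * q 1 = \<kappa> * \<theta>\<^sup>2"
    unfolding \<eta>_def \<kappa>_def W_def[symmetric] using q11 by (simp add: power2_eq_square)
  ultimately show "\<kappa> * \<theta>\<^sup>2 \<le> (sq_modulus \<theta> 1)\<^sup>2" by (simp add: q_def power2_eq_square)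
qed

lemma characteristic_solutions:
  "\<exists>(X :: real \<Rightarrow> real \<Rightarrow> real) Y \<kappa>. 0 < \<kappa> \<and> (\<forall>\<theta>.
     generator_solution (X \<theta>) (\<lambda>x. \<theta> * Y \<theta> x) \<and> generator_solution (Y \<theta>) (\<lambda>x. - \<theta> * X \<theta> x) \<and>
     (X \<theta> \<longlongrightarrow> 1) at_top \<and> (Y \<theta> \<longlongrightarrow> 0) at_top \<and>
     1 \<le> (X \<theta> 0)\<^sup>2 + (Y \<theta> 0)\<^sup>2 \<and> \<kappa> * \<theta>\<^sup>2 \<le> ((X \<theta> 0)\<^sup>2 + (Y \<theta> 0)\<^sup>2)\<^sup>2)"
proof (intro exI conjI allI)
  show "0 < 2 * (flux 0 3)\<^sup>2 / (exp (16/7 * \<alpha>\<^sup>2))\<^sup>2" using flux_0_pos[of 3] by simp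
  fix \<theta>
  have rhs: "mode_series (shift (re_coeff \<theta>)) x = \<theta> * series_solution (im_coeff \<theta>) x" "mode_series (shift (im_coeff \<theta>)) x = - \<theta> * series_solution (re_coeff \<theta>) x"
    if "0 < x" for x
    using that mode_series_cmult[OF geometric_im_coeff that, of \<theta> \<theta>] mode_series_cmult[OF geometric_re_coeff that, of "- \<theta>" \<theta>]
    by (auto simp: shift_re_coeff shift_im_coeff series_solution_def)
  show "generator_solution (series_solution (re_coeff \<theta>)) (\<lambda>x. \<theta> * series_solution (im_coeff \<theta>) x)" "generator_solution (series_solution (im_coeff \<theta>)) (\<lambda>x. - \<theta> * series_solution (re_coeff \<theta>) x)"
    using generator_solution_series_solution[OF geometric_re_coeff, of \<theta>] generator_solution_series_solution[OF geometric_im_coeff, of \<theta>] rhs unfolding generator_solution_def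
    by (auto cong: conj_cong) 
  have ev: "\<forall>\<^sub>F x in at_top. mode_series c x = series_solution c x" for c
    by (rule eventually_mono[OF eventually_gt_at_top[of 0]]) (auto simp: series_solution_def)
  show "(series_solution (re_coeff \<theta>) \<longlongrightarrow> 1) at_top" "(series_solution (im_coeff \<theta>) \<longlongrightarrow> 0) at_top"
    using Lim_transform_eventually[OF mode_series_lim[OF geometric_re_coeff] ev, of \<theta>] Lim_transform_eventually[OF mode_series_lim[OF geometric_im_coeff] ev, of \<theta>]
    by (simp_all add: re_coeff_def im_coeff_def)
  have L: "(sq_modulus \<theta> \<longlongrightarrow> (series_solution (re_coeff \<theta>) 0)\<^sup>2 + (series_solution (im_coeff \<theta>) 0)\<^sup>2) (at_right 0)"
    unfolding sq_modulus_def[abs_def] by (intro tendsto_intros mode_series_lim_0[OF geometric_re_coeff] mode_series_lim_0[OF geometric_im_coeff])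
  have q1: "sq_modulus \<theta> 1 \<le> (series_solution (re_coeff \<theta>) 0)\<^sup>2 + (series_solution (im_coeff \<theta>) 0)\<^sup>2"
    by (rule tendsto_lowerbound[OF L]) (auto intro!: eventually_at_rightI[of 0 1] modulus_growth(2))
  then show "1 \<le> (series_solution (re_coeff \<theta>) 0)\<^sup>2 + (series_solution (im_coeff \<theta>) 0)\<^sup>2" using modulus_growth(1)[of 1 \<theta>] by simp
  show "2 * (flux 0 3)\<^sup>2 / (exp (16/7 * \<alpha>\<^sup>2))\<^sup>2 * \<theta>\<^sup>2 \<le> ((series_solution (re_coeff \<theta>) 0)\<^sup>2 + (series_solution (im_coeff \<theta>) 0)\<^sup>2)\<^sup>2"
    using modulus_growth(3)[of \<theta>] power_mono[OF q1, of 2] modulus_growth(1)[of 1 \<theta>] by linarith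
qed

end

section \<open>Moments of one round of jumps\<close>

text \<open>
  The expectation of \<open>\<Phi>\<close> after one more particle has been thrown on a uniform vertex, given that \<open>e\<close> vertices were
  empty and \<open>s\<close> carried exactly one particle.
\<close>

definition jump :: "nat \<Rightarrow> (nat \<Rightarrow> nat \<Rightarrow> real) \<Rightarrow> nat \<Rightarrow> nat \<Rightarrow> real" where
  "jump n \<Phi> e s = real e / real n * \<Phi> (e - 1) (s + 1) + real s / real n * \<Phi> e (s - 1)
     + (real n - real e - real s) / real n * \<Phi> e s"

text \<open>
  The transition operator of the number of unhappy particles: the \<open>M - u\<close> happy particles occupy one vertex
  each, the others are thrown anew, and \<open>s\<close> particles are happy afterwards.
\<close>

definition next_round :: "nat \<Rightarrow> nat \<Rightarrow> (nat \<Rightarrow> real) \<Rightarrow> nat \<Rightarrow> real" where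
  "next_round n M F u = (jump n ^^ u) (\<lambda>e s. F (M - s)) (n - (M - u)) (M - u)"

text \<open>
  Invariants of the occupancy after \<open>k\<close> throws. The last one counts particles: every vertex that is neither
  empty nor singly occupied holds at least two.
\<close>

definition reach :: "nat \<Rightarrow> nat \<Rightarrow> nat \<Rightarrow> nat \<Rightarrow> nat \<Rightarrow> bool" where
  "reach n H k e s \<longleftrightarrow> e + H \<le> n \<and> n \<le> H + e + k \<and> s \<le> H + k \<and> H \<le> s + k \<and> e + s \<le> n \<and>
     n \<le> e + s + k \<and> 2 * n \<le> 2 * e + s + H + k"

lemma reach_0: "H \<le> n \<Longrightarrow> reach n H 0 (n - H) H" by (simp add: reach_def)

lemma reach_mono: "reach n H k e s \<Longrightarrow> k \<le> l \<Longrightarrow> reach n H l e s" by (simp add: reach_def)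

lemma reach_Suc:
  assumes "reach n H k e s"
  shows "0 < e \<Longrightarrow> reach n H (Suc k) (e - 1) (s + 1)" and "0 < s \<Longrightarrow> reach n H (Suc k) e (s - 1)"
    and "reach n H (Suc k) e s"
  using assms by (auto simp: reach_def)

text \<open>
  Transitions that would leave the state space have weight \<open>0\<close>, which makes truncated subtraction harmless.
\<close>

lemma jump_mono:
  fixes \<Phi> \<Psi> :: "nat \<Rightarrow> nat \<Rightarrow> real"
  assumes r: "reach n H k e s" and le: "\<And>e s. reach n H (Suc k) e s \<Longrightarrow> \<Phi> e s \<le> \<Psi> e s"
  shows "jump n \<Phi> e s \<le> jump n \<Psi> e s"
proof -
  have "real e / real n * \<Phi> (e - 1) (s + 1) \<le> real e / real n * \<Psi> (e - 1) (s + 1)"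
    using le[OF reach_Suc(1)[OF r]] by (cases "e = 0") (auto simp del: times_divide_eq_left intro!: mult_left_mono)
  moreover have "real s / real n * \<Phi> e (s - 1) \<le> real s / real n * \<Psi> e (s - 1)"
    using le[OF reach_Suc(2)[OF r]] by (cases "s = 0") (auto simp del: times_divide_eq_left intro!: mult_left_mono)
  moreover have "(real n - real e - real s) / real n * \<Phi> e s \<le> (real n - real e - real s) / real n * \<Psi> e s"
    using le[OF reach_Suc(3)[OF r]] r by (intro mult_left_mono) (auto simp: reach_def)
  ultimately show ?thesis unfolding jump_def by simp
qed

lemma jumps_mono:
  fixes \<Phi> \<Psi> :: "nat \<Rightarrow> nat \<Rightarrow> real"
  assumes "reach n H j e s" and "\<And>e s. reach n H (j + k) e s \<Longrightarrow> \<Phi> e s \<le> \<Psi> e s"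
  shows "(jump n ^^ k) \<Phi> e s \<le> (jump n ^^ k) \<Psi> e s"
  using assms
proof (induction k arbitrary: j e s)
  case (Suc k)
  show ?case unfolding funpow.simps o_def
    by (rule jump_mono[OF Suc.prems(1)], rule Suc.IH[of "Suc j"]) (use Suc.prems(2) in auto)
qed simp

lemma jump_add: "jump n (\<lambda>e s. \<Phi> e s + \<Psi> e s) = (\<lambda>e s. jump n \<Phi> e s + jump n \<Psi> e s)"
  by (simp add: jump_def fun_eq_iff distrib_left)

lemma jump_cmult: "jump n (\<lambda>e s. a * \<Phi> e s) = (\<lambda>e s. a * jump n \<Phi> e s)"
  by (simp add: jump_def fun_eq_iff distrib_left mult_ac)

lemma jump_const: "0 < n \<Longrightarrow> jump n (\<lambda>_ _. a) = (\<lambda>_ _. a)"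
  by (simp add: jump_def fun_eq_iff distrib_right[symmetric] add_divide_distrib[symmetric])

text \<open>
  Expectation after \<open>k\<close> throws onto \<open>H\<close> singly occupied vertices.
\<close>

definition micro_mean :: "nat \<Rightarrow> nat \<Rightarrow> nat \<Rightarrow> (nat \<Rightarrow> nat \<Rightarrow> real) \<Rightarrow> real" where
  "micro_mean n H k \<Phi> = (jump n ^^ k) \<Phi> (n - H) H"

lemma micro_mean_0: "micro_mean n H 0 \<Phi> = \<Phi> (n - H) H" by (simp add: micro_mean_def)

lemma micro_mean_Suc: "micro_mean n H (Suc k) \<Phi> = micro_mean n H k (jump n \<Phi>)"
  by (simp only: micro_mean_def funpow_Suc_right o_def)

lemma micro_mean_mono:
  assumes "H \<le> n" "k \<le> u" and "\<And>e s. reach n H u e s \<Longrightarrow> \<Phi> e s \<le> \<Psi> e s"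
  shows "micro_mean n H k \<Phi> \<le> micro_mean n H k \<Psi>"
  unfolding micro_mean_def using assms by (intro jumps_mono[OF reach_0]) (auto intro: reach_mono)

lemma micro_mean_cong:
  assumes "H \<le> n" "k \<le> u" and "\<And>e s. reach n H u e s \<Longrightarrow> \<Phi> e s = \<Psi> e s"
  shows "micro_mean n H k \<Phi> = micro_mean n H k \<Psi>"
  using assms by (intro antisym micro_mean_mono[of H n k u]) auto

lemma micro_mean_add: "micro_mean n H k (\<lambda>e s. \<Phi> e s + \<Psi> e s) = micro_mean n H k \<Phi> + micro_mean n H k \<Psi>"
  unfolding micro_mean_def by (induction k arbitrary: \<Phi> \<Psi>) (simp_all add: funpow_Suc_right jump_add del: funpow.simps(2))

lemma micro_mean_cmult: "micro_mean n H k (\<lambda>e s. a * \<Phi> e s) = a * micro_mean n H k \<Phi>"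
  unfolding micro_mean_def using jump_cmult[of n a]
  by (induction k arbitrary: \<Phi>) (simp_all add: funpow_Suc_right del: funpow.simps(2))

lemma micro_mean_const: "0 < n \<Longrightarrow> micro_mean n H k (\<lambda>_ _. a) = a"
  unfolding micro_mean_def by (induction k) (simp_all add: funpow_Suc_right jump_const del: funpow.simps(2))

lemma micro_mean_diff: "micro_mean n H k (\<lambda>e s. \<Phi> e s - \<Psi> e s) = micro_mean n H k \<Phi> - micro_mean n H k \<Psi>"
  using micro_mean_add[of n H k \<Phi> "\<lambda>e s. (-1) * \<Psi> e s"] by (simp only: micro_mean_cmult) simp

lemma micro_mean_abs:
  assumes "H \<le> n" "k \<le> u" "\<And>e s. reach n H u e s \<Longrightarrow> \<bar>\<Phi> e s\<bar> \<le> \<Psi> e s"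
  shows "\<bar>micro_mean n H k \<Phi>\<bar> \<le> micro_mean n H k \<Psi>"
proof -
  have "micro_mean n H k \<Phi> \<le> micro_mean n H k \<Psi>" using assms by (intro micro_mean_mono[of H n k u]) (auto dest: abs_le_D1)
  moreover have "micro_mean n H k (\<lambda>e s. (-1) * \<Phi> e s) \<le> micro_mean n H k \<Psi>"
  proof (rule micro_mean_mono[OF assms(1,2)])
    show "-1 * \<Phi> e s \<le> \<Psi> e s" if "reach n H u e s" for e s
      using assms(3)[OF that] by (simp add: abs_le_iff)
  qed
  ultimately show ?thesis unfolding micro_mean_cmult abs_le_iff by simp
qed

lemma next_round_eq_micro_mean: "u \<le> M \<Longrightarrow> next_round n M F u = micro_mean n (M - u) u (\<lambda>e s. F (M - s))"
  by (simp add: next_round_def micro_mean_def)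

text \<open>
  In the locale, \<open>- Y\<close> is the change of the number of unhappy particles after the last throw, and \<open>\<beta>\<close> bounds
  the drift \<open>(e - s) / n\<close> of a single throw.
\<close>

locale one_round =
  fixes n M u :: nat
  assumes u: "1 \<le> u" "u \<le> M" and Mn: "M \<le> n"
begin

definition H where "H = M - u"
definition Y :: "nat \<Rightarrow> nat \<Rightarrow> real" where "Y e s = real s - real H"
definition \<beta> :: real where "\<beta> = (\<bar>real n - 2 * real M\<bar> + 4 * real u) / real n"
abbreviation E where "E \<equiv> micro_mean n H"
abbreviation R where "R \<equiv> reach n H u"

lemma n_pos: "0 < n" using u Mn by simp
lemma Hn: "H \<le> n" using Mn by (simp add: H_def)
lemma real_H: "real H = real M - real u" using u by (simp add: H_def)
lemma beta_nonneg: "0 \<le> \<beta>" by (simp add: \<beta>_def)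

lemma reachD:
  assumes "R e s"
  shows "\<bar>Y e s\<bar> \<le> real u" and "\<bar>(real e - real s) / real n\<bar> \<le> \<beta>" and "0 \<le> (real n - real e - real s) / real n"
    and "(real n - real e - real s) / real n \<le> real u / real n"
    and "\<bar>(2 * real e - real s) / real n - 1/2\<bar> \<le> 2 * \<beta>"
    and "0 \<le> real e / real n" "real e / real n \<le> 1"
proof -
  have a: "real e + real H \<le> real n" "real n \<le> real H + real e + real u" "real s \<le> real H + real u"
    "real H \<le> real s + real u" "real e + real s \<le> real n" "real n \<le> real e + real s + real u"
    using assms unfolding reach_def by linarith+
  show "\<bar>Y e s\<bar> \<le> real u" using a unfolding Y_def by linarith
  have n: "0 < real n" using n_pos by simp
  have "\<bar>real e - real s\<bar> \<le> \<bar>real n - 2 * real M\<bar> + 4 * real u" using a real_H by linarith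
  then show "\<bar>(real e - real s) / real n\<bar> \<le> \<beta>" unfolding \<beta>_def abs_divide using n by (auto intro: divide_right_mono)
  show "0 \<le> (real n - real e - real s) / real n"  "(real n - real e - real s) / real n \<le> real u / real n"
    using a n by (auto intro!: divide_right_mono)
  have "\<bar>2 * real e - real s - real n / 2\<bar> \<le> 2 * (\<bar>real n - 2 * real M\<bar> + 4 * real u)"
  proof -
    have "\<bar>2 * e - s - n / 2\<bar> \<le> 2 * (\<bar>n - 2 * m\<bar> + 4 * u)"
      if "e + h \<le> n" "n \<le> h + e + u" "s \<le> h + u" "h \<le> s + u" "h = m - u" "0 \<le> u" for e s n m u h :: real
      using that by (simp add: abs_if)
    from this[OF a(1-4) real_H] show ?thesis by simp
  qed
  then have "\<bar>2 * real e - real s - real n / 2\<bar> / real n \<le> 2 * \<beta>" unfolding \<beta>_def using n by (simp add: divide_right_mono)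
  moreover have "\<bar>(2 * real e - real s) / real n - 1/2\<bar> = \<bar>2 * real e - real s - real n / 2\<bar> / real n"
    using n by (subst abs_of_pos[of "real n", symmetric], simp, subst abs_divide[symmetric]) (simp add: diff_divide_distrib)
  ultimately show "\<bar>(2 * real e - real s) / real n - 1/2\<bar> \<le> 2 * \<beta>" by simp
  show "0 \<le> real e / real n" "real e / real n \<le> 1" using a n by auto
qed

lemma jump_poly:
  fixes p :: "real \<Rightarrow> real"
  shows "jump n (\<lambda>e s. p (Y e s)) e s = (real e / real n) * p (Y e s + 1) + (real s / real n) * p (Y e s - 1)
     + ((real n - real e - real s) / real n) * p (Y e s)"
proof -
  have "real s / real n * p (Y e (s - 1)) = real s / real n * p (Y e s - 1)"
    by (cases s) (auto simp: Y_def)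
  moreover have "Y (e - 1) (s + 1) = Y e s + 1" by (simp add: Y_def)
  ultimately show ?thesis by (simp add: jump_def)
qed

lemma weights: "real e / real n + real s / real n + (real n - real e - real s) / real n = 1"
  using n_pos by (simp add: add_divide_distrib[symmetric])

lemma jump_Y: "jump n Y e s = Y e s + (real e - real s) / real n"
proof -
  have "jump n Y e s = (real e / real n + real s / real n + (real n - real e - real s) / real n) * Y e s + (real e / real n - real s / real n)"
    using jump_poly[of "\<lambda>y. y" e s] by (simp add: algebra_simps)
  then show ?thesis unfolding weights by (simp add: diff_divide_distrib)
qed

lemma jump_Y2: "jump n (\<lambda>e s. (Y e s)\<^sup>2) e s = (Y e s)\<^sup>2 + 2 * (Y e s * ((real e - real s) / real n)) + 1 - (real n - real e - real s) / real n"
proof -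
  define a b c where "a = real e / real n" and "b = real s / real n" and "c = (real n - real e - real s) / real n"
  have w: "a + b + c = 1" using weights by (simp add: a_def b_def c_def)
  have ab: "(real e - real s) / real n = a - b" by (simp add: a_def b_def diff_divide_distrib)
  have "jump n (\<lambda>e s. (Y e s)\<^sup>2) e s = a * (Y e s + 1)\<^sup>2 + b * (Y e s - 1)\<^sup>2 + c * (Y e s)\<^sup>2"
    using jump_poly[of "\<lambda>y. y\<^sup>2" e s] by (simp add: a_def b_def c_def)
  also have "\<dots> = (a + b + c) * (Y e s)\<^sup>2 + 2 * (Y e s * (a - b)) + (a + b + c) - c"
    by (simp add: power2_eq_square algebra_simps)
  finally show ?thesis unfolding w ab by (simp add: c_def[symmetric])
qed

lemma jump_Y4: "jump n (\<lambda>e s. (Y e s)^4) e s = (Y e s)^4 + 4 * ((Y e s)^3 * ((real e - real s) / real n))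
    + (6 * (Y e s)\<^sup>2 + 1) * (1 - (real n - real e - real s) / real n) + 4 * (Y e s * ((real e - real s) / real n))"
proof -
  define a b c where "a = real e / real n" and "b = real s / real n" and "c = (real n - real e - real s) / real n"
  have w: "a + b + c = 1" using weights by (simp add: a_def b_def c_def)
  have ab: "(real e - real s) / real n = a - b" by (simp add: a_def b_def diff_divide_distrib)
  have "jump n (\<lambda>e s. (Y e s)^4) e s = a * (Y e s + 1)^4 + b * (Y e s - 1)^4 + c * (Y e s)^4"
    using jump_poly[of "\<lambda>y. y^4" e s] by (simp add: a_def b_def c_def)
  also have "\<dots> = (a + b + c) * (Y e s)^4 + 4 * ((Y e s)^3 * (a - b)) + (6 * (Y e s)\<^sup>2 + 1) * (a + b + c - c) + 4 * (Y e s * (a - b))"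
    by (simp add: eval_nat_numeral algebra_simps)
  finally show ?thesis unfolding w ab by (simp add: c_def[symmetric])
qed

text \<open>
  A discrete Gronwall inequality.
\<close>

lemma growth_recursion:
  fixes m :: "nat \<Rightarrow> real"
  assumes "m 0 = 0" and "\<And>k. k < u \<Longrightarrow> m (Suc k) \<le> (1 + a / real u) * m k + d" and "0 \<le> a" "0 \<le> d" and "k \<le> u"
  shows "m k \<le> exp a * real u * d"
proof -
  have "m k \<le> (1 + a / real u) ^ k * (real k * d)" if "k \<le> u" for k
    using that
  proof (induction k)
    case (Suc k)
    have pos: "0 \<le> a / real u" using assms by simp
    have "m (Suc k) \<le> (1 + a / real u) * m k + d" using assms(2)[of k] Suc by simp
    also have "\<dots> \<le> (1 + a / real u) * ((1 + a / real u) ^ k * (real k * d)) + (1 + a / real u) ^ Suc k * d"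
    proof (intro add_mono mult_left_mono)
      show "d \<le> (1 + a / real u) ^ Suc k * d"
        using mult_right_mono[OF one_le_power[of "1 + a / real u" "Suc k"] assms(4)] pos by simp
    qed (use Suc pos in auto)
    finally show ?case by (simp add: algebra_simps add_divide_distrib)
  qed (use assms in simp)
  from this[OF assms(5)] have "m k \<le> (1 + a / real u) ^ k * (real k * d)" .
  also have "\<dots> \<le> exp a * (real u * d)"
  proof (intro mult_mono)
    have "(1 + a / real u) ^ k \<le> (1 + a / real u) ^ u" using assms by (intro power_increasing) auto
    also have "\<dots> \<le> exp (a / real u) ^ u" using assms by (intro power_mono) (auto simp: exp_ge_add_one_self)
    also have "\<dots> = exp a" using u by (simp add: exp_of_nat_mult[symmetric])
    finally show "(1 + a / real u) ^ k \<le> exp a" .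
  qed (use assms in auto)
  finally show ?thesis by simp
qed

text \<open>
  A throw adds at most \<open>1\<close> to \<open>Y^2\<close> apart from the drift term \<open>2 * Y * \<beta>\<close>, which is at most \<open>Y^2 / u + u * \<beta>^2\<close>.
  Over \<open>u\<close> throws the factor \<open>1 + 1 / u\<close> costs only a constant.
\<close>

lemma second_moment:
  assumes "k \<le> u"
  shows "E k (\<lambda>e s. (Y e s)\<^sup>2) \<le> 3 * real u * (1 + real u * \<beta>\<^sup>2)"
proof -
  have "E k (\<lambda>e s. (Y e s)\<^sup>2) \<le> exp 1 * real u * (1 + real u * \<beta>\<^sup>2)"
  proof (rule growth_recursion[OF _ _ _ _ assms])
    show "E 0 (\<lambda>e s. (Y e s)\<^sup>2) = 0" by (simp add: micro_mean_0 Y_def)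
    fix k assume k: "k < u"
    have "E (Suc k) (\<lambda>e s. (Y e s)\<^sup>2) \<le> E k (\<lambda>e s. (1 + 1 / real u) * (Y e s)\<^sup>2 + (1 + real u * \<beta>\<^sup>2))"
      unfolding micro_mean_Suc
    proof (rule micro_mean_mono[OF Hn, of _ u])
      fix e s assume r: "R e s"
      define y where "y = Y e s"
      have "y * ((real e - real s) / real n) \<le> \<bar>y\<bar> * \<beta>"
        using mult_left_mono[OF reachD(2)[OF r], of "\<bar>y\<bar>"] unfolding abs_mult[symmetric] by linarith
      moreover have "2 * (\<bar>y\<bar> * \<beta>) \<le> 1 / real u * y\<^sup>2 + real u * \<beta>\<^sup>2"
      proof -
        have "0 \<le> real u * (\<bar>y\<bar> / real u - \<beta>)\<^sup>2" by simp
        also have "\<dots> = 1 / real u * y\<^sup>2 + real u * \<beta>\<^sup>2 - 2 * (\<bar>y\<bar> * \<beta>)"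
          using u by (simp add: power2_eq_square field_simps)
        finally show ?thesis by simp
      qed
      ultimately show "jump n (\<lambda>e s. (Y e s)\<^sup>2) e s \<le> (1 + 1 / real u) * (Y e s)\<^sup>2 + (1 + real u * \<beta>\<^sup>2)"
        using reachD(3)[OF r] unfolding jump_Y2 y_def[symmetric] distrib_right by simp
    qed (use k in simp)
    then show "E (Suc k) (\<lambda>e s. (Y e s)\<^sup>2) \<le> (1 + 1 / real u) * E k (\<lambda>e s. (Y e s)\<^sup>2) + (1 + real u * \<beta>\<^sup>2)"
      by (simp only: micro_mean_add micro_mean_cmult micro_mean_const[OF n_pos])
  qed auto
  also have "\<dots> \<le> 3 * real u * (1 + real u * \<beta>\<^sup>2)"
    using exp_le by (intro mult_right_mono) auto
  finally show ?thesis .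
qed

text \<open>
  As for the second moment; the drift term \<open>4 * Y^3 * \<beta>\<close> is split by Young's inequality.
\<close>

lemma fourth_moment:
  assumes "k \<le> u" and b: "real u * \<beta>\<^sup>2 \<le> b"
  shows "E k (\<lambda>e s. (Y e s)^4) \<le> exp 3 * (real u)\<^sup>2 * (b\<^sup>2 + 26 * (1 + b))"
proof -
  have b0: "0 \<le> b" using b by (meson mult_nonneg_nonneg of_nat_0_le_iff order_trans zero_le_power2)
  define d where "d = real u * (b\<^sup>2 + 26 * (1 + b))"
  have "E k (\<lambda>e s. (Y e s)^4) \<le> exp 3 * real u * d"
  proof (rule growth_recursion[OF _ _ _ _ assms(1)])
    show "E 0 (\<lambda>e s. (Y e s)^4) = 0" by (simp add: micro_mean_0 Y_def)
    fix k assume k: "k < u"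
    have "E (Suc k) (\<lambda>e s. (Y e s)^4) \<le> E k (\<lambda>e s. (1 + 3 / real u) * (Y e s)^4 + (8 * (Y e s)\<^sup>2 + (real u * b\<^sup>2 + 2 * b + 1)))"
      unfolding micro_mean_Suc
    proof (rule micro_mean_mono[OF Hn, of _ u])
      fix e s assume r: "R e s"
      define y z where "y = Y e s" and "z = (real e - real s) / real n"
      have z: "\<bar>z\<bar> \<le> \<beta>" using reachD(2)[OF r] by (simp add: z_def)
      have ub: "real u * z\<^sup>2 \<le> b"
        using b mult_left_mono[OF power_mono[OF z, of 2], of "real u"] by simp
      (* Young's inequality in the form of two squares. *)
      have "4 * (y^3 * z) \<le> 3 / real u * y^4 + real u * b\<^sup>2"
      proof -
        have "0 \<le> (y\<^sup>2 - real u * y * z)\<^sup>2" "0 \<le> (y\<^sup>2 - (real u)\<^sup>2 * z\<^sup>2)\<^sup>2" by simp_all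
        then have "4 * (real u * y^3 * z) \<le> 2 * y^4 + 2 * ((real u)\<^sup>2 * z\<^sup>2 * y\<^sup>2)"
            "2 * ((real u)\<^sup>2 * z\<^sup>2 * y\<^sup>2) \<le> y^4 + (real u)^4 * z^4"
          by (simp_all add: eval_nat_numeral algebra_simps)
        then have "4 * (real u * y^3 * z) \<le> 3 * y^4 + (real u)^4 * z^4" by linarith
        also have "(real u)^4 * z^4 = (real u)\<^sup>2 * (real u * z\<^sup>2)\<^sup>2" by (simp add: eval_nat_numeral)
        also have "\<dots> \<le> (real u)\<^sup>2 * b\<^sup>2" using ub by (intro mult_left_mono power_mono) auto
        finally have "4 * (real u * y^3 * z) / real u \<le> (3 * y^4 + (real u)\<^sup>2 * b\<^sup>2) / real u"
          by (intro divide_right_mono) auto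
        then show ?thesis using u by (simp add: add_divide_distrib power2_eq_square)
      qed
      moreover have "4 * (y * z) \<le> 2 * y\<^sup>2 + 2 * b"
      proof -
        have "0 \<le> 2 * (y - z)\<^sup>2" by simp
        then have "4 * (y * z) \<le> 2 * y\<^sup>2 + 2 * z\<^sup>2" by (simp add: power2_eq_square algebra_simps)
        moreover have "z\<^sup>2 \<le> real u * z\<^sup>2" using u by (simp add: mult_le_cancel_right1)
        ultimately show ?thesis using ub by simp
      qed
      moreover have "(6 * y\<^sup>2 + 1) * (1 - (real n - real e - real s) / real n) \<le> 6 * y\<^sup>2 + 1"
        using mult_left_mono[of "1 - (real n - real e - real s) / real n" 1 "6 * y\<^sup>2 + 1"] reachD(3)[OF r] by simp
      ultimately show "jump n (\<lambda>e s. (Y e s)^4) e s \<le> (1 + 3 / real u) * (Y e s)^4 + (8 * (Y e s)\<^sup>2 + (real u * b\<^sup>2 + 2 * b + 1))"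
        unfolding jump_Y4 y_def[symmetric] z_def[symmetric] distrib_right by linarith
    qed (use k in simp)
    also have "\<dots> = (1 + 3 / real u) * E k (\<lambda>e s. (Y e s)^4) + (8 * E k (\<lambda>e s. (Y e s)\<^sup>2) + (real u * b\<^sup>2 + 2 * b + 1))"
      by (simp only: micro_mean_add micro_mean_cmult micro_mean_const[OF n_pos])
    also have "8 * E k (\<lambda>e s. (Y e s)\<^sup>2) \<le> 8 * (3 * real u * (1 + b))"
      using second_moment[of k] k mult_left_mono[of "1 + real u * \<beta>\<^sup>2" "1 + b" "3 * real u"] b by linarith
    also have "8 * (3 * real u * (1 + b)) + (real u * b\<^sup>2 + 2 * b + 1) \<le> real u * (b\<^sup>2 + 26 * (1 + b))"
    proof -
      have "2 * b + 1 \<le> real u * (2 * (1 + b))" using u b0 mult_mono[of 1 "real u" "2 * b + 1" "2 * (1 + b)"] by simp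
      then show ?thesis by (simp add: algebra_simps)
    qed
    finally show "E (Suc k) (\<lambda>e s. (Y e s)^4) \<le> (1 + 3 / real u) * E k (\<lambda>e s. (Y e s)^4) + d" by (simp add: d_def)
  qed (use b0 in \<open>auto simp: d_def\<close>)
  then show ?thesis by (simp add: d_def power2_eq_square mult_ac)
qed


lemma first_moment_abs:
  assumes "k \<le> u" shows "E k (\<lambda>e s. \<bar>Y e s\<bar>) \<le> 2 * (sqrt u * (1 + sqrt u * \<beta>))"
proof -
  define c where "c = sqrt u * (1 + sqrt u * \<beta>)"
  have c: "0 < c" using u beta_nonneg by (auto simp: c_def intro!: mult_pos_pos add_pos_nonneg)
  have "E k (\<lambda>e s. \<bar>Y e s\<bar>) \<le> E k (\<lambda>e s. 1 / (2 * c) * (Y e s)\<^sup>2 + c / 2)"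
  proof (rule micro_mean_mono[OF Hn assms])
    fix e s
    have "0 \<le> (\<bar>Y e s\<bar> - c)\<^sup>2 / (2 * c)" using c by simp
    also have "\<dots> = 1 / (2 * c) * (Y e s)\<^sup>2 + c / 2 - \<bar>Y e s\<bar>"
      using c by (simp add: power2_eq_square field_simps)
    finally show "\<bar>Y e s\<bar> \<le> 1 / (2 * c) * (Y e s)\<^sup>2 + c / 2" by simp
  qed
  also have "\<dots> = 1 / (2 * c) * E k (\<lambda>e s. (Y e s)\<^sup>2) + c / 2" by (simp only: micro_mean_add micro_mean_cmult micro_mean_const[OF n_pos])
  also have "\<dots> \<le> 1 / (2 * c) * (3 * c\<^sup>2) + c / 2"
  proof (intro add_right_mono mult_left_mono)
    have "real u * (1 + real u * \<beta>\<^sup>2) \<le> c\<^sup>2"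
    proof -
      have "c\<^sup>2 = real u * (1 + 2 * (sqrt u * \<beta>) + real u * \<beta>\<^sup>2)"
      proof -
        have "(w * (1 + w * b))\<^sup>2 = w\<^sup>2 * (1 + 2 * (w * b) + w\<^sup>2 * b\<^sup>2)" for w b :: real
          by (simp add: power2_eq_square algebra_simps)
        from this[of "sqrt u" \<beta>] show ?thesis by (simp add: c_def)
      qed
      moreover have "0 \<le> sqrt u * \<beta>" using beta_nonneg by simp
      ultimately show ?thesis by (simp add: mult_left_mono)
    qed
    then show "E k (\<lambda>e s. (Y e s)\<^sup>2) \<le> 3 * c\<^sup>2" using second_moment[OF assms] by linarith
  qed (use c in auto)
  also have "\<dots> = 2 * c" using c by (simp add: power2_eq_square)
  finally show ?thesis by (simp add: c_def)
qed

text \<open>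
  A throw adds exactly \<open>1\<close> to \<open>Y^2\<close>, up to the drift and the chance \<open>(n - e - s) / n\<close> of hitting a vertex that
  already holds several particles.
\<close>

lemma second_moment_precise:
  "\<bar>E u (\<lambda>e s. (Y e s)\<^sup>2) - real u\<bar> \<le> real u * (4 * \<beta> * (sqrt u * (1 + sqrt u * \<beta>)) + real u / real n)"
proof -
  define c where "c = 4 * \<beta> * (sqrt u * (1 + sqrt u * \<beta>)) + real u / real n"
  have "\<bar>E k (\<lambda>e s. (Y e s)\<^sup>2) - real k\<bar> \<le> real k * c" if "k \<le> u" for k
    using that
  proof (induction k)
    case 0 then show ?case by (simp add: micro_mean_0 Y_def)
  next
    case (Suc k)
    have "E (Suc k) (\<lambda>e s. (Y e s)\<^sup>2) = E k (\<lambda>e s. (Y e s)\<^sup>2 + ((2 * (Y e s * ((real e - real s) / real n)) - (real n - real e - real s) / real n) + 1))"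
      unfolding micro_mean_Suc by (rule micro_mean_cong[OF Hn, of _ u]) (use Suc in \<open>auto simp: jump_Y2\<close>)
    also have "\<dots> = E k (\<lambda>e s. (Y e s)\<^sup>2) + E k (\<lambda>e s. 2 * (Y e s * ((real e - real s) / real n)) - (real n - real e - real s) / real n) + 1"
      by (simp only: micro_mean_add micro_mean_const[OF n_pos] add.assoc)
    finally have eq: "E (Suc k) (\<lambda>e s. (Y e s)\<^sup>2) - real (Suc k) = (E k (\<lambda>e s. (Y e s)\<^sup>2) - real k)
        + E k (\<lambda>e s. 2 * (Y e s * ((real e - real s) / real n)) - (real n - real e - real s) / real n)" by simp
    have "\<bar>E k (\<lambda>e s. 2 * (Y e s * ((real e - real s) / real n)) - (real n - real e - real s) / real n)\<bar>
        \<le> E k (\<lambda>e s. (2 * \<beta>) * \<bar>Y e s\<bar> + real u / real n)"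
    proof (rule micro_mean_abs[OF Hn, of _ u])
      fix e s assume r: "R e s"
      have "\<bar>2 * (Y e s * ((real e - real s) / real n))\<bar> \<le> 2 * \<beta> * \<bar>Y e s\<bar>"
        using mult_left_mono[OF reachD(2)[OF r], of "2 * \<bar>Y e s\<bar>"] by (simp add: abs_mult mult_ac)
      then show "\<bar>2 * (Y e s * ((real e - real s) / real n)) - (real n - real e - real s) / real n\<bar> \<le> (2 * \<beta>) * \<bar>Y e s\<bar> + real u / real n"
        using reachD(3,4)[OF r] by linarith
    qed (use Suc in simp)
    also have "\<dots> = (2 * \<beta>) * E k (\<lambda>e s. \<bar>Y e s\<bar>) + real u / real n"
      by (simp only: micro_mean_add micro_mean_cmult micro_mean_const[OF n_pos])
    also have "\<dots> \<le> (2 * \<beta>) * (2 * (sqrt u * (1 + sqrt u * \<beta>))) + real u / real n"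
      using first_moment_abs[of k] Suc beta_nonneg by (intro add_right_mono mult_left_mono) auto
    finally have "\<bar>E k (\<lambda>e s. 2 * (Y e s * ((real e - real s) / real n)) - (real n - real e - real s) / real n)\<bar> \<le> c"
      by (simp add: c_def)
    moreover have "\<bar>E k (\<lambda>e s. (Y e s)\<^sup>2) - real k\<bar> \<le> real k * c" using Suc by simp
    ultimately show ?case unfolding eq by (simp add: algebra_simps)
  qed
  then show ?thesis by (simp add: c_def)
qed

text \<open>
  The drift \<open>(e - s) / n\<close> is not constant during the round: as \<open>2 * e - s\<close> stays close to \<open>n / 2\<close>, each throw lowers
  it by about \<open>1 / (2 * n)\<close>. Summing this arithmetic progression gives the term \<open>u^2 / (4 * n)\<close>, which turns the
  coefficient \<open>2\<close> of the quadratic drift into \<open>7/4\<close>.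
\<close>

lemma mean_precise:
  "\<bar>E u Y - real u * (real n - 2 * real H) / real n + (real u)\<^sup>2 / (4 * real n)\<bar>
     \<le> real u / (4 * real n) + 2 * (real u)\<^sup>2 * \<beta> / real n"
proof -
  have D: "\<bar>E k (\<lambda>e s. (real e - real s) / real n) - (real n - 2 * real H) / real n + real k / (2 * real n)\<bar> \<le> real k * (2 * \<beta> / real n)"
    if "k \<le> u" for k
    using that
  proof (induction k)
    case 0 then show ?case using Hn by (simp add: micro_mean_0 of_nat_diff)
  next
    case (Suc k)
    have "jump n (\<lambda>e s. (real e - real s) / real n) e s = (real e - real s) / real n + (- (1 / real n) * ((2 * real e - real s) / real n - 1/2) + - (1 / (2 * real n)))" for e s
    proof -
      define a b c d r where "a = real e / real n" and "b = real s / real n" and "c = (real n - real e - real s) / real n"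
        and "d = (real e - real s) / real n" and "r = 1 / real n"
      have w: "a + b + c = 1" using weights by (simp add: a_def b_def c_def)
      have "jump n (\<lambda>e s. (real e - real s) / real n) e s = a * ((real (e - 1) - real (s + 1)) / real n)
          + b * ((real e - real (s - 1)) / real n) + c * d"
        by (simp only: jump_def a_def b_def c_def d_def)
      also have "a * ((real (e - 1) - real (s + 1)) / real n) = a * (d - 2 * r)"
        by (cases e) (auto simp: a_def d_def r_def diff_divide_distrib add_divide_distrib)
      also have "b * ((real e - real (s - 1)) / real n) = b * (d + r)"
        by (cases s) (auto simp: b_def d_def r_def diff_divide_distrib add_divide_distrib)
      also have "a * (d - 2 * r) + b * (d + r) + c * d = (a + b + c) * d + (- r * ((2 * a - b) - 1/2) + - (r / 2))"
        by (simp add: algebra_simps)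
      also have "2 * a - b = (2 * real e - real s) / real n" by (simp add: a_def b_def diff_divide_distrib)
      finally show ?thesis unfolding w r_def d_def by simp
    qed
    then have "jump n (\<lambda>e s. (real e - real s) / real n) = (\<lambda>e s. (real e - real s) / real n + (- (1 / real n) * ((2 * real e - real s) / real n - 1/2) + - (1 / (2 * real n))))"
      by (intro ext)
    then have "E (Suc k) (\<lambda>e s. (real e - real s) / real n) = E k (\<lambda>e s. (real e - real s) / real n)
       + (- (1 / real n) * E k (\<lambda>e s. (2 * real e - real s) / real n - 1/2) + - (1 / (2 * real n)))"
      unfolding micro_mean_Suc by (simp only: micro_mean_add micro_mean_cmult micro_mean_const[OF n_pos])
    then have eq: "E (Suc k) (\<lambda>e s. (real e - real s) / real n) - (real n - 2 * real H) / real n + real (Suc k) / (2 * real n)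
       = (E k (\<lambda>e s. (real e - real s) / real n) - (real n - 2 * real H) / real n + real k / (2 * real n))
         - 1 / real n * E k (\<lambda>e s. (2 * real e - real s) / real n - 1/2)"
      by (simp add: add_divide_distrib)
    have "\<bar>E k (\<lambda>e s. (2 * real e - real s) / real n - 1/2)\<bar> \<le> E k (\<lambda>_ _. 2 * \<beta>)"
      by (rule micro_mean_abs[OF Hn, of _ u]) (use Suc reachD(5) in auto)
    then have "\<bar>E k (\<lambda>e s. (2 * real e - real s) / real n - 1/2)\<bar> \<le> 2 * \<beta>" by (simp add: micro_mean_const[OF n_pos])
    then have "1 / real n * \<bar>E k (\<lambda>e s. (2 * real e - real s) / real n - 1/2)\<bar> \<le> 1 / real n * (2 * \<beta>)"
      by (intro mult_left_mono) auto
    then have "\<bar>1 / real n * E k (\<lambda>e s. (2 * real e - real s) / real n - 1/2)\<bar> \<le> 2 * \<beta> / real n"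
      by (simp add: abs_mult)
    moreover have "\<bar>E k (\<lambda>e s. (real e - real s) / real n) - (real n - 2 * real H) / real n + real k / (2 * real n)\<bar> \<le> real k * (2 * \<beta> / real n)"
      using Suc by simp
    moreover have "real (Suc k) * (2 * \<beta> / real n) = real k * (2 * \<beta> / real n) + 2 * \<beta> / real n"
      by (simp add: algebra_simps add_divide_distrib)
    ultimately show ?case unfolding eq by linarith
  qed
  have "\<bar>E k Y - real k * ((real n - 2 * real H) / real n) + real k * (real k - 1) / (4 * real n)\<bar> \<le> real k * (real u * (2 * \<beta> / real n)) / 2
      + real k * (real u * (2 * \<beta> / real n)) / 2"
    if "k \<le> u" for k
    using that
  proof (induction k)
    case 0 then show ?case by (simp add: micro_mean_0 Y_def)
  next
    case (Suc k)
    have "E (Suc k) Y = E k (\<lambda>e s. Y e s + (real e - real s) / real n)"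
      unfolding micro_mean_Suc by (rule micro_mean_cong[OF Hn, of _ u]) (use Suc in \<open>auto simp: jump_Y\<close>)
    then have e: "E (Suc k) Y = E k Y + E k (\<lambda>e s. (real e - real s) / real n)" by (simp only: micro_mean_add)
    have "real (Suc k) * (real (Suc k) - 1) / (4 * real n) = real k * (real k - 1) / (4 * real n) + real k / (2 * real n)"
      using n_pos by (simp add: field_simps)
    moreover have "\<bar>E k (\<lambda>e s. (real e - real s) / real n) - (real n - 2 * real H) / real n + real k / (2 * real n)\<bar> \<le> real u * (2 * \<beta> / real n)"
      using D[of k] Suc.prems beta_nonneg mult_right_mono[of "real k" "real u" "2 * \<beta> / real n"] by simp
    moreover have "real (Suc k) * ((real n - 2 * real H) / real n) = real k * ((real n - 2 * real H) / real n) + (real n - 2 * real H) / real n"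
      "real (Suc k) * (real u * (2 * \<beta> / real n)) = real k * (real u * (2 * \<beta> / real n)) + real u * (2 * \<beta> / real n)"
      by (simp_all only: of_nat_Suc distrib_right mult_1_left add.commute)
    moreover have "\<bar>E k Y - real k * ((real n - 2 * real H) / real n) + real k * (real k - 1) / (4 * real n)\<bar> \<le> real k * (real u * (2 * \<beta> / real n)) / 2
      + real k * (real u * (2 * \<beta> / real n)) / 2" using Suc by simp
    ultimately show ?case using e by linarith
  qed
  from this[of u] have "\<bar>E u Y - real u * ((real n - 2 * real H) / real n) + real u * (real u - 1) / (4 * real n)\<bar> \<le> real u * (real u * (2 * \<beta> / real n))" by simp
  moreover have "real u * (real u - 1) / (4 * real n) = (real u)\<^sup>2 / (4 * real n) - real u / (4 * real n)"
    by (simp add: power2_eq_square algebra_simps diff_divide_distrib)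
  moreover have "real u * (real u * (2 * \<beta> / real n)) = 2 * (real u)\<^sup>2 * \<beta> / real n" by (simp add: power2_eq_square)
  moreover have "0 \<le> real u / (4 * real n)" by simp
  ultimately show ?thesis unfolding times_divide_eq_right abs_le_iff by linarith
qed

definition \<mu> :: real where "\<mu> = (real n - real H) * (1 - 1 / real n) ^ u"

lemma empty_mean: "E k (\<lambda>e s. real e) = (real n - real H) * (1 - 1 / real n) ^ k"
proof (induction k)
  case 0 then show ?case using Hn by (simp add: micro_mean_0 of_nat_diff)
next
  case (Suc k)
  have "jump n (\<lambda>e s. real e) e s = (1 - 1 / real n) * real e" for e s
  proof -
    have "jump n (\<lambda>e s. real e) e s = real e / real n * real (e - 1) + real s / real n * real e + (real n - real e - real s) / real n * real e"
      by (simp only: jump_def)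
    also have "real e / real n * real (e - 1) = real e / real n * (real e - 1)" by (cases e) auto
    also have "a * (x - 1) + b * x + c * x = (a + b + c) * x - a" for a b c x :: real
      by (simp add: algebra_simps)
    finally show ?thesis unfolding weights by (simp add: algebra_simps)
  qed
  then have "jump n (\<lambda>e s. real e) = (\<lambda>e s. (1 - 1 / real n) * real e)" by (simp add: fun_eq_iff)
  then show ?case unfolding micro_mean_Suc by (simp only: micro_mean_cmult Suc) simp
qed

text \<open>
  The number of empty vertices is a pure death chain, so its mean is explicit and its variance grows by at
  most \<open>1\<close> per throw. This controls the round even when \<open>u\<close> is of order \<open>n\<close>.
\<close>

lemma empty_variance: "E u (\<lambda>e s. (real e - \<mu>)\<^sup>2) \<le> real u"
proof -
  define m where "m k = (real n - real H) * (1 - 1 / real n) ^ k" for k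
  define v where "v k = E k (\<lambda>e s. (real e)\<^sup>2) - (m k)\<^sup>2" for k
  have var: "E k (\<lambda>e s. (real e - m k)\<^sup>2) = v k" for k
  proof -
    have "E k (\<lambda>e s. (real e - m k)\<^sup>2) = E k (\<lambda>e s. (real e)\<^sup>2 + ((- 2 * m k) * real e + (m k)\<^sup>2))"
      by (rule arg_cong[of _ _ "E k"]) (simp add: fun_eq_iff power2_eq_square algebra_simps)
    also have "\<dots> = E k (\<lambda>e s. (real e)\<^sup>2) + ((- 2 * m k) * m k + (m k)\<^sup>2)"
      by (simp only: micro_mean_add micro_mean_cmult micro_mean_const[OF n_pos] empty_mean m_def)
    finally show ?thesis by (simp add: v_def power2_eq_square)
  qed
  have v0: "0 \<le> v k" if "k \<le> u" for k
    using micro_mean_mono[OF Hn that, of "\<lambda>_ _. 0" "\<lambda>e s. (real e - m k)\<^sup>2"] unfolding var by (simp add: micro_mean_const[OF n_pos])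
  have "v k \<le> real k" if "k \<le> u" for k
    using that
  proof (induction k)
    case 0
    have "real (n - H) = real n - real H" using Hn by simp
    then show ?case by (simp add: v_def m_def micro_mean_0)
  next
    case (Suc k)
    have "jump n (\<lambda>e s. (real e)\<^sup>2) e s = (real e)\<^sup>2 + (- (2 / real n) * (real e)\<^sup>2 + 1 / real n * real e)" for e s
    proof -
      have "jump n (\<lambda>e s. (real e)\<^sup>2) e s = real e / real n * (real (e - 1))\<^sup>2 + real s / real n * (real e)\<^sup>2 + (real n - real e - real s) / real n * (real e)\<^sup>2"
        by (simp only: jump_def)
      also have "real e / real n * (real (e - 1))\<^sup>2 = real e / real n * (real e - 1)\<^sup>2" by (cases e) auto
      also have "a * (x - 1)\<^sup>2 + b * x\<^sup>2 + c * x\<^sup>2 = (a + b + c) * x\<^sup>2 + (- 2 * (a * x) + a)" for a b c x :: real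
        by (simp add: power2_eq_square algebra_simps)
      also have "- 2 * (real e / real n * real e) + real e / real n = - (2 / real n) * (real e)\<^sup>2 + 1 / real n * real e"
        by (simp add: power2_eq_square)
      finally show ?thesis unfolding weights by simp
    qed
    then have "jump n (\<lambda>e s. (real e)\<^sup>2) = (\<lambda>e s. (real e)\<^sup>2 + (- (2 / real n) * (real e)\<^sup>2 + 1 / real n * real e))" by (simp add: fun_eq_iff)
    then have S: "E (Suc k) (\<lambda>e s. (real e)\<^sup>2) = E k (\<lambda>e s. (real e)\<^sup>2) + (- (2 / real n) * E k (\<lambda>e s. (real e)\<^sup>2) + 1 / real n * m k)"
      unfolding micro_mean_Suc by (simp only: micro_mean_add micro_mean_cmult empty_mean m_def)
    have "m (Suc k) = m k - m k / real n" by (simp add: m_def algebra_simps)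
    then have "v (Suc k) = v k - 2 / real n * v k + m k / real n - (m k / real n)\<^sup>2"
      unfolding v_def S by (simp only: power2_eq_square) (simp add: algebra_simps)
    moreover have "0 \<le> 2 / real n * v k" using v0[of k] Suc by simp
    moreover have "m k / real n \<le> 1"
    proof -
      have "(1 - 1 / real n) ^ k \<le> 1" using n_pos by (intro power_le_one) auto
      then have "m k \<le> (real n - real H) * 1" unfolding m_def using Hn by (intro mult_left_mono) auto
      then show ?thesis using n_pos by simp
    qed
    moreover have "v k \<le> real k" "0 \<le> (m k / real n)\<^sup>2" "real (Suc k) = real k + 1" using Suc by auto
    ultimately show ?case by linarith
  qed
  then show ?thesis using var[of u] by (simp add: m_def \<mu>_def)
qed

lemma power_upper: fixes p :: real assumes "0 \<le> p" "p \<le> 1" shows "(1 - p) ^ k \<le> 1 - real k * p + (real k)\<^sup>2 * p\<^sup>2 / 2"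
proof (induction k)
  case (Suc k)
  have "(1 - p) ^ Suc k \<le> (1 - p) * (1 - real k * p + (real k)\<^sup>2 * p\<^sup>2 / 2)"
    using Suc assms by (simp add: mult_left_mono)
  also have "\<dots> = 1 - real (Suc k) * p + (real (Suc k))\<^sup>2 * p\<^sup>2 / 2 - (p\<^sup>2 / 2 + (real k)\<^sup>2 * p^3 / 2)"
    by (simp add: power2_eq_square power3_eq_cube field_simps)
  also have "\<dots> \<le> 1 - real (Suc k) * p + (real (Suc k))\<^sup>2 * p\<^sup>2 / 2"
  proof -
    have "0 \<le> p\<^sup>2 / 2 + (real k)\<^sup>2 * p^3 / 2" using assms by (intro add_nonneg_nonneg) auto
    then show ?thesis by linarith
  qed
  finally show ?case .
qed simp

lemma power_lower: fixes p :: real assumes "0 \<le> p" "p \<le> 1"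
  shows "1 - real k * p + real k * (real k - 1) * p\<^sup>2 / 2 - (real k)^3 * p^3 / 6 \<le> (1 - p) ^ k"
proof (induction k)
  case (Suc k)
  have "1 - real (Suc k) * p + real (Suc k) * (real (Suc k) - 1) * p\<^sup>2 / 2 - (real (Suc k))^3 * p^3 / 6
     = (1 - p) * (1 - real k * p + real k * (real k - 1) * p\<^sup>2 / 2 - (real k)^3 * p^3 / 6)
        - ((6 * real k + 1) * p^3 / 6 + (real k)^3 * p^4 / 6)"
    by (simp add: eval_nat_numeral field_simps)
  also have "\<dots> \<le> (1 - p) * (1 - real k * p + real k * (real k - 1) * p\<^sup>2 / 2 - (real k)^3 * p^3 / 6)"
  proof -
    have "0 \<le> (6 * real k + 1) * p^3 / 6 + (real k)^3 * p^4 / 6" using assms by (intro add_nonneg_nonneg) auto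
    then show ?thesis by linarith
  qed
  also have "\<dots> \<le> (1 - p) ^ Suc k" using Suc assms by (simp add: mult_left_mono)
  finally show ?case .
qed simp

text \<open>
  There are \<open>n - e - s\<close> multiply occupied vertices with at least two particles each, which bounds the number of
  unhappy particles by \<open>2 * (e + M - n)\<close>.
\<close>

lemma mean_upper: "E u (\<lambda>e s. - Y e s) \<le> real u * ((2 * real M - real n) / real n - real u / real n)"
proof -
  define x m where "x = real u / real n" and "m = real M / real n"
  have n: "0 < real n" using n_pos by simp
  have xm: "0 \<le> x" "x \<le> m" "m \<le> 1" using u Mn n by (auto simp: x_def m_def divide_right_mono)
  have "E u (\<lambda>e s. - Y e s) \<le> E u (\<lambda>e s. 2 * real e + (2 * real M - 2 * real n - real u))"
  proof (rule micro_mean_mono[OF Hn order_refl])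
    fix e s assume "R e s"
    then have "2 * real n \<le> 2 * real e + real s + real H + real u" unfolding reach_def by linarith
    then show "- Y e s \<le> 2 * real e + (2 * real M - 2 * real n - real u)"
      unfolding Y_def using real_H by linarith
  qed
  also have "\<dots> = 2 * \<mu> + (2 * real M - 2 * real n - real u)"
    by (simp only: micro_mean_add micro_mean_cmult micro_mean_const[OF n_pos] empty_mean \<mu>_def)
  also have "\<mu> \<le> (real n - real H) * (1 - x + x\<^sup>2 / 2)"
    unfolding \<mu>_def using power_upper[of "1 / real n" u] n Hn
    by (intro mult_left_mono) (auto simp: x_def power_divide)
  also have "2 * ((real n - real H) * (1 - x + x\<^sup>2 / 2)) + (2 * real M - 2 * real n - real u)
      = real u * ((2 * real M - real n) / real n - real u / real n) - real u * (x * (m - x))"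
  proof -
    have e: "real u = x * real n" "real M = m * real n" "real H = m * real n - x * real n"
      using n real_H by (auto simp: x_def m_def)
    show ?thesis unfolding e using n by (simp add: power2_eq_square field_simps)
  qed
  also have "\<dots> \<le> real u * ((2 * real M - real n) / real n - real u / real n)"
    using xm by simp
  finally show ?thesis by simp
qed

text \<open>
  At least \<open>e + M - n\<close> particles are unhappy after the round. The lemma says that this is of order \<open>u\<close>
  on average, even from the initial state \<open>u = M\<close>.
\<close>

lemma empty_mean_lower:
  assumes "3/8 * real n \<le> real M" "real M \<le> 5/8 * real n" "32 \<le> n"
  shows "real n - real M + real u / 8 \<le> \<mu>"
proof -
  define x m r where "x = real u / real n" and "m = real M / real n" and "r = 1 / real n"
  have n: "0 < real n" using n_pos by simp
  have xm: "0 \<le> x" "x \<le> m" "3/8 \<le> m" "m \<le> 5/8" and r: "0 \<le> r" "r \<le> 1/32"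
    using u Mn n assms by (auto simp: x_def m_def r_def divide_right_mono field_simps)
  have t: "1/8 \<le> m - x + (1 - (m - x)) * (x / 2 - x\<^sup>2 / 6 - r / 2)"
  proof -
    have "x\<^sup>2 \<le> 5/8 * x" using xm mult_right_mono[of x "5/8" x] by (simp add: power2_eq_square)
    then have "3/8 * x - 1/64 \<le> x / 2 - x\<^sup>2 / 6 - r / 2" using xm r by linarith
    then have "(1 - (m - x)) * (3/8 * x - 1/64) \<le> (1 - (m - x)) * (x / 2 - x\<^sup>2 / 6 - r / 2)"
      using xm by (intro mult_left_mono) auto
    moreover have "1/8 \<le> (m - x) + (1 - (m - x)) * (3/8 * x - 1/64)"
    proof -
      have "(m - x) + (1 - (m - x)) * (3/8 * x - 1/64)
          = 3/8 * m - 1/64 + (m - x) * (5/8 + 1/64 - 3/8 * m) + 3/8 * (m - x)\<^sup>2"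
        by (simp add: power2_eq_square field_simps)
      moreover have "0 \<le> (m - x) * (5/8 + 1/64 - 3/8 * m)" using xm by (intro mult_nonneg_nonneg) auto
      moreover have "0 \<le> 3/8 * (m - x)\<^sup>2" by simp
      ultimately show ?thesis using xm by linarith
    qed
    ultimately show ?thesis by linarith
  qed
  have "(real n - real H) * (1 - x + x * (x - r) / 2 - x^3 / 6) \<le> \<mu>"
    unfolding \<mu>_def
  proof (intro mult_left_mono)
    have "real u * (1 / real n) = x" "real u * (real u - 1) * (1 / real n)\<^sup>2 / 2 = x * (x - r) / 2"
        "(real u)^3 * (1 / real n)^3 / 6 = x^3 / 6"
      by (auto simp: x_def r_def power2_eq_square power3_eq_cube diff_divide_distrib algebra_simps)
    then show "1 - x + x * (x - r) / 2 - x^3 / 6 \<le> (1 - 1 / real n) ^ u"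
      using power_lower[of "1 / real n" u] n by simp
  qed (use Hn in simp)
  moreover have "(real n - real H) * (1 - x + x * (x - r) / 2 - x^3 / 6)
      = real n - real M + real u * (m - x + (1 - (m - x)) * (x / 2 - x\<^sup>2 / 6 - r / 2))"
  proof -
    have e: "real u = x * real n" "real M = m * real n" "real H = m * real n - x * real n"
      using n real_H by (auto simp: x_def m_def)
    show ?thesis unfolding e by (simp add: power2_eq_square power3_eq_cube field_simps)
  qed
  moreover have "real u * (1/8) \<le> real u * (m - x + (1 - (m - x)) * (x / 2 - x\<^sup>2 / 6 - r / 2))"
    using t by (intro mult_left_mono) auto
  ultimately show ?thesis by linarith
qed

text \<open>
  Each of the \<open>u\<close> particles in turn finds an empty vertex with probability at least \<open>1/4\<close>.
\<close>

lemma settle_probability: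
  assumes "4 * M \<le> 3 * n"
  shows "(1/4) ^ u \<le> next_round n M (\<lambda>v. if v = 0 then 1 else 0 :: real) u"
proof -
  let ?\<Phi> = "\<lambda>e s. if M - s = 0 then 1 else 0 :: real"
  have "(1/4) ^ k \<le> (jump n ^^ k) ?\<Phi> e s" if "reach n H (u - k) e s" "k \<le> u" "s + k = M" "n + k \<le> M + e" for k e s
    using that
  proof (induction k arbitrary: e s)
    case (Suc k)
    have e: "0 < e" using Suc.prems Mn by linarith
    define f where "f = (jump n ^^ k) ?\<Phi>"
    have f0: "0 \<le> f e s" if "reach n H (u - k) e s" for e s
    proof -
      have "(jump n ^^ k) (\<lambda>_ _. 0 :: real) e s \<le> f e s"
        unfolding f_def by (rule jumps_mono[OF that]) auto
      moreover have "(jump n ^^ k) (\<lambda>_ _. 0 :: real) = (\<lambda>_ _. 0)"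
        by (induction k) (auto simp: jump_def fun_eq_iff)
      ultimately show ?thesis by simp
    qed
    have sk: "Suc (u - Suc k) = u - k" using Suc.prems by simp
    have IH: "(1/4) ^ k \<le> f (e - 1) (s + 1)"
      unfolding f_def using Suc.prems e reach_Suc(1)[OF Suc.prems(1) e] sk by (intro Suc.IH) auto
    have q: "1/4 \<le> real e / real n" using Suc.prems(4) assms n_pos by (simp add: field_simps)
    have "1/4 * (1/4) ^ k \<le> real e / real n * f (e - 1) (s + 1)"
      using IH q by (intro mult_mono) auto
    moreover have "0 \<le> real s / real n * f e (s - 1)"
      using f0[OF reach_Suc(2)[OF Suc.prems(1), unfolded sk]] by (cases "s = 0") auto
    moreover have "0 \<le> (real n - real e - real s) / real n * f e s"
      using f0[OF reach_Suc(3)[OF Suc.prems(1), unfolded sk]] Suc.prems(1)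
      by (intro mult_nonneg_nonneg) (auto simp: reach_def)
    ultimately show ?case unfolding funpow.simps o_def f_def[symmetric] jump_def[of n f] power_Suc by linarith
  qed simp
  from this[OF _ order_refl, of "n - H" H] show ?thesis
    unfolding next_round_def H_def[symmetric] using u Mn reach_0[OF Hn] by (auto simp: H_def)
qed

end

section \<open>Taylor estimates with a singularity at the origin\<close>

lemma ln_le_sqrt: fixes t :: real assumes "0 < t" shows "ln t \<le> 2 * sqrt t"
proof -
  have "ln (sqrt t) \<le> sqrt t - 1" using assms by (intro ln_le_minus_one) auto
  then show ?thesis using assms by (simp add: ln_sqrt)
qed

text \<open>
  Only differentiability in the open interval is used, so that the left end point may be the singularity \<open>0\<close>.
\<close>

lemma deriv_bound_imp_diff_bound:
  fixes f D :: "real \<Rightarrow> real"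
  assumes ab: "a \<le> b" and cf: "continuous_on {a..b} f" and cD: "continuous_on {a..b} D"
    and f: "\<And>x. a < x \<Longrightarrow> x < b \<Longrightarrow> (f has_real_derivative f' x) (at x)"
    and D: "\<And>x. a < x \<Longrightarrow> x < b \<Longrightarrow> (D has_real_derivative D' x) (at x)"
    and le: "\<And>x. a < x \<Longrightarrow> x < b \<Longrightarrow> \<bar>f' x\<bar> \<le> D' x"
  shows "\<bar>f b - f a\<bar> \<le> D b - D a"
proof -
  have "D a - f a \<le> D b - f b"
  proof (rule DERIV_nonneg_imp_increasing_open[OF ab])
    fix x assume "a < x" "x < b"
    then show "\<exists>y. ((\<lambda>x. D x - f x) has_real_derivative y) (at x) \<and> 0 \<le> y"
      using DERIV_diff[OF D f] le[of x] by (intro exI[of _ "D' x - f' x"]) auto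
  qed (intro continuous_intros cf cD)
  moreover have "D a + f a \<le> D b + f b"
  proof (rule DERIV_nonneg_imp_increasing_open[OF ab])
    fix x assume "a < x" "x < b"
    then show "\<exists>y. ((\<lambda>x. D x + f x) has_real_derivative y) (at x) \<and> 0 \<le> y"
      using DERIV_add[OF D f] le[of x] by (intro exI[of _ "D' x + f' x"]) auto
  qed (intro continuous_intros cf cD)
  ultimately show ?thesis by linarith
qed

text \<open>
  For \<open>y\<close> far below \<open>x\<close> the segment runs into the singularity. There the bound on \<open>f2\<close> gives
  \<open>abs (f1 r - f1 x) \<le> C * ln (x / r)\<close>, which is integrable down to \<open>r = 0\<close>; the remainder is then of order \<open>x\<close>, and
  \<open>abs (y - x)\<close> is of order \<open>x\<close> as well.
\<close>

lemma taylor2_remainder: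
  fixes f f1 f2 f3 :: "real \<Rightarrow> real"
  assumes C: "0 \<le> C" and cont: "continuous_on {0..} f"
    and d1: "\<And>x. 0 < x \<Longrightarrow> (f has_real_derivative f1 x) (at x)"
    and d2: "\<And>x. 0 < x \<Longrightarrow> (f1 has_real_derivative f2 x) (at x)"
    and d3: "\<And>x. 0 < x \<Longrightarrow> (f2 has_real_derivative f3 x) (at x)"
    and b2: "\<And>x. 0 < x \<Longrightarrow> \<bar>f2 x\<bar> \<le> C / x" and b3: "\<And>x. 0 < x \<Longrightarrow> \<bar>f3 x\<bar> \<le> C * (1 / x\<^sup>2 + 1)"
    and x: "0 < x" and y: "0 \<le> y"
  shows "\<bar>f y - f x - f1 x * (y - x) - f2 x * (y - x)\<^sup>2 / 2\<bar> \<le> 40 * C * \<bar>y - x\<bar>^3 * (1 / x\<^sup>2 + 1)"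
proof (cases "x / 2 \<le> y")
  case True
  define B where "B = 4 * C * (1 / x\<^sup>2 + 1)"
  have B0: "0 \<le> B" using C by (simp add: B_def)
  have b3': "\<bar>f3 z\<bar> \<le> B" if "x / 2 \<le> z" for z
  proof -
    have "1 / z\<^sup>2 \<le> 1 / (x/2)\<^sup>2" using that x by (intro divide_left_mono power_mono mult_pos_pos) auto
    then have "1 / z\<^sup>2 + 1 \<le> 4 * (1 / x\<^sup>2 + 1)" by (simp add: power_divide)
    then have "C * (1 / z\<^sup>2 + 1) \<le> C * (4 * (1 / x\<^sup>2 + 1))" using C by (rule mult_left_mono)
    then show ?thesis using b3[of z] that x by (simp add: B_def mult_ac)
  qed
  have "\<bar>f y - f x - f1 x * (y - x) - f2 x * (y - x)\<^sup>2 / 2\<bar> \<le> B * \<bar>y - x\<bar>^3"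
  proof (cases "y = x")
    case False
    define a where "a = min x y"
    define b where "b = max x y"
    have ab: "x / 2 \<le> a" "a \<le> x" "x \<le> b" "a \<le> y" "y \<le> b" using True x by (auto simp: a_def b_def)
    define F :: "nat \<Rightarrow> real \<Rightarrow> real" where "F m = (if m = 0 then f else if m = 1 then f1 else if m = 2 then f2 else f3)" for m
    have "\<exists>t. (if y < x then y < t \<and> t < x else x < t \<and> t < y) \<and>
        f y = (\<Sum>m<3. F m x / fact m * (y - x)^m) + F 3 t / fact 3 * (y - x)^3"
    proof (rule Taylor[where a = a and b = b])
      show "\<forall>m t. m < 3 \<and> a \<le> t \<and> t \<le> b \<longrightarrow> (F m has_real_derivative F (Suc m) t) (at t)"
      proof (intro allI impI)
        fix m :: nat and t assume mt: "m < 3 \<and> a \<le> t \<and> t \<le> b"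
        then have "0 < t" using ab x by linarith
        moreover have "m = 0 \<or> m = 1 \<or> m = 2" using mt by linarith
        ultimately show "(F m has_real_derivative F (Suc m) t) (at t)"
          using d1 d2 d3 by (auto simp: F_def)
      qed
    qed (use ab False in \<open>auto simp: F_def\<close>)
    then obtain t where t: "if y < x then y < t \<and> t < x else x < t \<and> t < y"
      and eq: "f y = f x + f1 x * (y - x) + f2 x / 2 * (y - x)\<^sup>2 + f3 t / 6 * (y - x)^3"
      by (auto simp: eval_nat_numeral F_def)
    have "x / 2 \<le> t" using t True x by (auto split: if_splits)
    have "f y - f x - f1 x * (y - x) - f2 x * (y - x)\<^sup>2 / 2 = f3 t / 6 * (y - x)^3"
      using eq by simp
    then have "\<bar>f y - f x - f1 x * (y - x) - f2 x * (y - x)\<^sup>2 / 2\<bar> = \<bar>f3 t\<bar> / 6 * \<bar>y - x\<bar>^3"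
      by (simp only: abs_mult power_abs abs_divide abs_numeral)
    also have "\<dots> \<le> B * \<bar>y - x\<bar>^3" using b3'[OF \<open>x / 2 \<le> t\<close>] B0 by (intro mult_right_mono) auto
    finally show ?thesis .
  qed (simp add: B0)
  also have "\<dots> \<le> 40 * C * \<bar>y - x\<bar>^3 * (1 / x\<^sup>2 + 1)"
  proof -
    have "4 * C * ((1 / x\<^sup>2 + 1) * \<bar>y - x\<bar>^3) \<le> 40 * C * ((1 / x\<^sup>2 + 1) * \<bar>y - x\<bar>^3)"
      using C by (intro mult_right_mono mult_nonneg_nonneg) auto
    then show ?thesis unfolding B_def by (simp only: mult_ac)
  qed
  finally show ?thesis .
next
  case False
  then have yx: "y < x / 2" by simp
  have ln_bound: "\<bar>f1 r - f1 x\<bar> \<le> 2 * C * sqrt x / sqrt r" if r: "0 < r" "r \<le> x" for r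
  proof -
    have "\<bar>f1 x - f1 r\<bar> \<le> C * ln x - C * ln r"
    proof (rule deriv_bound_imp_diff_bound[OF r(2)])
      show "(f1 has_real_derivative f2 z) (at z)" if "r < z" "z < x" for z
        using that r by (intro d2) auto
      show "((\<lambda>z. C * ln z) has_real_derivative C * (1 / z)) (at z)" if "r < z" "z < x" for z
        using that r by (intro DERIV_cmult DERIV_ln_divide) auto
      show "\<bar>f2 z\<bar> \<le> C * (1 / z)" if "r < z" "z < x" for z using b2[of z] that r by simp
      show "continuous_on {r..x} f1"
        using r by (intro continuous_at_imp_continuous_on ballI DERIV_isCont[OF d2]) auto
      show "continuous_on {r..x} (\<lambda>z. C * ln z)" using r by (intro continuous_intros) auto
    qed
    also have "\<dots> = C * ln (x / r)" using r x by (simp add: ln_div algebra_simps)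
    also have "\<dots> \<le> C * (2 * sqrt (x / r))" using C r x by (intro mult_left_mono ln_le_sqrt) auto
    finally show ?thesis by (simp add: real_sqrt_divide abs_minus_commute mult_ac)
  qed
  (* The square root serves as an integrable majorant that is explicit at both end points. *)
  have "\<bar>(f x - f1 x * x) - (f y - f1 x * y)\<bar> \<le> 4 * C * sqrt x * sqrt x - 4 * C * sqrt x * sqrt y"
  proof (rule deriv_bound_imp_diff_bound[where f = "\<lambda>r. f r - f1 x * r" and D = "\<lambda>r. 4 * C * sqrt x * sqrt r"])
    show "y \<le> x" using yx y by simp
    show "continuous_on {y..x} (\<lambda>r. f r - f1 x * r)"
      using cont y by (intro continuous_intros) (auto intro: continuous_on_subset)
    show "continuous_on {y..x} (\<lambda>r. 4 * C * sqrt x * sqrt r)" by (intro continuous_intros)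
    show "((\<lambda>r. f r - f1 x * r) has_real_derivative f1 r - f1 x) (at r)" if "y < r" "r < x" for r
      using that y d1 by (auto intro!: derivative_eq_intros)
    show "((\<lambda>r. 4 * C * sqrt x * sqrt r) has_real_derivative 2 * C * sqrt x / sqrt r) (at r)" if "y < r" "r < x" for r
      using that y by (auto intro!: derivative_eq_intros simp: field_simps)
    show "\<bar>f1 r - f1 x\<bar> \<le> 2 * C * sqrt x / sqrt r" if "y < r" "r < x" for r
      using ln_bound that y by simp
  qed
  also have "\<dots> \<le> 4 * C * x" using C x y by (simp add: mult.assoc)
  finally have 1: "\<bar>f y - f x - f1 x * (y - x)\<bar> \<le> 4 * C * x" by (simp add: algebra_simps)
  define d where "d = \<bar>y - x\<bar>"
  have d: "x / 2 \<le> d" "d \<le> x" using yx y by (auto simp: d_def)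
  have 2: "\<bar>f2 x * (y - x)\<^sup>2 / 2\<bar> \<le> C * x"
  proof -
    have "\<bar>f2 x * (y - x)\<^sup>2 / 2\<bar> = \<bar>f2 x\<bar> * d\<^sup>2 / 2" by (simp add: abs_mult d_def)
    also have "\<dots> \<le> C / x * x\<^sup>2 / 2" using b2[OF x] d x C by (intro divide_right_mono mult_mono power_mono) auto
    also have "\<dots> \<le> C * x" using x C by (simp add: power2_eq_square)
    finally show ?thesis .
  qed
  have "5 * (C * x) \<le> 40 * C * d^3 * (1 / x\<^sup>2)"
  proof -
    have "(x/2)^3 \<le> d^3" using d x by (intro power_mono) auto
    then have "40 * C * (x/2)^3 * (1 / x\<^sup>2) \<le> 40 * C * d^3 * (1 / x\<^sup>2)" using C by (intro mult_right_mono mult_left_mono) auto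
    moreover have "40 * C * (x/2)^3 * (1 / x\<^sup>2) = 5 * (C * x)" using x by (simp add: power_divide power2_eq_square power3_eq_cube)
    ultimately show ?thesis by simp
  qed
  also have "\<dots> \<le> 40 * C * d^3 * (1 / x\<^sup>2 + 1)" using C d x by (intro mult_left_mono) auto
  finally show ?thesis using 1 2 unfolding d_def by linarith
qed

lemma diff_bound_far:
  fixes f f1 :: "real \<Rightarrow> real"
  assumes C: "0 \<le> C" and d1: "\<And>x. 0 < x \<Longrightarrow> (f has_real_derivative f1 x) (at x)"
    and b1: "\<And>x. 0 < x \<Longrightarrow> \<bar>f1 x\<bar> \<le> C / x\<^sup>2" and x: "0 < a" "a \<le> x" "a \<le> y"
  shows "\<bar>f y - f x\<bar> \<le> C / a\<^sup>2 * \<bar>y - x\<bar>"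
proof -
  have main: "\<bar>f v - f u\<bar> \<le> C / a\<^sup>2 * v - C / a\<^sup>2 * u" if "a \<le> u" "u \<le> v" for u v
  proof (rule deriv_bound_imp_diff_bound[OF that(2)])
    show "(f has_real_derivative f1 z) (at z)" if "u < z" for z using that \<open>a \<le> u\<close> x d1 by auto
    show "((*) (C / a\<^sup>2) has_real_derivative C / a\<^sup>2) (at z)" for z
      using DERIV_cmult[OF DERIV_ident, of "C / a\<^sup>2" z UNIV] by simp
    show "\<bar>f1 z\<bar> \<le> C / a\<^sup>2" if "u < z" for z
    proof -
      have "C / z\<^sup>2 \<le> C / a\<^sup>2" using C x that \<open>a \<le> u\<close> by (intro divide_left_mono power_mono) auto
      then show ?thesis using b1[of z] x that \<open>a \<le> u\<close> by simp
    qed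
    show "continuous_on {u..v} f" using x \<open>a \<le> u\<close>
      by (intro continuous_at_imp_continuous_on ballI DERIV_isCont[OF d1]) auto
  qed (intro continuous_intros)
  show ?thesis
    using main[of x y] main[of y x] x by (cases "x \<le> y") (auto simp: abs_minus_commute right_diff_distrib)
qed

section \<open>One round acts like the generator of the limit diffusion\<close>

text \<open>
  With \<open>g = n powr (1/6)\<close> all occurring powers of \<open>n\<close> are integral powers of \<open>g\<close>; in particular
  \<open>sqrt n = g ^ 3\<close>. The level \<open>u = g ^ 4\<close> separates the range where the second order expansion is accurate from the
  range where first order bounds suffice.
\<close>

locale scaled_round = one_round +
  fixes g c :: real
  assumes g1: "1 \<le> g" and sixth_root: "g ^ 6 = real n" and c0: "0 \<le> c" and crit: "\<bar>2 * real M - real n\<bar> \<le> c * g ^ 3"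
    and M_lo: "3/8 * real n \<le> real M" and M_hi: "real M \<le> 5/8 * real n" and n32: "32 \<le> n"
begin

definition w where "w = sqrt (real u)"
definition x where "x = real u / g ^ 3"
definition \<rho> where "\<rho> = (2 * real M - real n) / g ^ 3"

lemma g_pos: "0 < g" using g1 by simp
lemma w1: "1 \<le> w" using u by (simp add: w_def)
lemma w2: "w\<^sup>2 = real u" by (simp add: w_def)
lemma x_pos: "0 < x" using u g_pos by (simp add: x_def)

lemma beta_le: "\<beta> \<le> c / g ^ 3 + 4 * real u / g ^ 6"
proof -
  have "\<beta> \<le> (c * g ^ 3 + 4 * real u) / g ^ 6"
    unfolding \<beta>_def sixth_root using crit by (intro divide_right_mono) (auto simp: abs_minus_commute)
  also have "\<dots> = c / g ^ 3 + 4 * real u / g ^ 6"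
    using g_pos by (simp add: add_divide_distrib eval_nat_numeral)
  finally show ?thesis .
qed

lemma next_round_scaled: "next_round n M F u = E u (\<lambda>e s. F (M - s))"
  using u unfolding H_def by (intro next_round_eq_micro_mean) auto

lemma next_unhappy:
  assumes "R e s"
  shows "real (M - s) = real u - Y e s" and "real e + real M - real n \<le> real (M - s)"
proof -
  have "s \<le> M" using assms u unfolding reach_def H_def by auto
  then show "real (M - s) = real u - Y e s" using u by (simp add: Y_def H_def)
  show "real e + real M - real n \<le> real (M - s)" using assms \<open>s \<le> M\<close> unfolding reach_def by auto
qed

lemma drift_upper: "E u (\<lambda>e s. - Y e s) \<le> real u * (c / g ^ 3 - real u / g ^ 6)"
proof -
  have "(2 * real M - real n) / real n \<le> c * g ^ 3 / g ^ 6"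
    unfolding sixth_root using crit by (intro divide_right_mono) auto
  also have "\<dots> = c / g ^ 3" using g_pos by (simp add: eval_nat_numeral)
  finally have "real u * ((2 * real M - real n) / real n - real u / real n) \<le> real u * (c / g ^ 3 - real u / g ^ 6)"
    unfolding sixth_root by (intro mult_left_mono) auto
  then show ?thesis using mean_upper by linarith
qed

definition generator_at where "generator_at \<alpha> f1 f2 = x / 2 * f2 x + (2 * \<alpha> * x - 7/4 * x\<^sup>2) * f1 x" for \<alpha> :: real and f1 f2 :: "real \<Rightarrow> real"

context
  fixes \<alpha> :: real and f f1 f2 f3 :: "real \<Rightarrow> real" and C :: real
  assumes C0: "0 \<le> C" and cont: "continuous_on {0..} f"
    and bd: "\<And>x. 0 \<le> x \<Longrightarrow> \<bar>f x\<bar> \<le> C"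
    and d1: "\<And>x. 0 < x \<Longrightarrow> (f has_real_derivative f1 x) (at x)"
    and d2: "\<And>x. 0 < x \<Longrightarrow> (f1 has_real_derivative f2 x) (at x)"
    and d3: "\<And>x. 0 < x \<Longrightarrow> (f2 has_real_derivative f3 x) (at x)"
    and b1: "\<And>x. 0 < x \<Longrightarrow> \<bar>f1 x\<bar> \<le> C / x" and b1': "\<And>x. 0 < x \<Longrightarrow> \<bar>f1 x\<bar> \<le> C / x\<^sup>2"
    and b2: "\<And>x. 0 < x \<Longrightarrow> \<bar>f2 x\<bar> \<le> C / x" and b3: "\<And>x. 0 < x \<Longrightarrow> \<bar>f3 x\<bar> \<le> C * (1 / x\<^sup>2 + 1)"
begin

text \<open>
  Second order Taylor expansion around \<open>x\<close>. Here \<open>u \<le> n powr (2/3)\<close> makes \<open>w * \<beta>\<close> bounded, that is, the drift over a whole round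
  is at most of the order of the fluctuation \<open>w = sqrt u\<close>.
\<close>

lemma one_step_low_level:
  assumes ug: "real u \<le> g ^ 4"
  shows "\<bar>next_round n M (\<lambda>v. f (real v / g ^ 3)) u - f x - generator_at \<alpha> f1 f2 / g ^ 3\<bar>
    \<le> (40 * C * (11 * ((c + 4)^4 + 26 * (1 + (c + 4)\<^sup>2)) + 2 * (1 + (c + 4)\<^sup>2)) + C * (2 * c + 9) + C * (4 * (c + 5) * (c + 4) + 1))
       / g ^ 3 * (1 / w + real u / g ^ 4 + \<bar>\<rho> - 2 * \<alpha>\<bar> + 1 / g)"
proof -
  note gp = g_pos
  have wg: "w \<le> g\<^sup>2"
  proof (rule power2_le_imp_le)
    show "w\<^sup>2 \<le> (g\<^sup>2)\<^sup>2" using ug unfolding w2 by simp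
  qed simp
  have wpos: "0 < w" using w1 by simp
  have wb: "w * \<beta> \<le> c / g + 4 * (real u / g ^ 4)"
  proof -
    have "w * \<beta> \<le> w * (c / g ^ 3 + 4 * real u / g ^ 6)" using beta_le wpos by (intro mult_left_mono) auto
    also have "\<dots> = (c / g ^ 3 + 4 * real u / g ^ 6) * w" by simp
    also have "\<dots> \<le> (c / g ^ 3 + 4 * real u / g ^ 6) * g\<^sup>2" using wg c0 gp by (intro mult_left_mono) auto
    also have "\<dots> = c / g + 4 * (real u / g ^ 4)" using gp by (simp add: distrib_right eval_nat_numeral)
    finally show ?thesis .
  qed
  have ug1: "real u / g ^ 4 \<le> 1" using ug gp by simp
  have cg: "c / g \<le> c" using c0 g1 by (simp add: divide_le_eq mult_le_cancel_left1)
  have wb': "w * \<beta> \<le> c + 4" "0 \<le> w * \<beta>" using wb ug1 cg wpos beta_nonneg by auto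
  have b: "real u * \<beta>\<^sup>2 \<le> (c + 4)\<^sup>2"
    using power_mono[OF wb', of 2] unfolding power_mult_distrib w2 .
  define T where "T = 1 / w + real u / g ^ 4 + \<bar>\<rho> - 2 * \<alpha>\<bar> + 1 / g"
  have T: "1 / w \<le> T" "real u / g ^ 4 \<le> T" "\<bar>\<rho> - 2 * \<alpha>\<bar> \<le> T" "1 / g \<le> T" "\<bar>\<rho> - 2 * \<alpha>\<bar> + 1 / g \<le> T" "1 / w + real u / g ^ 4 \<le> T"
      "real u / g ^ 4 + 1 / g \<le> T"
    unfolding T_def using wpos gp by auto
  have T0: "0 \<le> T" using T(1) wpos by (meson less_imp_le order_trans zero_le_divide_1_iff)
  define K1 where "K1 = 11 * ((c + 4)^4 + 26 * (1 + (c + 4)\<^sup>2)) + 2 * (1 + (c + 4)\<^sup>2)"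
  (* The third absolute moment is interpolated between the second and the fourth one. *)
  have third: "E u (\<lambda>e s. \<bar>Y e s\<bar>^3) \<le> K1 * w^3"
  proof -
    have "E u (\<lambda>e s. \<bar>Y e s\<bar>^3) \<le> E u (\<lambda>e s. (1 / (2 * w)) * (Y e s)^4 + (w / 2) * (Y e s)\<^sup>2)"
    proof (rule micro_mean_mono[OF Hn order_refl])
      fix e s
      define y where "y = \<bar>Y e s\<bar>"
      have "0 \<le> y\<^sup>2 * (y - w)\<^sup>2 / (2 * w)" using wpos by simp
      also have "\<dots> = 1 / (2 * w) * y^4 + w / 2 * y\<^sup>2 - y^3"
        using wpos by (simp add: eval_nat_numeral field_simps)
      finally show "\<bar>Y e s\<bar>^3 \<le> 1 / (2 * w) * (Y e s)^4 + w / 2 * (Y e s)\<^sup>2"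
        by (simp add: y_def)
    qed
    also have "\<dots> = 1 / (2 * w) * E u (\<lambda>e s. (Y e s)^4) + w / 2 * E u (\<lambda>e s. (Y e s)\<^sup>2)"
      by (simp only: micro_mean_add micro_mean_cmult)
    also have "\<dots> \<le> 1 / (2 * w) * (22 * (real u)\<^sup>2 * ((c + 4)^4 + 26 * (1 + (c + 4)\<^sup>2))) + w / 2 * (3 * real u * (1 + (c + 4)\<^sup>2))"
    proof (intro add_mono mult_left_mono)
      have "exp 3 \<le> (22 :: real)"
      proof -
        have "exp (3 :: real) = (exp 1)^3" by (simp add: exp_of_nat_mult[symmetric])
        also have "\<dots> \<le> 2.8^3" using e_less_272 by (intro power_mono) auto
        finally show ?thesis by (simp add: power3_eq_cube)
      qed
      then have "exp 3 * ((real u)\<^sup>2 * (((c + 4)\<^sup>2)\<^sup>2 + 26 * (1 + (c + 4)\<^sup>2))) \<le> 22 * ((real u)\<^sup>2 * (((c + 4)\<^sup>2)\<^sup>2 + 26 * (1 + (c + 4)\<^sup>2)))"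
        by (intro mult_right_mono) auto
      then show "E u (\<lambda>e s. (Y e s)^4) \<le> 22 * (real u)\<^sup>2 * ((c + 4)^4 + 26 * (1 + (c + 4)\<^sup>2))"
        using fourth_moment[OF order_refl b] by (simp add: mult.assoc)
      show "E u (\<lambda>e s. (Y e s)\<^sup>2) \<le> 3 * real u * (1 + (c + 4)\<^sup>2)"
        using second_moment[OF order_refl] mult_left_mono[of "1 + real u * \<beta>\<^sup>2" "1 + (c + 4)\<^sup>2" "3 * real u"] b by linarith
    qed (use wpos in auto)
    also have "\<dots> = (11 * ((c + 4)^4 + 26 * (1 + (c + 4)\<^sup>2)) + 3/2 * (1 + (c + 4)\<^sup>2)) * w^3"
      unfolding w2[symmetric] using wpos by (simp add: eval_nat_numeral field_simps)
    also have "\<dots> \<le> K1 * w^3" unfolding K1_def using wpos by (intro mult_right_mono add_left_mono) auto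
    finally show ?thesis .
  qed
  have K1: "0 \<le> K1" unfolding K1_def by (intro add_nonneg_nonneg mult_nonneg_nonneg) auto
  define S where "S e s = f (real (M - s) / g ^ 3) - f x + f1 x / g ^ 3 * Y e s - f2 x / (2 * g ^ 6) * (Y e s)\<^sup>2" for e s
  have rem: "\<bar>S e s\<bar> \<le> 40 * C * (1 / x\<^sup>2 + 1) / g ^ 9 * \<bar>Y e s\<bar>^3" if "R e s" for e s
  proof -
    have y: "real (M - s) / g ^ 3 - x = - (Y e s / g ^ 3)"
      unfolding next_unhappy(1)[OF that] x_def by (simp add: diff_divide_distrib)
    have "\<bar>f (real (M - s) / g ^ 3) - f x - f1 x * (real (M - s) / g ^ 3 - x) - f2 x * (real (M - s) / g ^ 3 - x)\<^sup>2 / 2\<bar>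
       \<le> 40 * C * \<bar>real (M - s) / g ^ 3 - x\<bar>^3 * (1 / x\<^sup>2 + 1)"
      by (rule taylor2_remainder[OF C0 cont d1 d2 d3 b2 b3 x_pos]) (use gp in auto)
    moreover have "f (real (M - s) / g ^ 3) - f x - f1 x * (- (Y e s / g ^ 3)) - f2 x * (- (Y e s / g ^ 3))\<^sup>2 / 2 = S e s"
      by (simp add: S_def power_divide power_mult[symmetric])
    moreover have "40 * C * \<bar>- (Y e s / g ^ 3)\<bar>^3 * (1 / x\<^sup>2 + 1) = 40 * C * (1 / x\<^sup>2 + 1) / g ^ 9 * \<bar>Y e s\<bar>^3"
      using gp by (simp add: abs_divide power_divide power_mult[symmetric])
    ultimately show ?thesis unfolding y by simp
  qed
  have "\<bar>E u S\<bar> \<le> E u (\<lambda>e s. 40 * C * (1 / x\<^sup>2 + 1) / g ^ 9 * \<bar>Y e s\<bar>^3)"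
    by (rule micro_mean_abs[OF Hn order_refl rem])
  also have "\<dots> = 40 * C * (1 / x\<^sup>2 + 1) / g ^ 9 * E u (\<lambda>e s. \<bar>Y e s\<bar>^3)" by (rule micro_mean_cmult)
  also have "\<dots> \<le> 40 * C * (1 / x\<^sup>2 + 1) / g ^ 9 * (K1 * w^3)"
    using third C0 gp by (intro mult_left_mono) auto
  also have "\<dots> = 40 * C * K1 / g ^ 3 * (1 / w + w^3 / g ^ 6)"
    unfolding x_def w2[symmetric] using gp wpos by (simp add: eval_nat_numeral field_simps)
  also have "\<dots> \<le> 40 * C * K1 / g ^ 3 * T"
  proof (intro mult_left_mono)
    have "w^3 / g ^ 6 = real u / g ^ 4 * (w / g\<^sup>2)" unfolding w2[symmetric] by (simp add: eval_nat_numeral)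
    also have "\<dots> \<le> real u / g ^ 4 * 1" using wg gp by (intro mult_left_mono) auto
    finally show "1 / w + w^3 / g ^ 6 \<le> T" using T by simp
  qed (use C0 K1 gp in auto)
  finally have ES: "\<bar>E u S\<bar> \<le> 40 * C * K1 / g ^ 3 * T" .
  have "E u S = E u (\<lambda>e s. f (real (M - s) / g ^ 3) + ((- f x) + (f1 x / g ^ 3 * Y e s + (- (f2 x / (2 * g ^ 6))) * (Y e s)\<^sup>2)))"
    by (rule arg_cong[of _ _ "E u"]) (simp add: S_def fun_eq_iff)
  also have "\<dots> = next_round n M (\<lambda>v. f (real v / g ^ 3)) u + ((- f x) + (f1 x / g ^ 3 * E u Y + (- (f2 x / (2 * g ^ 6))) * E u (\<lambda>e s. (Y e s)\<^sup>2)))"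
    unfolding next_round_scaled by (simp only: micro_mean_add micro_mean_cmult micro_mean_const[OF n_pos])
  finally have main: "next_round n M (\<lambda>v. f (real v / g ^ 3)) u - f x = E u S - f1 x / g ^ 3 * E u Y + f2 x / (2 * g ^ 6) * E u (\<lambda>e s. (Y e s)\<^sup>2)"
    by simp
  (* The drift times f1 reproduces the first order part of the generator. *)
  define bx where "bx = 2 * \<alpha> * x - 7/4 * x\<^sup>2"
  have first: "\<bar>E u Y + bx\<bar> \<le> x * ((2 * c + 9) * T)"
  proof -
    have e: "real u * (real n - 2 * real H) / real n - (real u)\<^sup>2 / (4 * real n) = - \<rho> * x + 7/4 * x\<^sup>2"
      unfolding x_def \<rho>_def real_H sixth_root[symmetric] using gp by (simp add: eval_nat_numeral field_simps)
    have "\<bar>E u Y - (- \<rho> * x + 7/4 * x\<^sup>2)\<bar> \<le> real u / (4 * g ^ 6) + 2 * (real u)\<^sup>2 * \<beta> / g ^ 6"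
      using mean_precise unfolding e[symmetric] sixth_root by (simp add: algebra_simps)
    also have "\<dots> = x * (1 / (4 * g ^ 3) + 2 * (w * (w * \<beta>)) / g ^ 3)"
      unfolding x_def w2[symmetric] using gp by (simp add: eval_nat_numeral field_simps)
    also have "\<dots> \<le> x * ((2 * c + 9) * (1 / g))"
    proof (intro mult_left_mono)
      have g3: "1 / g ^ 3 \<le> 1 / g" using g1 by (intro divide_left_mono) (auto simp: eval_nat_numeral intro: order_trans[OF _ mult_left_mono[of 1]])
      have "w * (w * \<beta>) / g ^ 3 \<le> g\<^sup>2 * (c + 4) / g ^ 3" using wg wb' gp wpos by (intro divide_right_mono mult_mono) auto
      also have "\<dots> = (c + 4) * (1 / g)" using gp by (simp add: eval_nat_numeral)
      finally have "2 * (w * (w * \<beta>)) / g ^ 3 \<le> 2 * ((c + 4) * (1 / g))"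
        unfolding times_divide_eq_right[symmetric] by (intro mult_left_mono) auto
      moreover have "1 / (4 * g ^ 3) \<le> 1 / g" using g3 gp by (simp add: field_simps)
      ultimately show "1 / (4 * g ^ 3) + 2 * (w * (w * \<beta>)) / g ^ 3 \<le> (2 * c + 9) * (1 / g)"
        unfolding distrib_right by (simp add: algebra_simps)
    qed (use x_pos in simp)
    finally have 1: "\<bar>E u Y - (- \<rho> * x + 7/4 * x\<^sup>2)\<bar> \<le> x * ((2 * c + 9) * (1 / g))" .
    have "\<bar>E u Y + bx\<bar> \<le> \<bar>E u Y - (- \<rho> * x + 7/4 * x\<^sup>2)\<bar> + \<bar>(2 * \<alpha> - \<rho>) * x\<bar>"
      unfolding bx_def by (simp add: algebra_simps)
    also have "\<bar>(2 * \<alpha> - \<rho>) * x\<bar> = x * \<bar>\<rho> - 2 * \<alpha>\<bar>" using x_pos by (simp add: abs_mult abs_minus_commute mult.commute)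
    also have "x * \<bar>\<rho> - 2 * \<alpha>\<bar> \<le> x * ((2 * c + 9) * \<bar>\<rho> - 2 * \<alpha>\<bar>)"
      using x_pos c0 by (intro mult_left_mono) (auto simp: mult_le_cancel_right1)
    also have "\<bar>E u Y - (- \<rho> * x + 7/4 * x\<^sup>2)\<bar> + x * ((2 * c + 9) * \<bar>\<rho> - 2 * \<alpha>\<bar>) \<le> x * ((2 * c + 9) * (\<bar>\<rho> - 2 * \<alpha>\<bar> + 1 / g))"
      using 1 by (simp add: algebra_simps)
    also have "\<dots> \<le> x * ((2 * c + 9) * T)" using T(5) x_pos c0 by (intro mult_left_mono) auto
    finally show ?thesis by simp
  qed
  have t1: "\<bar>- f1 x / g ^ 3 * E u Y - bx * f1 x / g ^ 3\<bar> \<le> C * (2 * c + 9) / g ^ 3 * T"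
  proof -
    have "\<bar>- f1 x / g ^ 3 * E u Y - bx * f1 x / g ^ 3\<bar> = \<bar>f1 x\<bar> / g ^ 3 * \<bar>E u Y + bx\<bar>"
    proof -
      have "- f1 x / g ^ 3 * E u Y - bx * f1 x / g ^ 3 = - (f1 x / g ^ 3 * (E u Y + bx))"
        by (simp add: algebra_simps add_divide_distrib)
      then show ?thesis using gp by (simp add: abs_mult)
    qed
    also have "\<dots> \<le> (C / x) / g ^ 3 * (x * ((2 * c + 9) * T))"
      using b1[OF x_pos] first gp C0 x_pos by (intro mult_mono divide_right_mono) auto
    also have "\<dots> = C * (2 * c + 9) / g ^ 3 * T" using x_pos by simp
    finally show ?thesis .
  qed
  (* The variance of a round is close to u = x * g^3, which gives x / 2 * f2 after scaling. *)
  have t2: "\<bar>f2 x / (2 * g ^ 6) * E u (\<lambda>e s. (Y e s)\<^sup>2) - x / 2 * f2 x / g ^ 3\<bar> \<le> C * (4 * (c + 5) * (c + 4) + 1) / g ^ 3 * T"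
  proof -
    have "x / 2 * f2 x / g ^ 3 = f2 x / (2 * g ^ 6) * real u"
      using gp by (simp add: x_def eval_nat_numeral field_simps)
    then have "\<bar>f2 x / (2 * g ^ 6) * E u (\<lambda>e s. (Y e s)\<^sup>2) - x / 2 * f2 x / g ^ 3\<bar>
        = \<bar>f2 x / (2 * g ^ 6) * (E u (\<lambda>e s. (Y e s)\<^sup>2) - real u)\<bar>"
      by (simp only: right_diff_distrib)
    also have "\<dots> = \<bar>f2 x\<bar> / (2 * g ^ 6) * \<bar>E u (\<lambda>e s. (Y e s)\<^sup>2) - real u\<bar>" using gp by (simp add: abs_mult)
    also have "\<dots> \<le> (C / x) / (2 * g ^ 6) * (real u * (4 * \<beta> * (w * (1 + w * \<beta>)) + real u / real n))"
      using b2[OF x_pos] second_moment_precise[folded w_def] gp C0 x_pos by (intro mult_mono divide_right_mono) auto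
    also have "\<dots> = C / (2 * g ^ 3) * (4 * (w * \<beta>) * (1 + w * \<beta>) + real u / g ^ 6)"
      unfolding x_def sixth_root[symmetric] using gp u by (simp add: eval_nat_numeral field_simps)
    also have "\<dots> \<le> C / (2 * g ^ 3) * ((4 * (c + 5) * (c + 4) + 1) * T)"
    proof (intro mult_left_mono)
      have "w * \<beta> \<le> (c + 4) * T"
      proof -
        have "c / g + 4 * (real u / g ^ 4) \<le> c * T + 4 * T"
          using T(2) mult_left_mono[OF T(4) c0] by (intro add_mono) auto
        then show ?thesis using wb by (simp add: algebra_simps)
      qed
      then have "(w * \<beta>) * (1 + w * \<beta>) \<le> ((c + 4) * T) * (c + 5)"
        using wb' c0 T0 by (intro mult_mono[of "w * \<beta>" "(c + 4) * T" "1 + w * \<beta>" "c + 5"]) auto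
      moreover have "real u / g ^ 6 \<le> T"
      proof -
        have "real u / g ^ 6 \<le> real u / g ^ 4" using g1 by (intro divide_left_mono power_increasing) auto
        then show ?thesis using T(2) by simp
      qed
      ultimately show "4 * (w * \<beta>) * (1 + w * \<beta>) + real u / g ^ 6 \<le> (4 * (c + 5) * (c + 4) + 1) * T"
        by (simp add: algebra_simps)
    qed (use C0 gp in auto)
    also have "\<dots> \<le> C / g ^ 3 * ((4 * (c + 5) * (c + 4) + 1) * T)"
      using C0 gp c0 T0 by (intro mult_right_mono divide_left_mono) auto
    finally show ?thesis by (simp add: mult_ac)
  qed
  have "\<bar>next_round n M (\<lambda>v. f (real v / g ^ 3)) u - f x - generator_at \<alpha> f1 f2 / g ^ 3\<bar>
     \<le> \<bar>E u S\<bar> + \<bar>- f1 x / g ^ 3 * E u Y - bx * f1 x / g ^ 3\<bar> + \<bar>f2 x / (2 * g ^ 6) * E u (\<lambda>e s. (Y e s)\<^sup>2) - x / 2 * f2 x / g ^ 3\<bar>"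
  proof -
    have "generator_at \<alpha> f1 f2 / g ^ 3 = x / 2 * f2 x / g ^ 3 + bx * f1 x / g ^ 3"
      by (simp add: generator_at_def bx_def add_divide_distrib)
    moreover have "- f1 x / g ^ 3 * E u Y = - (f1 x / g ^ 3 * E u Y)" by simp
    ultimately show ?thesis using main by linarith
  qed
  also have "\<dots> \<le> 40 * C * K1 / g ^ 3 * T + C * (2 * c + 9) / g ^ 3 * T + C * (4 * (c + 5) * (c + 4) + 1) / g ^ 3 * T"
    using ES t1 t2 by linarith
  also have "\<dots> = (40 * C * K1 + C * (2 * c + 9) + C * (4 * (c + 5) * (c + 4) + 1)) / g ^ 3 * T"
    by (simp add: add_divide_distrib distrib_right)
  finally show ?thesis unfolding K1_def T_def .
qed

text \<open>
  Both the increment of \<open>f\<close> and \<open>L f / sqrt n\<close> are of order \<open>1 / sqrt n\<close> here, since \<open>f'\<close> decays like \<open>1 / x^2\<close> and a round changes \<open>u\<close>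
  by at most a multiple of \<open>sqrt u + u^2 / n\<close> on average. The rounds that end far below \<open>u\<close> are excluded by the variance of the number
  of empty vertices.
\<close>

lemma one_step_high_level:
  assumes ug: "g ^ 4 \<le> real u"
  shows "\<bar>next_round n M (\<lambda>v. f (real v / g ^ 3)) u - f x - generator_at \<alpha> f1 f2 / g ^ 3\<bar>
    \<le> (C * (512 * (c + 6)) + C * (3 + 2 * \<bar>\<alpha>\<bar>)) / g ^ 3 * (1 / w + real u / g ^ 4 + \<bar>\<rho> - 2 * \<alpha>\<bar> + 1 / g)"
proof -
  note gp = g_pos
  have wpos: "0 < w" using w1 by simp
  have wg: "g\<^sup>2 \<le> w"
  proof (rule power2_le_imp_le)
    show "(g\<^sup>2)\<^sup>2 \<le> w\<^sup>2" using ug unfolding w2 by simp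
  qed (use wpos in simp)
  (* If e is close to its mean, the next value is at least u / 16 and the derivative bound applies; otherwise f is merely
     bounded, and the second term is Chebyshev's inequality for the number of empty vertices. *)
  have pt: "\<bar>f (real (M - s) / g ^ 3) - f x\<bar> \<le> C * 256 / x\<^sup>2 / g ^ 3 * \<bar>Y e s\<bar> + 512 * C / (real u)\<^sup>2 * (real e - \<mu>)\<^sup>2" if r: "R e s" for e s
  proof (cases "\<bar>real e - \<mu>\<bar> \<le> real u / 16")
    case True
    have "real u / 16 \<le> real (M - s)"
      using next_unhappy(2)[OF r] empty_mean_lower[OF M_lo M_hi n32] True by linarith
    then have y: "x / 16 \<le> real (M - s) / g ^ 3" using gp by (simp add: x_def field_simps)
    have "\<bar>f (real (M - s) / g ^ 3) - f x\<bar> \<le> C / (x/16)\<^sup>2 * \<bar>real (M - s) / g ^ 3 - x\<bar>"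
      by (rule diff_bound_far[OF C0 d1 b1' _ _ y]) (use x_pos in auto)
    also have "real (M - s) / g ^ 3 - x = - (Y e s / g ^ 3)"
      unfolding next_unhappy(1)[OF r] x_def by (simp add: diff_divide_distrib)
    also have "C / (x/16)\<^sup>2 * \<bar>- (Y e s / g ^ 3)\<bar> = C * 256 / x\<^sup>2 / g ^ 3 * \<bar>Y e s\<bar>"
      using gp by (simp add: power_divide abs_divide)
    moreover have "0 \<le> 512 * C / (real u)\<^sup>2 * (real e - \<mu>)\<^sup>2" using C0 by simp
    ultimately show ?thesis by linarith
  next
    case False
    have "(real u / 16)\<^sup>2 \<le> \<bar>real e - \<mu>\<bar>\<^sup>2" using False by (intro power_mono) auto
    then have "1 \<le> 256 / (real u)\<^sup>2 * (real e - \<mu>)\<^sup>2" using u by (simp add: power_divide field_simps)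
    then have "2 * C * 1 \<le> 2 * C * (256 / (real u)\<^sup>2 * (real e - \<mu>)\<^sup>2)" using C0 by (intro mult_left_mono) auto
    moreover have "\<bar>f (real (M - s) / g ^ 3) - f x\<bar> \<le> 2 * C"
      using bd[of "real (M - s) / g ^ 3"] bd[of x] gp x_pos by auto
    moreover have "0 \<le> C * 256 / x\<^sup>2 / g ^ 3 * \<bar>Y e s\<bar>" using C0 gp by simp
    ultimately show ?thesis by simp
  qed
  have "next_round n M (\<lambda>v. f (real v / g ^ 3)) u - f x = E u (\<lambda>e s. f (real (M - s) / g ^ 3) - f x)"
    unfolding next_round_scaled micro_mean_diff by (simp only: micro_mean_const[OF n_pos])
  then have "\<bar>next_round n M (\<lambda>v. f (real v / g ^ 3)) u - f x\<bar> \<le> E u (\<lambda>e s. C * 256 / x\<^sup>2 / g ^ 3 * \<bar>Y e s\<bar> + 512 * C / (real u)\<^sup>2 * (real e - \<mu>)\<^sup>2)"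
    using micro_mean_abs[OF Hn order_refl pt] by simp
  also have "\<dots> = C * 256 / x\<^sup>2 / g ^ 3 * E u (\<lambda>e s. \<bar>Y e s\<bar>) + 512 * C / (real u)\<^sup>2 * E u (\<lambda>e s. (real e - \<mu>)\<^sup>2)"
    by (simp only: micro_mean_add micro_mean_cmult)
  also have "\<dots> \<le> C * 256 / x\<^sup>2 / g ^ 3 * (2 * (w * (1 + w * \<beta>))) + 512 * C / (real u)\<^sup>2 * real u"
    using first_moment_abs[OF order_refl, folded w_def] empty_variance C0 gp
    by (intro add_mono mult_left_mono) auto
  also have "\<dots> = 512 * C * (g ^ 3 / w ^ 3 + g ^ 3 * \<beta> / w\<^sup>2 + 1 / w\<^sup>2)"
    unfolding x_def w2[symmetric] using wpos gp by (simp add: eval_nat_numeral field_simps)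
  also have "\<dots> \<le> 512 * C * ((c + 6) / g ^ 3)"
  proof (intro mult_left_mono)
    have "(g\<^sup>2)^3 \<le> w^3" using wg gp by (intro power_mono) auto
    then have "g ^ 3 / w ^ 3 \<le> g ^ 3 / (g\<^sup>2)^3" using gp wpos by (intro divide_left_mono) auto
    also have "\<dots> = 1 / g ^ 3" using gp by (simp add: eval_nat_numeral)
    finally have 1: "g ^ 3 / w ^ 3 \<le> 1 / g ^ 3" .
    have g34: "g ^ 3 \<le> real u" using ug power_increasing[of 3 4 g] g1 by simp
    have "g ^ 3 * \<beta> / real u \<le> g ^ 3 * (c / g ^ 3 + 4 * real u / g ^ 6) / real u"
      using beta_le gp by (intro divide_right_mono mult_left_mono) auto
    also have "\<dots> = c / real u + 4 / g ^ 3" using gp u by (simp add: eval_nat_numeral field_simps)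
    also have "\<dots> \<le> c / g ^ 3 + 4 / g ^ 3" using g34 c0 gp u by (intro add_mono divide_left_mono) auto
    finally have 2: "g ^ 3 * \<beta> / w\<^sup>2 \<le> c / g ^ 3 + 4 / g ^ 3" unfolding w2 .
    have 3: "1 / w\<^sup>2 \<le> 1 / g ^ 3" unfolding w2 using g34 gp u by (intro divide_left_mono) auto
    show "g ^ 3 / w ^ 3 + g ^ 3 * \<beta> / w\<^sup>2 + 1 / w\<^sup>2 \<le> (c + 6) / g ^ 3"
      using 1 2 3 by (simp add: add_divide_distrib)
  qed (use C0 in simp)
  finally have A: "\<bar>next_round n M (\<lambda>v. f (real v / g ^ 3)) u - f x\<bar> \<le> C * (512 * (c + 6)) / g ^ 3"
    unfolding times_divide_eq_right by (simp only: mult_ac)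
  have "\<bar>generator_at \<alpha> f1 f2\<bar> \<le> C * (3 + 2 * \<bar>\<alpha>\<bar>)"
  proof -
    have a1: "x * \<bar>f1 x\<bar> \<le> C" "x * \<bar>f2 x\<bar> \<le> C" "x\<^sup>2 * \<bar>f1 x\<bar> \<le> C"
      using b1[OF x_pos] b2[OF x_pos] b1'[OF x_pos] x_pos by (auto simp: field_simps)
    have "\<bar>generator_at \<alpha> f1 f2\<bar> \<le> \<bar>x / 2 * f2 x\<bar> + (\<bar>2 * \<alpha> * x * f1 x\<bar> + \<bar>7/4 * x\<^sup>2 * f1 x\<bar>)"
      unfolding generator_at_def left_diff_distrib by linarith
    also have "\<dots> = 1/2 * (x * \<bar>f2 x\<bar>) + (2 * \<bar>\<alpha>\<bar> * (x * \<bar>f1 x\<bar>) + 7/4 * (x\<^sup>2 * \<bar>f1 x\<bar>))"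
      using x_pos by (simp add: abs_mult)
    also have "\<dots> \<le> 1/2 * C + (2 * \<bar>\<alpha>\<bar> * C + 7/4 * C)"
      using a1 by (intro add_mono mult_left_mono) auto
    also have "\<dots> \<le> C * (3 + 2 * \<bar>\<alpha>\<bar>)" using C0 by (simp add: algebra_simps)
    finally show ?thesis .
  qed
  then have B: "\<bar>generator_at \<alpha> f1 f2 / g ^ 3\<bar> \<le> C * (3 + 2 * \<bar>\<alpha>\<bar>) / g ^ 3" using gp by (simp add: abs_divide divide_right_mono)
  have "1 \<le> 1 / w + real u / g ^ 4 + \<bar>\<rho> - 2 * \<alpha>\<bar> + 1 / g"
  proof -
    have "1 \<le> real u / g ^ 4" using ug gp by simp
    moreover have "0 \<le> 1 / w" "0 \<le> 1 / g" using wpos gp by auto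
    ultimately show ?thesis by linarith
  qed
  then have "(C * (512 * (c + 6)) + C * (3 + 2 * \<bar>\<alpha>\<bar>)) / g ^ 3 * 1
     \<le> (C * (512 * (c + 6)) + C * (3 + 2 * \<bar>\<alpha>\<bar>)) / g ^ 3 * (1 / w + real u / g ^ 4 + \<bar>\<rho> - 2 * \<alpha>\<bar> + 1 / g)"
    using C0 c0 gp by (intro mult_left_mono) auto
  then show ?thesis using A B unfolding add_divide_distrib mult_1_right by linarith
qed

end

end

text \<open>
  The error per round is \<open>1 / sqrt n\<close> times a quantity that is small except for bounded \<open>u\<close> and for \<open>u\<close> of order at
  least \<open>g ^ 4\<close>; few rounds are spent at such levels.
\<close>

lemma one_step_generator:
  fixes \<alpha> c :: real
  assumes f: "generator_solution \<alpha> f G" and c0: "0 \<le> c"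
  shows "\<exists>K\<ge>0. \<forall>n M u g. scaled_round n M u g c \<longrightarrow>
    \<bar>next_round n M (\<lambda>v. f (real v / g ^ 3)) u - f (real u / g ^ 3) - G (real u / g ^ 3) / g ^ 3\<bar>
     \<le> K / g ^ 3 * (1 / sqrt (real u) + real u / g ^ 4 + \<bar>(2 * real M - real n) / g ^ 3 - 2 * \<alpha>\<bar> + 1 / g)"
proof -
  from f obtain f1 f2 f3 C where
    C0: "0 \<le> C" and cont: "continuous_on {0..} f"
    and bd: "\<And>x. 0 \<le> x \<Longrightarrow> \<bar>f x\<bar> \<le> C"
    and d1: "\<And>x. 0 < x \<Longrightarrow> (f has_real_derivative f1 x) (at x)"
    and d2: "\<And>x. 0 < x \<Longrightarrow> (f1 has_real_derivative f2 x) (at x)"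
    and d3: "\<And>x. 0 < x \<Longrightarrow> (f2 has_real_derivative f3 x) (at x)"
    and b1: "\<And>x. 0 < x \<Longrightarrow> \<bar>f1 x\<bar> \<le> C / x" and b1': "\<And>x. 0 < x \<Longrightarrow> \<bar>f1 x\<bar> \<le> C / x\<^sup>2"
    and b2: "\<And>x. 0 < x \<Longrightarrow> \<bar>f2 x\<bar> \<le> C / x" and b3: "\<And>x. 0 < x \<Longrightarrow> \<bar>f3 x\<bar> \<le> C * (1 / x\<^sup>2 + 1)"
    and eq: "\<And>x. 0 < x \<Longrightarrow> x / 2 * f2 x + (2 * \<alpha> * x - 7/4 * x\<^sup>2) * f1 x = G x"
    unfolding generator_solution_def by blast
  define K1 where "K1 = 40 * C * (11 * ((c + 4)^4 + 26 * (1 + (c + 4)\<^sup>2)) + 2 * (1 + (c + 4)\<^sup>2)) + C * (2 * c + 9) + C * (4 * (c + 5) * (c + 4) + 1)"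
  define K2 where "K2 = C * (512 * (c + 6)) + C * (3 + 2 * \<bar>\<alpha>\<bar>)"
  have K: "0 \<le> K1" "0 \<le> K2" unfolding K1_def K2_def using C0 c0
    by (intro add_nonneg_nonneg mult_nonneg_nonneg; simp)+
  show ?thesis
  proof (intro exI[of _ "K1 + K2"] conjI allI impI)
    fix n M u g assume "scaled_round n M u g c"
    then interpret scaled_round n M u g c .
    have LfG: "generator_at \<alpha> f1 f2 = G x" unfolding generator_at_def by (rule eq[OF x_pos])
    define T where "T = 1 / w + real u / g ^ 4 + \<bar>\<rho> - 2 * \<alpha>\<bar> + 1 / g"
    have T: "0 \<le> T" unfolding T_def using w1 g_pos by (intro add_nonneg_nonneg) auto
    define D where "D = \<bar>next_round n M (\<lambda>v. f (real v / g ^ 3)) u - f x - G x / g ^ 3\<bar>"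
    have le: "Ki / g ^ 3 * T \<le> (K1 + K2) / g ^ 3 * T" if "Ki \<le> K1 + K2" for Ki
      using that g_pos T by (intro mult_right_mono divide_right_mono) auto
    have "D \<le> (K1 + K2) / g ^ 3 * T"
    proof (cases "real u \<le> g ^ 4")
      case True
      have "D \<le> K1 / g ^ 3 * T" unfolding D_def K1_def T_def
        using one_step_low_level[OF C0 cont bd d1 d2 d3 b1 b1' b2 b3 True, of \<alpha>]
        unfolding LfG .
      then show ?thesis using le[of K1] K by simp
    next
      case False
      have "D \<le> K2 / g ^ 3 * T" unfolding D_def K2_def T_def
        using one_step_high_level[OF C0 cont bd d1 d2 d3 b1 b1' b2 b3, of \<alpha>] False
        unfolding LfG by simp
      then show ?thesis using le[of K2] K by simp
    qed
    then show "\<bar>next_round n M (\<lambda>v. f (real v / g ^ 3)) u - f (real u / g ^ 3) - G (real u / g ^ 3) / g ^ 3\<bar>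
     \<le> (K1 + K2) / g ^ 3 * (1 / sqrt (real u) + real u / g ^ 4 + \<bar>(2 * real M - real n) / g ^ 3 - 2 * \<alpha>\<bar> + 1 / g)"
      unfolding D_def T_def w_def x_def \<rho>_def .
  qed (use K in simp)
qed

section \<open>Lyapunov functions for the number of unhappy particles\<close>

lemma next_round_0: "next_round n M F 0 = F 0" by (simp add: next_round_def)

text \<open>
  In the locale, \<open>avg t F\<close> is the expectation of \<open>F\<close> at the number of unhappy particles after \<open>t\<close> rounds, all \<open>M\<close>
  particles being unhappy at time \<open>0\<close>.
\<close>

locale settling =
  fixes n M :: nat
  assumes M_pos: "0 < M" and M_le: "M \<le> n"
begin

definition avg :: "nat \<Rightarrow> (nat \<Rightarrow> real) \<Rightarrow> real" where
  "avg t F = (next_round n M ^^ t) F M"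

definition settled :: "nat \<Rightarrow> real" where
  "settled t = avg t (\<lambda>v. if v = 0 then 1 else 0)"

lemma n_pos: "0 < n" using M_pos M_le by simp

lemma next_round_mono:
  assumes "u \<le> M" "\<And>v. v \<le> M \<Longrightarrow> F v \<le> F' v"
  shows "next_round n M F u \<le> (next_round n M F' u :: real)"
  unfolding next_round_eq_micro_mean[OF assms(1)] by (rule micro_mean_mono[of _ _ u u]) (use assms M_le in auto)

lemma next_round_add: "u \<le> M \<Longrightarrow> next_round n M (\<lambda>v. F v + F' v) u = next_round n M F u + (next_round n M F' u :: real)"
  unfolding next_round_eq_micro_mean by (rule micro_mean_add)

lemma next_round_cmult: "u \<le> M \<Longrightarrow> next_round n M (\<lambda>v. a * F v) u = a * (next_round n M F u :: real)"
  unfolding next_round_eq_micro_mean by (rule micro_mean_cmult)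

lemma next_round_const: "u \<le> M \<Longrightarrow> next_round n M (\<lambda>_. a) u = (a :: real)"
  unfolding next_round_eq_micro_mean by (rule micro_mean_const[OF n_pos])

lemma avg_0: "avg 0 F = F M" by (simp add: avg_def)

lemma avg_Suc: "avg (Suc t) F = avg t (next_round n M F)"
  unfolding avg_def by (simp only: funpow_Suc_right o_def)

lemma avg_mono: "(\<And>v. v \<le> M \<Longrightarrow> F v \<le> F' v) \<Longrightarrow> avg t F \<le> avg t F'"
proof (induction t arbitrary: F F')
  case (Suc t)
  then show ?case unfolding avg_Suc by (intro Suc.IH next_round_mono) auto
qed (simp add: avg_0)

lemma avg_cong: "(\<And>v. v \<le> M \<Longrightarrow> F v = F' v) \<Longrightarrow> avg t F = avg t F'"
  by (intro antisym avg_mono) auto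

lemma avg_add: "avg t (\<lambda>v. F v + F' v) = avg t F + avg t F'"
proof (induction t arbitrary: F F')
  case (Suc t)
  have "avg t (next_round n M (\<lambda>v. F v + F' v)) = avg t (\<lambda>v. next_round n M F v + next_round n M F' v)"
    by (rule avg_cong) (rule next_round_add)
  then show ?case unfolding avg_Suc Suc .
qed (simp add: avg_0)

lemma avg_cmult: "avg t (\<lambda>v. a * F v) = a * avg t F"
proof (induction t arbitrary: F)
  case (Suc t)
  have "avg t (next_round n M (\<lambda>v. a * F v)) = avg t (\<lambda>v. a * next_round n M F v)"
    by (rule avg_cong) (rule next_round_cmult)
  then show ?case unfolding avg_Suc Suc .
qed (simp add: avg_0)

lemma avg_const: "avg t (\<lambda>_. a) = a"
proof (induction t)
  case (Suc t)
  have "avg t (next_round n M (\<lambda>v. a)) = avg t (\<lambda>v. a)" by (rule avg_cong) (rule next_round_const)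
  then show ?case unfolding avg_Suc Suc .
qed (simp add: avg_0)

lemma avg_diff: "avg t (\<lambda>v. F v - F' v) = avg t F - avg t F'"
  using avg_add[of t F "\<lambda>v. (-1) * F' v"] by (simp only: avg_cmult) simp

lemma avg_nonneg: "(\<And>v. v \<le> M \<Longrightarrow> 0 \<le> F v) \<Longrightarrow> 0 \<le> avg t F"
  using avg_mono[of "\<lambda>_. 0" F t] by (simp add: avg_const)

lemma avg_abs: "(\<And>v. v \<le> M \<Longrightarrow> \<bar>F v\<bar> \<le> F' v) \<Longrightarrow> \<bar>avg t F\<bar> \<le> avg t F'"
  using avg_mono[of F F' t] avg_mono[of "\<lambda>v. (-1) * F v" F' t] unfolding avg_cmult by (simp add: abs_le_iff)

lemma settled_0: "settled 0 = 0" using M_pos by (simp add: settled_def avg_0)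

lemma settled_le_1: "settled t \<le> 1"
  unfolding settled_def using avg_mono[of "\<lambda>v. if v = 0 then 1 else 0" "\<lambda>_. 1" t] by (simp add: avg_const)

lemma settled_mono: "settled t \<le> settled (Suc t)"
  unfolding settled_def avg_Suc
proof (rule avg_mono)
  fix v assume v: "v \<le> M"
  show "(if v = 0 then 1 else 0) \<le> next_round n M (\<lambda>v. if v = 0 then 1 else 0 :: real) v"
    using next_round_mono[OF v, of "\<lambda>_. 0" "\<lambda>v. if v = 0 then 1 else 0"] next_round_const[OF v, of 0]
    by (auto simp: next_round_0)
qed

text \<open>
  The expectation of \<open>V\<close> drops by that of \<open>q\<close> in each round before absorption and never becomes negative.
\<close>

lemma potential_bound:
  assumes V: "\<And>v. v \<le> M \<Longrightarrow> 0 \<le> V v"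
    and dr: "\<And>v. 1 \<le> v \<Longrightarrow> v \<le> M \<Longrightarrow> next_round n M V v \<le> V v - q v"
  shows "(\<Sum>t<N. avg t (\<lambda>v. if v = 0 then 0 else q v)) \<le> V M"
proof -
  have "avg (Suc t) V \<le> avg t V - avg t (\<lambda>v. if v = 0 then 0 else q v)" for t
    unfolding avg_Suc avg_diff[symmetric]
    by (rule avg_mono) (use dr in \<open>auto simp: next_round_0\<close>)
  then have "avg N V + (\<Sum>t<N. avg t (\<lambda>v. if v = 0 then 0 else q v)) \<le> V M"
  proof (induction N)
    case (Suc N)
    have "avg (Suc N) V \<le> avg N V - avg N (\<lambda>v. if v = 0 then 0 else q v)" by (rule Suc.prems)
    then show ?case using Suc.IH[OF Suc.prems] by simp
  qed (simp add: avg_0)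
  moreover have "0 \<le> avg N V" by (rule avg_nonneg) (rule V)
  ultimately show ?thesis by simp
qed

end

context scaled_round
begin

text \<open>
  The concavity of the logarithm reduces the claim to the mean. The term \<open>- u / n\<close> pays for the rounds at
  high levels, and the initial value is only of order \<open>ln n\<close>.
\<close>

lemma log_drift: "next_round n M (\<lambda>v. ln (1 + real v)) u \<le> ln (1 + real u) + (c / g ^ 3 - 1/2 * (real u / g ^ 6))"
proof -
  have "next_round n M (\<lambda>v. ln (1 + real v)) u = E u (\<lambda>e s. ln (1 + real (M - s)))" by (rule next_round_scaled)
  also have "\<dots> \<le> E u (\<lambda>e s. ln (1 + real u) + 1 / (1 + real u) * (- Y e s))"
  proof (rule micro_mean_mono[OF Hn order_refl])
    fix e s assume r: "R e s"
    have "ln ((1 + real (M - s)) / (1 + real u)) \<le> (1 + real (M - s)) / (1 + real u) - 1"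
      by (rule ln_le_minus_one) simp
    also have "\<dots> = 1 / (1 + real u) * (- Y e s)"
      unfolding next_unhappy(1)[OF r] by (simp add: field_simps)
    finally show "ln (1 + real (M - s)) \<le> ln (1 + real u) + 1 / (1 + real u) * (- Y e s)"
      by (simp add: ln_div)
  qed
  also have "\<dots> = ln (1 + real u) + 1 / (1 + real u) * E u (\<lambda>e s. - Y e s)"
    by (simp only: micro_mean_add micro_mean_cmult micro_mean_const[OF n_pos])
  also have "1 / (1 + real u) * E u (\<lambda>e s. - Y e s) \<le> 1 / (1 + real u) * (real u * (c / g ^ 3 - real u / g ^ 6))"
    using drift_upper by (intro mult_left_mono) auto
  also have "\<dots> \<le> c / g ^ 3 - 1/2 * (real u / g ^ 6)"
  proof -
    define z where "z = real u / (1 + real u)"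
    have z: "1/2 \<le> z" "z \<le> 1" using u by (auto simp: z_def field_simps)
    have "1 / (1 + real u) * (real u * (c / g ^ 3 - real u / g ^ 6)) = z * (c / g ^ 3) - z * (real u / g ^ 6)"
      by (simp add: z_def right_diff_distrib diff_divide_distrib)
    moreover have "z * (c / g ^ 3) \<le> 1 * (c / g ^ 3)" using z c0 g_pos by (intro mult_right_mono) auto
    moreover have "1/2 * (real u / g ^ 6) \<le> z * (real u / g ^ 6)" using z g_pos by (intro mult_right_mono) auto
    ultimately show ?thesis by linarith
  qed
  finally show ?thesis by simp
qed

lemma alive_drift: "next_round n M (\<lambda>v. if v = 0 then 0 else 1) u \<le> (1 - (1/4) ^ u :: real)"
proof -
  have "4 * M \<le> 3 * n" using M_hi by linarith
  note s = settle_probability[OF this]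
  have "next_round n M (\<lambda>v. if v = 0 then 0 else 1 :: real) u = E u (\<lambda>e s. 1 - (if M - s = 0 then 1 else 0))"
    unfolding next_round_scaled by (rule arg_cong[of _ _ "E u"]) (auto simp: fun_eq_iff)
  also have "\<dots> = 1 - next_round n M (\<lambda>v. if v = 0 then 1 else 0 :: real) u"
    unfolding next_round_scaled micro_mean_diff by (simp only: micro_mean_const[OF n_pos])
  finally show ?thesis using s by simp
qed

end

definition sixth_root :: "nat \<Rightarrow> real" where "sixth_root n = real n powr (1/6)"

lemma sixth_root_power: "0 < n \<Longrightarrow> sixth_root n ^ 6 = real n"
  by (simp add: sixth_root_def powr_realpow[symmetric] powr_powr)

lemma sixth_root_cube: "0 < n \<Longrightarrow> sixth_root n ^ 3 = sqrt (real n)"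
  by (simp add: sixth_root_def powr_realpow[symmetric] powr_powr powr_half_sqrt)

lemma sixth_root_lim: "filterlim sixth_root at_top sequentially"
  unfolding sixth_root_def by real_asymp

locale critical_sequence =
  fixes \<alpha> :: real and M :: "nat \<Rightarrow> nat"
  assumes critical: "(\<lambda>n. (2 * real (M n) - real n) / sqrt (real n)) \<longlonglongrightarrow> 2 * \<alpha>"
begin

definition c where "c = 2 * \<bar>\<alpha>\<bar> + 1"
definition \<delta> where "\<delta> n = \<bar>(2 * real (M n) - real n) / sixth_root n ^ 3 - 2 * \<alpha>\<bar> + 1 / sixth_root n"
definition error_rate where "error_rate n v = 1 / sqrt (real v) + real v / sixth_root n ^ 4 + \<delta> n"

lemma eventually_scaled: "\<forall>\<^sub>F n in sequentially. \<forall>u. 1 \<le> u \<longrightarrow> u \<le> M n \<longrightarrow> scaled_round n (M n) u (sixth_root n) c"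
  and eventually_settling: "\<forall>\<^sub>F n in sequentially. settling n (M n)"
proof -
  have 1: "\<forall>\<^sub>F n in sequentially. \<bar>(2 * real (M n) - real n) / sqrt (real n) - 2 * \<alpha>\<bar> < 1"
    using tendstoD[OF critical, of 1] by (simp add: dist_real_def)
  have 2: "\<forall>\<^sub>F n in sequentially. c * sqrt (real n) \<le> real n / 4"
    unfolding c_def by real_asymp
  have 3: "\<forall>\<^sub>F n in sequentially. (32 :: nat) \<le> n" by (rule eventually_ge_at_top)
  have both: "\<forall>\<^sub>F n in sequentially. (\<forall>u. 1 \<le> u \<longrightarrow> u \<le> M n \<longrightarrow> scaled_round n (M n) u (sixth_root n) c) \<and> settling n (M n)"
    using 1 2 3
  proof eventually_elim
    case (elim n)
    have n: "0 < real n" "0 < n" using elim by auto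
    have s: "0 < sqrt (real n)" using n by simp
    have "\<bar>(2 * real (M n) - real n) / sqrt (real n)\<bar> \<le> c" using elim(1) unfolding c_def by linarith
    then have d: "\<bar>2 * real (M n) - real n\<bar> \<le> c * sqrt (real n)"
      using s by (simp add: abs_divide pos_divide_le_eq)
    then have d': "\<bar>2 * real (M n) - real n\<bar> \<le> real n / 4" using elim by linarith
    have M: "3/8 * real n \<le> real (M n)" "real (M n) \<le> 5/8 * real n" using d' by linarith+
    have "1 \<le> sixth_root n" unfolding sixth_root_def using n by (intro ge_one_powr_ge_zero) auto
    then show ?case
      using d M n elim sixth_root_power[OF n(2)] sixth_root_cube[OF n(2)]
      by (auto simp: scaled_round_def one_round_def scaled_round_axioms_def settling_def c_def)
  qed
  then show "\<forall>\<^sub>F n in sequentially. \<forall>u. 1 \<le> u \<longrightarrow> u \<le> M n \<longrightarrow> scaled_round n (M n) u (sixth_root n) c"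
    "\<forall>\<^sub>F n in sequentially. settling n (M n)" by (auto elim: eventually_mono)
qed

lemma delta_lim: "\<delta> \<longlonglongrightarrow> 0"
proof -
  have "\<forall>\<^sub>F n in sequentially. (2 * real (M n) - real n) / sqrt (real n) = (2 * real (M n) - real n) / sixth_root n ^ 3"
    using eventually_gt_at_top[of 0] by eventually_elim (simp add: sixth_root_cube)
  from Lim_transform_eventually[OF critical this]
  have "(\<lambda>n. \<bar>(2 * real (M n) - real n) / sixth_root n ^ 3 - 2 * \<alpha>\<bar> + 1 / sixth_root n) \<longlonglongrightarrow> \<bar>2 * \<alpha> - 2 * \<alpha>\<bar> + 0"
    by (intro tendsto_intros real_tendsto_divide_at_top[OF tendsto_const sixth_root_lim])
  then show ?thesis by (simp add: \<delta>_def[abs_def])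
qed

lemma inv_g_lim: "(\<lambda>n. a / sixth_root n) \<longlonglongrightarrow> 0"
  by (rule real_tendsto_divide_at_top[OF tendsto_const sixth_root_lim])

lemma inv_g3_lim: "(\<lambda>n. a / sixth_root n ^ 3) \<longlonglongrightarrow> 0"
  unfolding sixth_root_def by real_asymp

lemma log_lim: "(\<lambda>n. a * ln (1 + real n) / sixth_root n) \<longlonglongrightarrow> 0"
  unfolding sixth_root_def by real_asymp

text \<open>
  The solution \<open>A\<close> of \<open>L A = - 1\<close> decreases by \<open>1 / sqrt n\<close> per round, up to the error of \<open>one_step_generator\<close>. The error at
  bounded levels \<open>u \<le> k\<close> is paid by the indicator of not being absorbed, which drops by at least \<open>4 ^ (- k)\<close> there, and
  the error at high levels by the logarithm.
\<close>

lemma lyapunov_time: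
  "\<exists>B>0. \<forall>\<^sub>F n in sequentially. \<exists>V. (\<forall>v. 0 \<le> V v) \<and> V (M n) \<le> B \<and>
     (\<forall>v. 1 \<le> v \<longrightarrow> v \<le> M n \<longrightarrow> next_round n (M n) V v \<le> V v - 1 / sixth_root n ^ 3)"
proof -
  obtain A where A: "generator_solution \<alpha> A (\<lambda>_. -1)" and A0: "\<And>x. 0 \<le> x \<Longrightarrow> 0 \<le> A x"
    using bounded_lyapunov_exists by blast
  from A obtain CA where CA: "0 \<le> CA" "\<And>x. 0 \<le> x \<Longrightarrow> \<bar>A x\<bar> \<le> CA" unfolding generator_solution_def by blast
  have c0: "0 \<le> c" by (simp add: c_def)
  obtain K where K: "0 \<le> K" and step: "\<And>n M u g. scaled_round n M u g c \<Longrightarrow>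
    \<bar>next_round n M (\<lambda>v. A (real v / g ^ 3)) u - A (real u / g ^ 3) - (-1) / g ^ 3\<bar>
     \<le> K / g ^ 3 * (1 / sqrt (real u) + real u / g ^ 4 + \<bar>(2 * real M - real n) / g ^ 3 - 2 * \<alpha>\<bar> + 1 / g)"
    using one_step_generator[OF A c0] by blast
  (* Above level k the term K / sqrt u is below 1/4. *)
  obtain k :: nat where k: "(4 * K + 1)\<^sup>2 \<le> real k" using real_arch_simple by blast
  have sk: "4 * K + 1 \<le> sqrt (real k)" using k by (rule real_le_rsqrt)
  have ev1: "\<forall>\<^sub>F n in sequentially. 2 * K * \<delta> n + 4 * K * c / sixth_root n < 1/2"
  proof (rule order_tendstoD(2))
    show "(\<lambda>n. 2 * K * \<delta> n + 4 * K * c / sixth_root n) \<longlonglongrightarrow> 2 * K * 0 + 0"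
      by (intro tendsto_intros delta_lim inv_g_lim)
  qed simp
  have ev2: "\<forall>\<^sub>F n in sequentially. 2 * K * 4 ^ k / sixth_root n ^ 3 + 4 * K * ln (1 + real n) / sixth_root n < 1"
  proof (rule order_tendstoD(2))
    show "(\<lambda>n. 2 * K * 4 ^ k / sixth_root n ^ 3 + 4 * K * ln (1 + real n) / sixth_root n) \<longlonglongrightarrow> 0 + 0"
      by (intro tendsto_intros inv_g3_lim log_lim)
  qed simp
  have "\<forall>\<^sub>F n in sequentially. \<exists>V. (\<forall>v. 0 \<le> V v) \<and> V (M n) \<le> 2 * CA + 1 \<and>
     (\<forall>v. 1 \<le> v \<longrightarrow> v \<le> M n \<longrightarrow> next_round n (M n) V v \<le> V v - 1 / sixth_root n ^ 3)"
    using eventually_scaled eventually_settling ev1 ev2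
  proof eventually_elim
    case (elim n)
    interpret settling n "M n" by (rule elim)
    define g where "g = sixth_root n"
    have gp: "0 < g" using n_pos by (simp add: g_def sixth_root_def)
    define V where "V v = 2 * A (real v / g ^ 3) + (2 * K * 4 ^ k / g ^ 3 * (if v = 0 then 0 else 1) + 4 * K / g * ln (1 + real v))" for v
    have "0 \<le> V v" for v unfolding V_def
      using A0[of "real v / g ^ 3"] K gp by (intro add_nonneg_nonneg mult_nonneg_nonneg) auto
    moreover have "V (M n) \<le> 2 * CA + 1"
    proof -
      have "A (real (M n) / g ^ 3) \<le> CA" using CA(2)[of "real (M n) / g ^ 3"] gp by auto
      moreover have "4 * K / g * ln (1 + real (M n)) \<le> 4 * K / g * ln (1 + real n)"
        using M_le K gp by (intro mult_left_mono) auto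
      ultimately show ?thesis using elim(4) M_pos unfolding V_def g_def[symmetric] by simp
    qed
    moreover have "next_round n (M n) V u \<le> V u - 1 / g ^ 3" if u: "1 \<le> u" "u \<le> M n" for u
    proof -
      interpret S: scaled_round n "M n" u g c using elim(1) u by (auto simp: g_def)
      have "next_round n (M n) V u = 2 * next_round n (M n) (\<lambda>v. A (real v / g ^ 3)) u
          + (2 * K * 4 ^ k / g ^ 3 * next_round n (M n) (\<lambda>v. if v = 0 then 0 else 1) u + 4 * K / g * next_round n (M n) (\<lambda>v. ln (1 + real v)) u)"
        unfolding V_def by (simp only: next_round_add[OF u(2)] next_round_cmult[OF u(2)])
      also have "\<dots> \<le> 2 * (A (real u / g ^ 3) - 1 / g ^ 3 + K / g ^ 3 * (1 / sqrt (real u) + real u / g ^ 4 + \<delta> n))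
          + (2 * K * 4 ^ k / g ^ 3 * (1 - (1/4) ^ u) + 4 * K / g * (ln (1 + real u) + (c / g ^ 3 - 1/2 * (real u / g ^ 6))))"
        using step[OF S.scaled_round_axioms] S.alive_drift S.log_drift K gp
        unfolding \<delta>_def g_def[symmetric]
        by (intro add_mono mult_left_mono) (auto simp: abs_le_iff algebra_simps)
      also have "\<dots> = V u - 2 / g ^ 3 + 1 / g ^ 3 * (2 * K / sqrt (real u) - 2 * K * (4 ^ k * (1/4) ^ u)) + 1 / g ^ 3 * (2 * K * \<delta> n + 4 * K * c / g)"
        unfolding V_def using u gp by (simp add: eval_nat_numeral field_simps)
      also have "\<dots> \<le> V u - 2 / g ^ 3 + 1 / g ^ 3 * (1/2) + 1 / g ^ 3 * (1/2)"
      proof (intro add_mono mult_left_mono order_refl)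
        show "2 * K / sqrt (real u) - 2 * K * (4 ^ k * (1/4) ^ u) \<le> 1/2"
        proof (cases "u \<le> k")
          case True
          have "(4::real) ^ u \<le> 4 ^ k" using True by (intro power_increasing) auto
          then have "1 \<le> (4::real) ^ k * (1/4) ^ u" by (simp add: power_divide field_simps)
          then have "2 * K * 1 \<le> 2 * K * (4 ^ k * (1/4) ^ u)" using K by (intro mult_left_mono) auto
          moreover have "2 * K / sqrt (real u) \<le> 2 * K / 1" using u K by (intro divide_left_mono) auto
          ultimately show ?thesis by simp
        next
          case False
          then have "sqrt (real k) \<le> sqrt (real u)" by simp
          then have "4 * K + 1 \<le> sqrt (real u)" using sk by linarith
          then have "2 * K / sqrt (real u) \<le> 1/2" using K u by (subst pos_divide_le_eq) auto
          moreover have "0 \<le> 2 * K * (4 ^ k * (1/4) ^ u)" using K by simp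
          ultimately show ?thesis by linarith
        qed
        show "2 * K * \<delta> n + 4 * K * c / g \<le> 1/2" using elim(3) by (simp add: g_def)
      qed (use gp in auto)
      also have "\<dots> = V u - 1 / g ^ 3" by simp
      finally show ?thesis .
    qed
    ultimately show ?case unfolding g_def by blast
  qed
  then show ?thesis using CA by (intro exI[of _ "2 * CA + 1"]) auto
qed

text \<open>
  With weight \<open>\<eta>\<close> the time function covers the levels where the error rate is below \<open>\<eta>\<close>. The indicator and the
  logarithm cover the others, and their initial values tend to \<open>0\<close>.
\<close>

lemma lyapunov_error:
  "\<exists>B>0. \<forall>\<eta>>0. \<forall>\<^sub>F n in sequentially. \<exists>V. (\<forall>v. 0 \<le> V v) \<and> V (M n) \<le> B * \<eta> \<and>
     (\<forall>v. 1 \<le> v \<longrightarrow> v \<le> M n \<longrightarrow> next_round n (M n) V v \<le> V v - 1 / sixth_root n ^ 3 * error_rate n v)"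
proof -
  obtain B1 where B1: "0 < B1" and ly: "\<forall>\<^sub>F n in sequentially. \<exists>V. (\<forall>v. 0 \<le> V v) \<and> V (M n) \<le> B1 \<and>
     (\<forall>v. 1 \<le> v \<longrightarrow> v \<le> M n \<longrightarrow> next_round n (M n) V v \<le> V v - 1 / sixth_root n ^ 3)"
    using lyapunov_time by blast
  have c0: "0 \<le> c" by (simp add: c_def)
  have "\<forall>\<^sub>F n in sequentially. \<exists>V. (\<forall>v. 0 \<le> V v) \<and> V (M n) \<le> (2 * B1 + 1) * \<eta> \<and>
     (\<forall>v. 1 \<le> v \<longrightarrow> v \<le> M n \<longrightarrow> next_round n (M n) V v \<le> V v - 1 / sixth_root n ^ 3 * error_rate n v)" if eta: "0 < \<eta>" for \<eta>
  proof -
    obtain k :: nat where k: "(1 / \<eta>)\<^sup>2 \<le> real k" using real_arch_simple by blast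
    have sk: "1 / \<eta> \<le> sqrt (real k)" using k by (rule real_le_rsqrt)
    have ev1: "\<forall>\<^sub>F n in sequentially. \<delta> n + 2 * c / sixth_root n < \<eta>"
    proof (rule order_tendstoD(2))
      show "(\<lambda>n. \<delta> n + 2 * c / sixth_root n) \<longlonglongrightarrow> 0 + 0" by (intro tendsto_intros delta_lim inv_g_lim)
    qed (use eta in simp)
    have ev2: "\<forall>\<^sub>F n in sequentially. 4 ^ k / sixth_root n ^ 3 + 2 * ln (1 + real n) / sixth_root n < \<eta>"
    proof (rule order_tendstoD(2))
      show "(\<lambda>n. 4 ^ k / sixth_root n ^ 3 + 2 * ln (1 + real n) / sixth_root n) \<longlonglongrightarrow> 0 + 0" by (intro tendsto_intros inv_g3_lim log_lim)
    qed (use eta in simp)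
    show ?thesis using eventually_scaled eventually_settling ev1 ev2 ly
    proof eventually_elim
      case (elim n)
      interpret settling n "M n" by (rule elim)
      define g where "g = sixth_root n"
      have gp: "0 < g" using n_pos by (simp add: g_def sixth_root_def)
      obtain V1 where V1: "\<And>v. 0 \<le> V1 v" "V1 (M n) \<le> B1"
        "\<And>v. 1 \<le> v \<Longrightarrow> v \<le> M n \<Longrightarrow> next_round n (M n) V1 v \<le> V1 v - 1 / g ^ 3" using elim(5) unfolding g_def by blast
      define V where "V v = 2 * \<eta> * V1 v + (4 ^ k / g ^ 3 * (if v = 0 then 0 else 1) + 2 / g * ln (1 + real v))" for v
      have "0 \<le> V v" for v unfolding V_def
        using V1(1)[of v] eta gp by (intro add_nonneg_nonneg mult_nonneg_nonneg) auto
      moreover have "V (M n) \<le> (2 * B1 + 1) * \<eta>"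
      proof -
        have "2 * \<eta> * V1 (M n) \<le> 2 * \<eta> * B1" using V1 eta by (intro mult_left_mono) auto
        moreover have "2 / g * ln (1 + real (M n)) \<le> 2 / g * ln (1 + real n)"
          using M_le gp by (intro mult_left_mono) auto
        ultimately show ?thesis using elim(4) M_pos unfolding V_def g_def[symmetric] by (simp add: algebra_simps)
      qed
      moreover have "next_round n (M n) V u \<le> V u - 1 / g ^ 3 * error_rate n u" if u: "1 \<le> u" "u \<le> M n" for u
      proof -
        interpret S: scaled_round n "M n" u g c using elim(1) u by (auto simp: g_def)
        have "next_round n (M n) V u = 2 * \<eta> * next_round n (M n) V1 u
          + (4 ^ k / g ^ 3 * next_round n (M n) (\<lambda>v. if v = 0 then 0 else 1) u + 2 / g * next_round n (M n) (\<lambda>v. ln (1 + real v)) u)"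
          unfolding V_def by (simp only: next_round_add[OF u(2)] next_round_cmult[OF u(2)])
        also have "\<dots> \<le> 2 * \<eta> * (V1 u - 1 / g ^ 3)
          + (4 ^ k / g ^ 3 * (1 - (1/4) ^ u) + 2 / g * (ln (1 + real u) + (c / g ^ 3 - 1/2 * (real u / g ^ 6))))"
          using V1(3)[OF u] S.alive_drift S.log_drift eta gp
          by (intro add_mono mult_left_mono) auto
        also have "\<dots> = V u - 1 / g ^ 3 * (4 ^ k * (1/4) ^ u + \<eta> + (real u / g ^ 4) + (\<eta> - 2 * c / g))"
          unfolding V_def using u gp by (simp add: eval_nat_numeral field_simps)
        also have "\<dots> \<le> V u - 1 / g ^ 3 * (1 / sqrt (real u) + real u / g ^ 4 + \<delta> n)"
        proof (intro diff_left_mono mult_left_mono)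
          have "1 / sqrt (real u) \<le> 4 ^ k * (1/4) ^ u + \<eta>"
          proof (cases "u \<le> k")
            case True
            have "(4::real) ^ u \<le> 4 ^ k" using True by (intro power_increasing) auto
            then have "1 \<le> (4::real) ^ k * (1/4) ^ u" by (simp add: power_divide field_simps)
            moreover have "1 / sqrt (real u) \<le> 1" using u by simp
            ultimately show ?thesis using eta by simp
          next
            case False
            then have "sqrt (real k) \<le> sqrt (real u)" by simp
            then have "1 / \<eta> \<le> sqrt (real u)" using sk by linarith
            then have "1 / sqrt (real u) \<le> \<eta>" using eta u by (simp add: field_simps)
            moreover have "0 \<le> (4::real) ^ k * (1/4) ^ u" by simp
            ultimately show ?thesis by linarith
          qed
          moreover have "\<delta> n \<le> \<eta> - 2 * c / g" using elim(3) by (simp add: g_def)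
          ultimately show "1 / sqrt (real u) + real u / g ^ 4 + \<delta> n \<le> 4 ^ k * (1/4) ^ u + \<eta> + (real u / g ^ 4) + (\<eta> - 2 * c / g)"
            by linarith
        qed (use gp in auto)
        finally show ?thesis by (simp add: error_rate_def g_def)
      qed
      ultimately show ?case unfolding g_def by blast
    qed
  qed
  then show ?thesis using B1 by (intro exI[of _ "2 * B1 + 1"]) auto
qed

end

section \<open>Characteristic functions of the rescaled absorption times\<close>

context settling
begin

definition increment :: "nat \<Rightarrow> real" where
  "increment t = (case t of 0 \<Rightarrow> 0 | Suc s \<Rightarrow> settled (Suc s) - settled s)"

definition time_pmf :: "nat pmf" where "time_pmf = embed_pmf increment"

definition law :: "real \<Rightarrow> real measure" where
  "law h = distr (measure_pmf time_pmf) borel (\<lambda>t. h * real t)"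

lemma increment_nonneg: "0 \<le> increment t"
  using settled_mono by (auto simp: increment_def split: nat.split)

lemma sum_increment: "(\<Sum>s\<le>t. increment s) = settled t"
  by (induction t) (auto simp: increment_def settled_0)

lemma settled_incseq: "s \<le> t \<Longrightarrow> settled s \<le> settled t"
  using settled_mono by (rule lift_Suc_mono_le)

context
  assumes lim: "settled \<longlonglongrightarrow> 1"
begin

lemma pmf_time: "pmf time_pmf t = increment t"
  unfolding time_pmf_def
proof (rule pmf_embed_pmf)
  have "increment sums 1"
    unfolding sums_def' using lim by (simp add: atLeast0AtMost sum_increment)
  then show "(\<integral>\<^sup>+ x. ennreal (increment x) \<partial>count_space UNIV) = 1"
    by (simp add: nn_integral_count_space_nat suminf_ennreal2 increment_nonneg sums_iff)
qed (rule increment_nonneg)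

lemma prob_time: "measure (measure_pmf time_pmf) {..t} = settled t"
  by (simp add: measure_measure_pmf_finite pmf_time sum_increment)

lemma real_distribution_law: "real_distribution (law h)"
  unfolding law_def by (rule prob_space.real_distribution_distr) (auto simp: measure_pmf.prob_space_axioms)

lemma cdf_law:
  assumes "0 < h"
  shows "cdf (law h) x = (if x < 0 then 0 else settled (nat \<lfloor>x / h\<rfloor>))"
proof -
  have "(\<lambda>t. h * real t) -` {..x} = (if x < 0 then {} else {..nat \<lfloor>x / h\<rfloor>})"
  proof (cases "x < 0")
    case True
    have "x < h * real t" for t using True assms by (meson less_le_trans mult_nonneg_nonneg less_imp_le of_nat_0_le_iff)
    then have "\<not> h * real t \<le> x" for t by (simp add: not_le)
    then show ?thesis using True by auto
  next
    case False
    have "h * real t \<le> x \<longleftrightarrow> t \<le> nat \<lfloor>x / h\<rfloor>" for t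
    proof -
      have "h * real t \<le> x \<longleftrightarrow> real t \<le> x / h" using assms by (simp add: field_simps)
      also have "\<dots> \<longleftrightarrow> t \<le> nat \<lfloor>x / h\<rfloor>" using False assms by (simp add: le_nat_iff le_floor_iff)
      finally show ?thesis .
    qed
    then show ?thesis using False by auto
  qed
  then show ?thesis
    unfolding cdf_def law_def by (subst measure_distr) (auto simp: prob_time)
qed

text \<open>
  Splitting at \<open>N\<close>: the part up to \<open>N\<close> is a finite sum, and the rest has mass \<open>1 - settled N\<close>.
\<close>

lemma char_law:
  "cmod (char (law h) \<theta> - (\<Sum>t<N. cis (\<theta> * h) ^ Suc t * of_real (settled (Suc t) - settled t))) \<le> 1 - settled N"
proof -
  let ?f = "\<lambda>t. iexp (\<theta> * (h * real t))"
  have "char (law h) \<theta> = (LINT t|measure_pmf time_pmf. ?f t)"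
    unfolding char_def law_def by (subst integral_distr) auto
  also have "\<dots> = (LINT t|measure_pmf time_pmf. indicator {..N} t *\<^sub>R ?f t + indicator {N<..} t *\<^sub>R ?f t)"
    by (intro Bochner_Integration.integral_cong) (auto simp: indicator_def)
  also have "\<dots> = (LINT t|measure_pmf time_pmf. indicator {..N} t *\<^sub>R ?f t) + (LINT t|measure_pmf time_pmf. indicator {N<..} t *\<^sub>R ?f t)"
    by (intro Bochner_Integration.integral_add measure_pmf.integrable_const_bound[where B = 1])
       (auto simp: indicator_def)
  also have "(LINT t|measure_pmf time_pmf. indicator {..N} t *\<^sub>R ?f t) = (\<Sum>t\<in>{..N}. pmf time_pmf t *\<^sub>R (indicator {..N} t *\<^sub>R ?f t))"
    by (rule integral_measure_pmf) (auto simp: indicator_def split: if_splits)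
  also have "\<dots> = (\<Sum>t\<le>N. of_real (increment t) * cis (\<theta> * h) ^ t)"
    by (intro sum.cong refl) (auto simp: pmf_time scaleR_conv_of_real cis_conv_exp exp_of_nat_mult[symmetric] mult_ac)
  also have "\<dots> = (\<Sum>t<N. cis (\<theta> * h) ^ Suc t * of_real (settled (Suc t) - settled t))"
    unfolding lessThan_Suc_atMost[symmetric] sum.lessThan_Suc_shift by (simp add: increment_def mult.commute)
  finally have "char (law h) \<theta> - (\<Sum>t<N. cis (\<theta> * h) ^ Suc t * of_real (settled (Suc t) - settled t))
     = (LINT t|measure_pmf time_pmf. indicator {N<..} t *\<^sub>R ?f t)" by simp
  also have "cmod \<dots> \<le> (LINT t|measure_pmf time_pmf. indicator {N<..} t)"
  proof -
    have "cmod (LINT t|measure_pmf time_pmf. indicator {N<..} t *\<^sub>R ?f t) \<le> (LINT t|measure_pmf time_pmf. cmod (indicator {N<..} t *\<^sub>R ?f t))"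
      by (rule integral_norm_bound)
    also have "\<dots> = (LINT t|measure_pmf time_pmf. indicator {N<..} t)"
      by (intro Bochner_Integration.integral_cong) (auto simp: indicator_def)
    finally show ?thesis .
  qed
  also have "\<dots> = measure (measure_pmf time_pmf) {N<..}" by simp
  also have "\<dots> = 1 - settled N"
    using measure_pmf.prob_compl[of "{..N}" time_pmf] by (simp add: prob_time Compl_atMost[symmetric] Compl_eq_Diff_UNIV)
  finally show ?thesis .
qed

end

lemma unsettled_bound:
  assumes V: "\<And>v. v \<le> M \<Longrightarrow> 0 \<le> V v"
    and dr: "\<And>v. 1 \<le> v \<Longrightarrow> v \<le> M \<Longrightarrow> next_round n M V v \<le> V v - h" and h: "0 < h"
  shows "real N * h * (1 - settled N) \<le> V M" and "settled \<longlonglongrightarrow> 1"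
proof -
  have e: "avg t (\<lambda>v. if v = 0 then 0 else h) = h * (1 - settled t)" for t
  proof -
    have "avg t (\<lambda>v. if v = 0 then 0 else h) = avg t (\<lambda>v. h * (1 - (if v = 0 then 1 else 0)))"
      by (rule avg_cong) auto
    then show ?thesis by (simp only: avg_cmult avg_diff avg_const settled_def)
  qed
  have main: "real N * h * (1 - settled N) \<le> V M" for N
  proof -
    have "real N * h * (1 - settled N) = (\<Sum>t<N. h * (1 - settled N))" by simp
    also have "\<dots> \<le> (\<Sum>t<N. h * (1 - settled t))"
      using h by (intro sum_mono mult_left_mono) (auto simp: settled_incseq)
    also have "\<dots> \<le> V M" using potential_bound[OF V dr, where N = N] unfolding e .
    finally show ?thesis .
  qed
  then show "real N * h * (1 - settled N) \<le> V M" .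
  have z: "(\<lambda>N. V M / h * (1 / real N)) \<longlonglongrightarrow> 0"
    using tendsto_mult[OF tendsto_const lim_1_over_n, of "V M / h"] by simp
  have "(\<lambda>N. 1 - settled N) \<longlonglongrightarrow> 0"
  proof (rule real_tendsto_sandwich[OF _ _ tendsto_const z])
    show "\<forall>\<^sub>F N in sequentially. 0 \<le> 1 - settled N" using settled_le_1 by simp
    show "\<forall>\<^sub>F N in sequentially. 1 - settled N \<le> V M / h * (1 / real N)"
      using eventually_gt_at_top[of 0]
    proof eventually_elim
      case (elim N)
      then show ?case using main[of N] h by (simp add: field_simps)
    qed
  qed
  from tendsto_diff[OF tendsto_const this, of 1] show "settled \<longlonglongrightarrow> 1" by simp
qed

text \<open>
  Optional stopping for \<open>cis (\<phi> * t) * \<Phi> (u_t)\<close> with \<open>\<Phi> = X + i Y\<close>. Let \<open>Z t\<close> be the expectation of \<open>\<Phi>\<close> on the event that the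
  chain is not yet absorbed. Then the absorbed mass times \<open>\<Phi> 0\<close> plus \<open>Z\<close>, both rotated, changes per round by the expectation of a
  function that vanishes at \<open>0\<close> and is bounded by \<open>q\<close> elsewhere.
\<close>

lemma telescoped_characteristic_sum:
  fixes X Y :: "nat \<Rightarrow> real" and \<phi> :: real
  defines "a \<equiv> cos \<phi>" and "b \<equiv> sin \<phi>"
  defines "FR \<equiv> \<lambda>v. a * next_round n M X v - b * next_round n M Y v - X v"
    and "FI \<equiv> \<lambda>v. b * next_round n M X v + a * next_round n M Y v - Y v"
  assumes V: "\<And>v. v \<le> M \<Longrightarrow> 0 \<le> V v"
    and dr: "\<And>v. 1 \<le> v \<Longrightarrow> v \<le> M \<Longrightarrow> next_round n M V v \<le> V v - q v"
    and F: "\<And>v. 1 \<le> v \<Longrightarrow> v \<le> M \<Longrightarrow> \<bar>FR v\<bar> \<le> q v" "\<And>v. 1 \<le> v \<Longrightarrow> v \<le> M \<Longrightarrow> \<bar>FI v\<bar> \<le> q v"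
    and C: "\<And>v. \<bar>X v\<bar> \<le> C" "\<And>v. \<bar>Y v\<bar> \<le> C"
  shows "cmod (Complex (X 0) (Y 0) * (\<Sum>t<N. cis \<phi> ^ Suc t * of_real (settled (Suc t) - settled t)) - Complex (X M) (Y M))
     \<le> 2 * V M + 2 * C * (1 - settled N)"
proof -
  define z where "z = (\<lambda>v::nat. if v = 0 then 1 else 0 :: real)"
  define Z where "Z t = Complex (avg t X - X 0 * settled t) (avg t Y - Y 0 * settled t)" for t
  define S where "S N = Complex (X 0) (Y 0) * (\<Sum>t<N. cis \<phi> ^ Suc t * of_real (settled (Suc t) - settled t))" for N
  (* The multiples of z make both components vanish at 0, where the chain is absorbed. *)
  define W where "W t = Complex (avg t (\<lambda>v. FR v - (X 0 * (a - 1) - Y 0 * b) * z v)) (avg t (\<lambda>v. FI v - (X 0 * b + Y 0 * (a - 1)) * z v))" for t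
  have zavg: "avg t z = settled t" for t by (simp add: settled_def z_def)
  have AFR: "avg t (\<lambda>v. FR v - k * z v) = a * avg (Suc t) X - b * avg (Suc t) Y - avg t X - k * settled t" for t k
    unfolding FR_def avg_Suc by (simp only: avg_diff avg_cmult zavg)
  have AFI: "avg t (\<lambda>v. FI v - k * z v) = b * avg (Suc t) X + a * avg (Suc t) Y - avg t Y - k * settled t" for t k
    unfolding FI_def avg_Suc by (simp only: avg_diff avg_add avg_cmult zavg)
  have step: "cis \<phi> * (Z (Suc t) + Complex (X 0) (Y 0) * of_real (settled (Suc t) - settled t)) = Z t + W t" for t
  proof (rule complex_eqI)
    show "Re (cis \<phi> * (Z (Suc t) + Complex (X 0) (Y 0) * of_real (settled (Suc t) - settled t))) = Re (Z t + W t)"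
      unfolding Z_def W_def AFR by (simp add: a_def b_def algebra_simps)
    show "Im (cis \<phi> * (Z (Suc t) + Complex (X 0) (Y 0) * of_real (settled (Suc t) - settled t))) = Im (Z t + W t)"
      unfolding Z_def W_def AFI by (simp add: a_def b_def algebra_simps)
  qed
  have tele: "S N + cis \<phi> ^ N * Z N = Z 0 + (\<Sum>t<N. cis \<phi> ^ t * W t)"
  proof (induction N)
    case 0 then show ?case by (simp add: S_def)
  next
    case (Suc N)
    have "S (Suc N) + cis \<phi> ^ Suc N * Z (Suc N)
      = S N + cis \<phi> ^ N * (cis \<phi> * (Z (Suc N) + Complex (X 0) (Y 0) * of_real (settled (Suc N) - settled N)))"
      by (simp add: S_def algebra_simps)
    also have "\<dots> = S N + cis \<phi> ^ N * Z N + cis \<phi> ^ N * W N" unfolding step by (simp add: algebra_simps)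
    finally show ?case using Suc by (simp add: algebra_simps)
  qed
  have q0: "\<bar>FR v - (X 0 * (a - 1) - Y 0 * b) * z v\<bar> \<le> (if v = 0 then 0 else q v)"
    "\<bar>FI v - (X 0 * b + Y 0 * (a - 1)) * z v\<bar> \<le> (if v = 0 then 0 else q v)" if "v \<le> M" for v
    using F[of v] that by (auto simp: z_def FR_def FI_def next_round_0 algebra_simps)
  have cm: "cmod (Complex x y) \<le> \<bar>x\<bar> + \<bar>y\<bar>" for x y using cmod_le[of "Complex x y"] by simp
  have Wb: "cmod (W t) \<le> 2 * avg t (\<lambda>v. if v = 0 then 0 else q v)" for t
  proof -
    have "cmod (W t) \<le> \<bar>avg t (\<lambda>v. FR v - (X 0 * (a - 1) - Y 0 * b) * z v)\<bar> + \<bar>avg t (\<lambda>v. FI v - (X 0 * b + Y 0 * (a - 1)) * z v)\<bar>"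
      unfolding W_def by (rule cm)
    moreover have "\<bar>avg t (\<lambda>v. FR v - (X 0 * (a - 1) - Y 0 * b) * z v)\<bar> \<le> avg t (\<lambda>v. if v = 0 then 0 else q v)"
      "\<bar>avg t (\<lambda>v. FI v - (X 0 * b + Y 0 * (a - 1)) * z v)\<bar> \<le> avg t (\<lambda>v. if v = 0 then 0 else q v)"
      by (rule avg_abs, rule q0, assumption)+
    ultimately show ?thesis by linarith
  qed
  have "cmod (\<Sum>t<N. cis \<phi> ^ t * W t) \<le> (\<Sum>t<N. cmod (cis \<phi> ^ t * W t))" by (rule norm_sum)
  also have "\<dots> \<le> (\<Sum>t<N. 2 * avg t (\<lambda>v. if v = 0 then 0 else q v))"
    using Wb by (intro sum_mono) (simp add: norm_mult norm_power)
  also have "\<dots> \<le> 2 * V M" using potential_bound[OF V dr, of N] by (simp add: sum_distrib_left[symmetric])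
  finally have A: "cmod (\<Sum>t<N. cis \<phi> ^ t * W t) \<le> 2 * V M" .
  have B: "cmod (Z N) \<le> 2 * C * (1 - settled N)"
  proof -
    have g: "\<bar>avg N G - G 0 * settled N\<bar> \<le> C * (1 - settled N)" if "\<And>v. \<bar>G v\<bar> \<le> C" for G
    proof -
      have "\<bar>avg N (\<lambda>v. G v - G 0 * z v)\<bar> \<le> avg N (\<lambda>v. C * (1 - z v))"
        by (rule avg_abs) (use that in \<open>auto simp: z_def\<close>)
      then show ?thesis by (simp only: avg_diff avg_cmult avg_const zavg)
    qed
    have "cmod (Z N) \<le> \<bar>avg N X - X 0 * settled N\<bar> + \<bar>avg N Y - Y 0 * settled N\<bar>" unfolding Z_def by (rule cm)
    then show ?thesis using g[of X, OF C(1)] g[of Y, OF C(2)] by linarith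
  qed
  have Z0: "Z 0 = Complex (X M) (Y M)" by (simp add: Z_def avg_0 settled_0)
  have "S N - Complex (X M) (Y M) = (\<Sum>t<N. cis \<phi> ^ t * W t) - cis \<phi> ^ N * Z N"
    using tele unfolding Z0 by (simp add: algebra_simps)
  also have "cmod \<dots> \<le> cmod (\<Sum>t<N. cis \<phi> ^ t * W t) + cmod (cis \<phi> ^ N * Z N)" by (rule norm_triangle_ineq4)
  also have "cmod (cis \<phi> ^ N * Z N) = cmod (Z N)" by (simp add: norm_mult norm_power)
  finally show ?thesis using A B unfolding S_def by linarith
qed

end

context critical_sequence
begin

definition h where "h n = real n powr (-1/2)"

lemma h_eq: "0 < n \<Longrightarrow> h n = 1 / sixth_root n ^ 3"
  by (simp add: h_def sixth_root_cube powr_minus_divide powr_half_sqrt)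

text \<open>
  If one round acts as \<open>1 - i \<theta> s\<close> up to \<open>e\<close>, then rotating back by the angle \<open>\<theta> s\<close> leaves an error of second order,
  since \<open>exp (i r) * (1 - i r) = 1 + O(r^2)\<close>.
\<close>

lemma rotation_error:
  fixes x y p q e a b s \<theta> :: real
  assumes "\<bar>p - x - s * (\<theta> * y)\<bar> \<le> e" "\<bar>q - y - s * (- \<theta> * x)\<bar> \<le> e" "\<bar>x\<bar> \<le> C" "\<bar>y\<bar> \<le> C"
  shows "\<bar>cos (\<theta> * s) * p - sin (\<theta> * s) * q - x\<bar> \<le> 2 * e + 2 * C * (\<theta> * s)\<^sup>2"
    and "\<bar>sin (\<theta> * s) * p + cos (\<theta> * s) * q - y\<bar> \<le> 2 * e + 2 * C * (\<theta> * s)\<^sup>2"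
proof -
  define r where "r = \<theta> * s"
  have C: "0 \<le> C" using assms(3) by linarith
  define z where "z = Complex x y"
  define d where "d = Complex (p - x - s * (\<theta> * y)) (q - y - s * (- \<theta> * x))"
  have cm: "cmod (Complex x y) \<le> \<bar>x\<bar> + \<bar>y\<bar>" for x y using cmod_le[of "Complex x y"] by simp
  have zb: "cmod z \<le> 2 * C" "cmod d \<le> 2 * e" unfolding z_def d_def
    using cm[of x y] cm[of "p - x - s * (\<theta> * y)" "q - y - s * (- \<theta> * x)"] assms by linarith+
  have "Complex p q = z - \<i> * of_real r * z + d"
    by (rule complex_eqI) (simp_all add: z_def d_def r_def algebra_simps)
  moreover have "cis r * iexp (- r) = 1" by (simp add: cis_conv_exp exp_minus)
  moreover have "E1 * (z - w * z + d) - (E1 * E2) * z = - E1 * ((E2 - (1 - w)) * z) + E1 * d" for E1 E2 w :: complex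
    by (simp add: algebra_simps)
  from this[of "cis r" "\<i> * of_real r" "iexp (- r)"]
  have "cis r * (z - \<i> * of_real r * z + d) - (cis r * iexp (- r)) * z = - cis r * ((iexp (- r) - (1 + \<i> * of_real (- r))) * z) + cis r * d"
    by simp
  ultimately have "cis r * Complex p q - z = - cis r * ((iexp (- r) - (1 + \<i> * of_real (- r))) * z) + cis r * d"
    by simp
  then have "cmod (cis r * Complex p q - z) \<le> cmod ((iexp (- r) - (1 + \<i> * of_real (- r))) * z) + cmod d"
    using norm_triangle_ineq[of "- cis r * ((iexp (- r) - (1 + \<i> * of_real (- r))) * z)" "cis r * d"]
    by (simp add: norm_mult)
  also have "\<dots> \<le> r\<^sup>2 / 2 * (2 * C) + 2 * e"
  proof -
    have "cmod (iexp (- r) - (\<Sum>k\<le>1. (\<i> * of_real (- r))^k / fact k)) \<le> \<bar>- r\<bar>^(Suc 1) / fact (Suc 1)"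
      by (rule iexp_approx1)
    then have "cmod (iexp (- r) - (1 + \<i> * of_real (- r))) \<le> r\<^sup>2 / 2" by (simp add: power2_eq_square)
    then show ?thesis unfolding norm_mult using zb by (intro add_mono mult_mono) auto
  qed
  also have "\<dots> \<le> 2 * e + 2 * C * r\<^sup>2" using C by (simp add: mult.commute)
  finally have "cmod (cis r * Complex p q - z) \<le> 2 * e + 2 * C * r\<^sup>2" .
  moreover have "Re (cis r * Complex p q - z) = cos r * p - sin r * q - x" "Im (cis r * Complex p q - z) = sin r * p + cos r * q - y"
    by (simp_all add: z_def)
  ultimately show "\<bar>cos (\<theta> * s) * p - sin (\<theta> * s) * q - x\<bar> \<le> 2 * e + 2 * C * (\<theta> * s)\<^sup>2"
    "\<bar>sin (\<theta> * s) * p + cos (\<theta> * s) * q - y\<bar> \<le> 2 * e + 2 * C * (\<theta> * s)\<^sup>2"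
    using abs_Re_le_cmod[of "cis r * Complex p q - z"] abs_Im_le_cmod[of "cis r * Complex p q - z"] unfolding r_def by linarith+
qed

lemma eventually_settled:
  "\<exists>B>0. \<forall>\<^sub>F n in sequentially. settling n (M n) \<and> settling.settled n (M n) \<longlonglongrightarrow> 1 \<and>
     (\<forall>N. real N * h n * (1 - settling.settled n (M n) N) \<le> B)"
proof -
  obtain B where B: "0 < B" and ly: "\<forall>\<^sub>F n in sequentially. \<exists>V. (\<forall>v. 0 \<le> V v) \<and> V (M n) \<le> B \<and>
     (\<forall>v. 1 \<le> v \<longrightarrow> v \<le> M n \<longrightarrow> next_round n (M n) V v \<le> V v - 1 / sixth_root n ^ 3)"
    using lyapunov_time by blast
  have "\<forall>\<^sub>F n in sequentially. settling n (M n) \<and> settling.settled n (M n) \<longlonglongrightarrow> 1 \<and>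
     (\<forall>N. real N * h n * (1 - settling.settled n (M n) N) \<le> B)"
    using ly eventually_settling
  proof eventually_elim
    case (elim n)
    interpret settling n "M n" by (rule elim)
    obtain V where V: "\<And>v. 0 \<le> V v" "V (M n) \<le> B" "\<And>v. 1 \<le> v \<Longrightarrow> v \<le> M n \<Longrightarrow> next_round n (M n) V v \<le> V v - h n"
      using elim(1) unfolding h_eq[OF n_pos] by blast
    have "0 < h n" using n_pos by (simp add: h_def)
    note u = unsettled_bound[OF V(1) V(3) this]
    show ?case using u V(2) settling_axioms by (auto intro: order_trans)
  qed
  then show ?thesis using B by blast
qed

text \<open>
  The total error is at most a constant times the initial value of the Lyapunov function of \<open>lyapunov_error\<close>,
  hence arbitrarily small, and the starting point \<open>M / sqrt n\<close> tends to infinity.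
\<close>

lemma char_limit:
  assumes X: "generator_solution \<alpha> X (\<lambda>x. \<theta> * Y x)" and Y: "generator_solution \<alpha> Y (\<lambda>x. - \<theta> * X x)"
    and limX: "(X \<longlongrightarrow> 1) at_top" and limY: "(Y \<longlongrightarrow> 0) at_top" and nz: "1 \<le> (X 0)\<^sup>2 + (Y 0)\<^sup>2"
  shows "(\<lambda>n. char (settling.law n (M n) (h n)) \<theta>) \<longlonglongrightarrow> 1 / Complex (X 0) (Y 0)"
proof -
  define z0 where "z0 = Complex (X 0) (Y 0)"
  have z0: "z0 \<noteq> 0" using nz by (auto simp: z0_def complex_eq_iff)
  have c0: "0 \<le> c" by (simp add: c_def)
  obtain K1 where K1: "0 \<le> K1" and step1: "\<And>n M u g. scaled_round n M u g c \<Longrightarrow>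
    \<bar>next_round n M (\<lambda>v. X (real v / g ^ 3)) u - X (real u / g ^ 3) - (\<theta> * Y (real u / g ^ 3)) / g ^ 3\<bar>
     \<le> K1 / g ^ 3 * (1 / sqrt (real u) + real u / g ^ 4 + \<bar>(2 * real M - real n) / g ^ 3 - 2 * \<alpha>\<bar> + 1 / g)"
    using one_step_generator[OF X c0] by blast
  obtain K2 where K2: "0 \<le> K2" and step2: "\<And>n M u g. scaled_round n M u g c \<Longrightarrow>
    \<bar>next_round n M (\<lambda>v. Y (real v / g ^ 3)) u - Y (real u / g ^ 3) - (- \<theta> * X (real u / g ^ 3)) / g ^ 3\<bar>
     \<le> K2 / g ^ 3 * (1 / sqrt (real u) + real u / g ^ 4 + \<bar>(2 * real M - real n) / g ^ 3 - 2 * \<alpha>\<bar> + 1 / g)"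
    using one_step_generator[OF Y c0] by blast
  obtain C1 C2 where C12: "\<And>x. 0 \<le> x \<Longrightarrow> \<bar>X x\<bar> \<le> C1" "\<And>x. 0 \<le> x \<Longrightarrow> \<bar>Y x\<bar> \<le> C2"
    using X Y unfolding generator_solution_def by blast
  define C where "C = max C1 C2"
  have C: "\<And>x. 0 \<le> x \<Longrightarrow> \<bar>X x\<bar> \<le> C" "\<And>x. 0 \<le> x \<Longrightarrow> \<bar>Y x\<bar> \<le> C" using C12 by (fastforce simp: C_def)+
  have C0: "0 \<le> C" using C(1)[of 0] by simp
  define Q where "Q = 2 * (K1 + K2) + 2 * C * \<theta>\<^sup>2 + 1"
  have Q: "0 < Q" unfolding Q_def using K1 K2 C0 by (intro add_nonneg_pos add_nonneg_nonneg) auto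
  obtain B where B: "0 < B" and ly: "\<And>\<eta>. 0 < \<eta> \<Longrightarrow> \<forall>\<^sub>F n in sequentially. \<exists>V. (\<forall>v. 0 \<le> V v) \<and> V (M n) \<le> B * \<eta> \<and>
     (\<forall>v. 1 \<le> v \<longrightarrow> v \<le> M n \<longrightarrow> next_round n (M n) V v \<le> V v - 1 / sixth_root n ^ 3 * error_rate n v)"
    using lyapunov_error by blast
  obtain B' where ev_set: "\<forall>\<^sub>F n in sequentially. settling n (M n) \<and> settling.settled n (M n) \<longlonglongrightarrow> 1 \<and>
     (\<forall>N. real N * h n * (1 - settling.settled n (M n) N) \<le> B')" using eventually_settled by blast
  have close: "\<forall>\<^sub>F n in sequentially. cmod (z0 * char (settling.law n (M n) (h n)) \<theta> - Complex (X (real (M n) / sixth_root n ^ 3)) (Y (real (M n) / sixth_root n ^ 3))) \<le> \<epsilon>"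
    if eps: "0 < \<epsilon>" for \<epsilon>
  proof -
    (* Chosen so that the final bound 2 * Q * (B * \<eta>) is \<epsilon>. *)
    define \<eta> where "\<eta> = \<epsilon> / (2 * Q * B)"
    have eta: "0 < \<eta>" using eps Q B by (simp add: \<eta>_def)
    show ?thesis using ly[OF eta] ev_set eventually_scaled
    proof eventually_elim
      case (elim n)
      interpret settling n "M n" using elim by blast
      have lim: "settled \<longlonglongrightarrow> 1" using elim by blast
      define g where "g = sixth_root n"
      have gp: "0 < g" using n_pos by (simp add: g_def sixth_root_def)
      have hg: "h n = 1 / g ^ 3" using h_eq[OF n_pos] by (simp add: g_def)
      obtain V where V: "\<And>v. 0 \<le> V v" "V (M n) \<le> B * \<eta>"
        "\<And>v. 1 \<le> v \<Longrightarrow> v \<le> M n \<Longrightarrow> next_round n (M n) V v \<le> V v - h n * error_rate n v" using elim(1) unfolding hg g_def by blast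
      define X' where "X' v = X (real v / g ^ 3)" for v :: nat
      define Y' where "Y' v = Y (real v / g ^ 3)" for v :: nat
      define V' where "V' v = Q * V v" for v
      have X0: "X' 0 = X 0" "Y' 0 = Y 0" by (auto simp: X'_def Y'_def)
      have Fb: "\<bar>cos (\<theta> * h n) * next_round n (M n) X' v - sin (\<theta> * h n) * next_round n (M n) Y' v - X' v\<bar> \<le> Q * (h n * error_rate n v)"
        "\<bar>sin (\<theta> * h n) * next_round n (M n) X' v + cos (\<theta> * h n) * next_round n (M n) Y' v - Y' v\<bar> \<le> Q * (h n * error_rate n v)"
        if v: "1 \<le> v" "v \<le> M n" for v
      proof -
        interpret S: scaled_round n "M n" v g c using elim(3) v by (auto simp: g_def)
        define e where "e = (K1 + K2) * (h n * error_rate n v)"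
        have err0: "0 \<le> 1 / sqrt (real v) + real v / g ^ 4 + \<bar>(2 * real (M n) - real n) / g ^ 3 - 2 * \<alpha>\<bar> + 1 / g"
          using gp by (intro add_nonneg_nonneg) auto
        have err_g: "error_rate n v = 1 / sqrt (real v) + real v / g ^ 4 + \<bar>(2 * real (M n) - real n) / g ^ 3 - 2 * \<alpha>\<bar> + 1 / g"
          by (simp add: error_rate_def \<delta>_def g_def)
        have le: "Ki / g ^ 3 * error_rate n v \<le> e" if "Ki \<le> K1 + K2" for Ki
          unfolding e_def hg err_g using mult_right_mono[OF that, of "1 / g ^ 3 * error_rate n v"] err0 gp unfolding err_g by simp
        have e1: "\<bar>next_round n (M n) X' v - X' v - h n * (\<theta> * Y' v)\<bar> \<le> e"
          using step1[OF S.scaled_round_axioms] le[of K1] K2 unfolding X'_def Y'_def hg err_g by simp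
        have e2: "\<bar>next_round n (M n) Y' v - Y' v - h n * (- \<theta> * X' v)\<bar> \<le> e"
          using step2[OF S.scaled_round_axioms] le[of K2] K1 unfolding X'_def Y'_def hg err_g by simp
        have "\<bar>X' v\<bar> \<le> C" "\<bar>Y' v\<bar> \<le> C" using C gp by (auto simp: X'_def Y'_def)
        note r = rotation_error[OF e1 e2 this]
        have "2 * C * (\<theta> * h n)\<^sup>2 \<le> 2 * C * \<theta>\<^sup>2 * (h n * error_rate n v)"
        proof -
          have "h n \<le> 1 / g" unfolding hg using gp S.g1 power_increasing[of 1 3 g] by (intro divide_left_mono) auto
          also have "1 / g \<le> error_rate n v" unfolding err_g using gp by simp
          finally have "h n * h n \<le> h n * error_rate n v" using gp by (intro mult_left_mono) (auto simp: hg)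
          from mult_left_mono[OF this, of "2 * C * \<theta>\<^sup>2"] C0
          have "2 * C * \<theta>\<^sup>2 * (h n * h n) \<le> 2 * C * \<theta>\<^sup>2 * (h n * error_rate n v)" by simp
          then show ?thesis by (simp add: power_mult_distrib power2_eq_square mult_ac)
        qed
        moreover have "0 \<le> h n * error_rate n v" unfolding err_g using err0 gp by (simp add: hg)
        ultimately have "2 * e + 2 * C * (\<theta> * h n)\<^sup>2 \<le> Q * (h n * error_rate n v)"
        proof -
          assume a: "2 * C * (\<theta> * h n)\<^sup>2 \<le> 2 * C * \<theta>\<^sup>2 * (h n * error_rate n v)" "0 \<le> h n * error_rate n v"
          have "Q * r = 2 * ((K1 + K2) * r) + 2 * C * \<theta>\<^sup>2 * r + r" for r
            by (simp add: Q_def algebra_simps)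
          from this[of "h n * error_rate n v"] show ?thesis using a unfolding e_def by linarith
        qed
        then show "\<bar>cos (\<theta> * h n) * next_round n (M n) X' v - sin (\<theta> * h n) * next_round n (M n) Y' v - X' v\<bar> \<le> Q * (h n * error_rate n v)"
          "\<bar>sin (\<theta> * h n) * next_round n (M n) X' v + cos (\<theta> * h n) * next_round n (M n) Y' v - Y' v\<bar> \<le> Q * (h n * error_rate n v)"
          using r by linarith+
      qed
      have dr': "next_round n (M n) V' v \<le> V' v - Q * (h n * error_rate n v)" if "1 \<le> v" "v \<le> M n" for v
        unfolding V'_def next_round_cmult[OF that(2)] using mult_left_mono[OF V(3)[OF that], of Q] Q
        by (simp add: right_diff_distrib)
      have V'0: "0 \<le> V' v" for v using V(1)[of v] Q by (simp add: V'_def)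
      have bnd: "cmod (z0 * (\<Sum>t<N. cis (\<theta> * h n) ^ Suc t * of_real (settled (Suc t) - settled t)) - Complex (X' (M n)) (Y' (M n)))
          \<le> 2 * V' (M n) + 2 * C * (1 - settled N)" for N
        unfolding z0_def X0[symmetric]
        by (rule telescoped_characteristic_sum[OF V'0 dr' Fb]) (use C gp in \<open>auto simp: X'_def Y'_def\<close>)
      have bnd2: "cmod (z0 * char (law (h n)) \<theta> - Complex (X' (M n)) (Y' (M n))) \<le> 2 * V' (M n) + (2 * C + cmod z0) * (1 - settled N)" for N
      proof -
        have split: "cmod (z0 * u - w) \<le> cmod z0 * cmod (u - p) + cmod (z0 * p - w)" for u w p
          using norm_triangle_ineq[of "z0 * (u - p)" "z0 * p - w"] by (simp add: norm_mult[symmetric] right_diff_distrib)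
        have gen: "cmod (z0 * u - w) \<le> V2 + (2 * C + cmod z0) * r"
          if "cmod (u - p) \<le> r" "cmod (z0 * p - w) \<le> V2 + 2 * C * r" for u w p V2 r
          using split[of u w p] mult_left_mono[OF that(1), of "cmod z0"] that(2) by (simp add: distrib_right)
        show ?thesis by (rule gen[OF char_law[OF lim] bnd])
      qed
      have "(\<lambda>N. 2 * V' (M n) + (2 * C + cmod z0) * (1 - settled N)) \<longlonglongrightarrow> 2 * V' (M n) + (2 * C + cmod z0) * (1 - 1)"
        by (intro tendsto_intros lim)
      then have "cmod (z0 * char (law (h n)) \<theta> - Complex (X' (M n)) (Y' (M n))) \<le> 2 * V' (M n) + (2 * C + cmod z0) * (1 - 1)"
        by (rule tendsto_lowerbound) (use bnd2 in auto)
      also have "\<dots> \<le> 2 * Q * (B * \<eta>)" using V(2) Q by (simp add: V'_def)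
      also have "\<dots> = \<epsilon>" using Q B by (simp add: \<eta>_def)
      finally show ?case by (simp add: X'_def Y'_def g_def)
    qed
  qed
  have Mlim: "filterlim (\<lambda>n. real (M n) / sixth_root n ^ 3) at_top sequentially"
  proof (rule filterlim_at_top_mono)
    show "filterlim (\<lambda>n. 3/8 * sixth_root n ^ 3) at_top sequentially" unfolding sixth_root_def by real_asymp
    show "\<forall>\<^sub>F n in sequentially. 3/8 * sixth_root n ^ 3 \<le> real (M n) / sixth_root n ^ 3"
      using eventually_scaled eventually_settling
    proof eventually_elim
      case (elim n)
      interpret settling n "M n" by (rule elim)
      interpret S: scaled_round n "M n" 1 "sixth_root n" c using elim M_pos by auto
      show ?case using S.M_lo S.g_pos unfolding S.sixth_root[symmetric] by (simp add: field_simps eval_nat_numeral)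
    qed
  qed
  have XYlim: "(\<lambda>n. Complex (X (real (M n) / sixth_root n ^ 3)) (Y (real (M n) / sixth_root n ^ 3))) \<longlonglongrightarrow> Complex 1 0"
    by (intro tendsto_Complex filterlim_compose[OF limX Mlim] filterlim_compose[OF limY Mlim])
  have "(\<lambda>n. z0 * char (settling.law n (M n) (h n)) \<theta> - Complex (X (real (M n) / sixth_root n ^ 3)) (Y (real (M n) / sixth_root n ^ 3))) \<longlonglongrightarrow> 0"
  proof (rule tendstoI)
    fix e :: real assume "0 < e"
    then show "\<forall>\<^sub>F n in sequentially. dist (z0 * char (settling.law n (M n) (h n)) \<theta> - Complex (X (real (M n) / sixth_root n ^ 3)) (Y (real (M n) / sixth_root n ^ 3))) 0 < e"
      using close[of "e / 2"] by (auto elim!: eventually_mono simp: dist_norm)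
  qed
  from tendsto_add[OF this XYlim] have "(\<lambda>n. z0 * char (settling.law n (M n) (h n)) \<theta>) \<longlonglongrightarrow> Complex 1 0" by simp
  from tendsto_divide[OF this tendsto_const z0] z0 show ?thesis by (simp add: z0_def[symmetric] one_complex.code[symmetric])
qed

end

section \<open>From particles to vertex occupancies\<close>

definition singles :: "nat \<Rightarrow> 'i set \<Rightarrow> ('i \<Rightarrow> nat) \<Rightarrow> nat set" where
  "singles n B p = {v \<in> {1..n}. \<exists>!i. i \<in> B \<and> p i = v}"

definition empties :: "nat \<Rightarrow> 'i set \<Rightarrow> ('i \<Rightarrow> nat) \<Rightarrow> nat set" where
  "empties n B p = {v \<in> {1..n}. \<forall>i\<in>B. p i \<noteq> v}"

lemma finite_singles [simp]: "finite (singles n B p)" and finite_empties [simp]: "finite (empties n B p)"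
  by (auto simp: singles_def empties_def)

lemma card_singles:
  assumes "finite B" "p ` B \<subseteq> {1..n}"
  shows "card (singles n B p) = card {i \<in> B. \<forall>j\<in>B. j \<noteq> i \<longrightarrow> p i \<noteq> p j}"
proof -
  let ?H = "{i \<in> B. \<forall>j\<in>B. j \<noteq> i \<longrightarrow> p i \<noteq> p j}"
  have "singles n B p = p ` ?H"
  proof
    show "singles n B p \<subseteq> p ` ?H"
    proof
      fix v assume "v \<in> singles n B p"
      then have uq: "\<exists>!i. i \<in> B \<and> p i = v" by (simp add: singles_def)
      define i where "i = (THE i. i \<in> B \<and> p i = v)"
      have i: "i \<in> B" "p i = v" using theI'[OF uq] by (simp_all add: i_def)
      have uniq: "j = i" if "j \<in> B" "p j = v" for j
        unfolding i_def by (rule the1_equality[OF uq, symmetric]) (use that in simp)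
      have "p i \<noteq> p j" if "j \<in> B" "j \<noteq> i" for j
        using uniq[OF that(1)] that(2) i(2) by metis
      then have "i \<in> ?H" using i(1) by simp
      then have "p i \<in> p ` ?H" by (rule imageI)
      then show "v \<in> p ` ?H" using i by (simp only:)
    qed
    show "p ` ?H \<subseteq> singles n B p"
    proof
      fix v assume "v \<in> p ` ?H"
      then obtain i where i: "i \<in> B" "\<And>j. j \<in> B \<Longrightarrow> j \<noteq> i \<Longrightarrow> p i \<noteq> p j" "v = p i" by blast
      then have "\<exists>!i. i \<in> B \<and> p i = v" by (intro ex1I[of _ i]) force+
      then show "v \<in> singles n B p" unfolding singles_def using assms i by auto
    qed
  qed
  moreover have "inj_on p ?H" unfolding inj_on_def by auto
  ultimately show ?thesis by (simp add: card_image)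
qed

lemma insert_particle:
  assumes B: "finite B" and j: "j \<notin> B" and y: "y \<in> {1..n}"
  shows "empties n (insert j B) (p(j := y)) = empties n B p - {y}"
    and "singles n (insert j B) (p(j := y)) =
      (if y \<in> empties n B p then insert y (singles n B p) else singles n B p - {y})"
proof -
  have [simp]: "i \<in> B \<Longrightarrow> i \<noteq> j" for i using j by auto
  show "empties n (insert j B) (p(j := y)) = empties n B p - {y}"
    unfolding empties_def using j by auto
  have uq: "(\<exists>!i. i \<in> insert j B \<and> (p(j := y)) i = v) \<longleftrightarrow> (if v = y then \<forall>i\<in>B. p i \<noteq> y else \<exists>!i. i \<in> B \<and> p i = v)" for v
  proof (cases "v = y")
    case True
    show ?thesis
    proof
      assume "\<exists>!i. i \<in> insert j B \<and> (p(j := y)) i = v"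
      then have u: "\<And>a b. a \<in> insert j B \<Longrightarrow> (p(j := y)) a = v \<Longrightarrow> b \<in> insert j B \<Longrightarrow> (p(j := y)) b = v \<Longrightarrow> a = b" by blast
      have "p i \<noteq> y" if "i \<in> B" for i using u[of i j] that True j by auto
      then show "if v = y then \<forall>i\<in>B. p i \<noteq> y else \<exists>!i. i \<in> B \<and> p i = v" using True by simp
    next
      assume "if v = y then \<forall>i\<in>B. p i \<noteq> y else \<exists>!i. i \<in> B \<and> p i = v"
      then show "\<exists>!i. i \<in> insert j B \<and> (p(j := y)) i = v" using True by (intro ex1I[of _ j]) auto
    qed
  next
    case False
    have "i \<in> insert j B \<and> (p(j := y)) i = v \<longleftrightarrow> i \<in> B \<and> p i = v" for i
      using False j by auto
    then show ?thesis using False by simp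
  qed
  show "singles n (insert j B) (p(j := y)) =
      (if y \<in> empties n B p then insert y (singles n B p) else singles n B p - {y})"
    unfolding singles_def empties_def uq using y by auto
qed

text \<open>
  The uniform vertex is empty, singly occupied, or neither; only its kind changes the two counts.
\<close>

lemma average_over_vertex:
  fixes \<Psi> :: "nat \<Rightarrow> nat \<Rightarrow> real"
  assumes B: "finite B" and j: "j \<notin> B" and n: "0 < n"
  shows "(\<Sum>y\<in>{1..n}. \<Psi> (card (empties n (insert j B) (p(j := y)))) (card (singles n (insert j B) (p(j := y))))) / real n
     = jump n \<Psi> (card (empties n B p)) (card (singles n B p))"
proof -
  let ?E = "empties n B p" and ?S = "singles n B p"
  let ?f = "\<lambda>y. \<Psi> (card (empties n (insert j B) (p(j := y)))) (card (singles n (insert j B) (p(j := y))))"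
  have sub: "?E \<subseteq> {1..n}" "?S \<subseteq> {1..n}" and dis: "?E \<inter> ?S = {}" by (auto simp: empties_def singles_def)
  have "{1..n} = ?E \<union> ?S \<union> ({1..n} - ?E - ?S)" using sub by auto
  then have "(\<Sum>y\<in>{1..n}. ?f y) = (\<Sum>y\<in>?E \<union> ?S \<union> ({1..n} - ?E - ?S). ?f y)" by simp
  also have "\<dots> = (\<Sum>y\<in>?E \<union> ?S. ?f y) + (\<Sum>y\<in>{1..n} - ?E - ?S. ?f y)" by (rule sum.union_disjoint) auto
  also have "(\<Sum>y\<in>?E \<union> ?S. ?f y) = (\<Sum>y\<in>?E. ?f y) + (\<Sum>y\<in>?S. ?f y)" by (rule sum.union_disjoint) (use dis in auto)
  also have "(\<Sum>y\<in>?E. ?f y) = (\<Sum>y\<in>?E. \<Psi> (card ?E - 1) (card ?S + 1))"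
  proof (rule sum.cong[OF refl])
    fix y assume y: "y \<in> ?E"
    then have "y \<in> {1..n}" "y \<notin> ?S" using sub dis by auto
    then show "?f y = \<Psi> (card ?E - 1) (card ?S + 1)"
      unfolding insert_particle[OF B j \<open>y \<in> {1..n}\<close>] using y by (simp add: card_Diff_singleton)
  qed
  also have "(\<Sum>y\<in>?S. ?f y) = (\<Sum>y\<in>?S. \<Psi> (card ?E) (card ?S - 1))"
  proof (rule sum.cong[OF refl])
    fix y assume y: "y \<in> ?S"
    then have "y \<in> {1..n}" "y \<notin> ?E" using sub dis by auto
    then show "?f y = \<Psi> (card ?E) (card ?S - 1)"
      unfolding insert_particle[OF B j \<open>y \<in> {1..n}\<close>] using y by (simp add: card_Diff_singleton)
  qed
  also have "(\<Sum>y\<in>{1..n} - ?E - ?S. ?f y) = (\<Sum>y\<in>{1..n} - ?E - ?S. \<Psi> (card ?E) (card ?S))"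
  proof (rule sum.cong[OF refl])
    fix y assume y: "y \<in> {1..n} - ?E - ?S"
    then have "y \<in> {1..n}" "y \<notin> ?E" "y \<notin> ?S" by auto
    then show "?f y = \<Psi> (card ?E) (card ?S)"
      unfolding insert_particle[OF B j \<open>y \<in> {1..n}\<close>] by simp
  qed
  finally have s: "(\<Sum>y\<in>{1..n}. ?f y) = real (card ?E) * \<Psi> (card ?E - 1) (card ?S + 1) + real (card ?S) * \<Psi> (card ?E) (card ?S - 1)
     + real (card ({1..n} - ?E - ?S)) * \<Psi> (card ?E) (card ?S)" by (simp only: sum_constant)
  have "card ({1..n} - ?E - ?S) = card {1..n} - card (?E \<union> ?S)"
  proof -
    have "{1..n} - ?E - ?S = {1..n} - (?E \<union> ?S)" by auto
    then show ?thesis using sub by (simp only:) (intro card_Diff_subset, auto)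
  qed
  moreover have "card (?E \<union> ?S) = card ?E + card ?S" using dis by (intro card_Un_disjoint) auto
  moreover have "card (?E \<union> ?S) \<le> card {1..n}" using sub by (intro card_mono) auto
  ultimately have "real (card ({1..n} - ?E - ?S)) = real n - real (card ?E) - real (card ?S)" by simp
  then show ?thesis unfolding s jump_def by (simp add: add_divide_distrib)
qed

abbreviation uniform_choices_pmf :: "nat \<Rightarrow> 'i set \<Rightarrow> ('i \<Rightarrow> nat) pmf" where
  "uniform_choices_pmf n A \<equiv> Pi_pmf A 0 (\<lambda>_. pmf_of_set {1..n})"

lemma finite_set_uniform: "finite A \<Longrightarrow> 0 < n \<Longrightarrow> finite (set_pmf (uniform_choices_pmf n A))"
  by (rule finite_subset[OF set_Pi_pmf_subset']) (auto intro!: finite_PiE_dflt)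

lemma expectation_bind_finite:
  fixes h :: "'b \<Rightarrow> real"
  assumes "finite (set_pmf p)" "\<And>x. x \<in> set_pmf p \<Longrightarrow> finite (set_pmf (f x))"
  shows "measure_pmf.expectation (bind_pmf p f) h = measure_pmf.expectation p (\<lambda>x. measure_pmf.expectation (f x) h)"
  using assms by (subst pmf_expectation_bind[of "set_pmf p"]) (auto simp: integral_measure_pmf[of "set_pmf p"])

lemma expectation_bind_bind_return:
  fixes h :: "'c \<Rightarrow> real"
  assumes p: "finite (set_pmf p)" and q: "finite (set_pmf q)"
  shows "measure_pmf.expectation (bind_pmf p (\<lambda>y. bind_pmf q (\<lambda>f. return_pmf (u y f)))) h
     = measure_pmf.expectation p (\<lambda>y. measure_pmf.expectation q (\<lambda>f. h (u y f)))"
proof -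
  have e: "bind_pmf q (\<lambda>f. return_pmf (u y f)) = map_pmf (u y) q" for y by (simp add: map_pmf_def)
  show ?thesis unfolding e
    by (subst expectation_bind_finite[OF p]) (use q in auto)
qed

text \<open>
  The jumps of one round may be revealed one at a time, because the final occupancy does not depend on their order.
\<close>

lemma layer_expectation:
  fixes \<Phi> :: "nat \<Rightarrow> nat \<Rightarrow> real"
  assumes "finite J" "finite B" "B \<inter> J = {}" "0 < n"
  shows "measure_pmf.expectation (uniform_choices_pmf n J)
      (\<lambda>x. \<Phi> (card (empties n (B \<union> J) (\<lambda>i. if i \<in> J then x i else p i))) (card (singles n (B \<union> J) (\<lambda>i. if i \<in> J then x i else p i))))
     = (jump n ^^ card J) \<Phi> (card (empties n B p)) (card (singles n B p))"
  using assms
proof (induction J arbitrary: B p rule: finite_induct)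
  case empty
  then show ?case by simp
next
  case (insert j J)
  have jB: "j \<notin> B" and BJ: "insert j B \<inter> J = {}" using insert by auto
  have fJ: "finite (set_pmf (uniform_choices_pmf n J))" using insert by (intro finite_set_uniform) auto
  let ?h = "\<lambda>x. \<Phi> (card (empties n (B \<union> insert j J) (\<lambda>i. if i \<in> insert j J then x i else p i)))
     (card (singles n (B \<union> insert j J) (\<lambda>i. if i \<in> insert j J then x i else p i)))"
  have fn: "finite (set_pmf (pmf_of_set {1..n}))" using insert.prems by (subst set_pmf_of_set) auto
  have "measure_pmf.expectation (uniform_choices_pmf n (insert j J)) ?h
     = measure_pmf.expectation (pmf_of_set {1..n}) (\<lambda>y. measure_pmf.expectation (uniform_choices_pmf n J) (\<lambda>f. ?h (f(j := y))))"
    unfolding Pi_pmf_insert'[OF insert.hyps(1,2)]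
    by (rule expectation_bind_bind_return[OF fn fJ])
  also have "\<dots> = measure_pmf.expectation (pmf_of_set {1..n}) (\<lambda>y. (jump n ^^ card J) \<Phi> (card (empties n (insert j B) (p(j := y)))) (card (singles n (insert j B) (p(j := y)))))"
  proof (rule Bochner_Integration.integral_cong[OF refl])
    fix y
    have e: "(\<lambda>i. if i \<in> insert j J then (f(j := y)) i else p i) = (\<lambda>i. if i \<in> J then f i else (p(j := y)) i)" for f
      using insert.hyps by (auto simp: fun_eq_iff)
    have u: "B \<union> insert j J = insert j B \<union> J" by auto
    show "measure_pmf.expectation (uniform_choices_pmf n J) (\<lambda>f. ?h (f(j := y)))
      = (jump n ^^ card J) \<Phi> (card (empties n (insert j B) (p(j := y)))) (card (singles n (insert j B) (p(j := y))))"
      unfolding e u by (rule insert.IH) (use insert.prems BJ in auto)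
  qed
  also have "\<dots> = (\<Sum>y\<in>{1..n}. (jump n ^^ card J) \<Phi> (card (empties n (insert j B) (p(j := y)))) (card (singles n (insert j B) (p(j := y))))) / real n"
    using insert.prems by (subst integral_pmf_of_set) (auto simp only: finite_atLeastAtMost card_atLeastAtMost, auto)
  also have "\<dots> = jump n ((jump n ^^ card J) \<Phi>) (card (empties n B p)) (card (singles n B p))"
    using insert.prems by (intro average_over_vertex[OF _ jB]) auto
  finally show ?case unfolding card_insert_disjoint[OF insert.hyps(1,2)] funpow.simps o_def .
qed


lemma position_cong:
  assumes "\<And>i s. i \<in> {1..M} \<Longrightarrow> s \<in> {1..t} \<Longrightarrow> g i s = g' i s"
  shows "i \<in> {1..M} \<Longrightarrow> position M g t i = position M g' t i" and "happy M g t = happy M g' t"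
proof -
  have "(\<forall>i\<in>{1..M}. position M g t i = position M g' t i) \<and> happy M g t = happy M g' t"
    using assms
  proof (induction t)
    case (Suc t)
    then have IH: "\<forall>i\<in>{1..M}. position M g t i = position M g' t i" "happy M g t = happy M g' t" by auto
    have "\<forall>i\<in>{1..M}. position M g (Suc t) i = position M g' (Suc t) i"
      using IH Suc.prems by auto
    then show ?case by (auto simp del: position.simps)
  qed auto
  then show "i \<in> {1..M} \<Longrightarrow> position M g t i = position M g' t i" "happy M g t = happy M g' t" by auto
qed

lemma position_range:
  assumes "0 < n" "\<And>i s. i \<in> {1..M} \<Longrightarrow> s \<in> {1..t} \<Longrightarrow> g i s \<in> {1..n}" "i \<in> {1..M}"
  shows "position M g t i \<in> {1..n}"
  using assms
proof (induction t)
  case (Suc t)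
  have "position M g t i \<in> {1..n}" using Suc.prems by (intro Suc.IH) auto
  moreover have "g i (Suc t) \<in> {1..n}" using Suc.prems by auto
  ultimately show ?case by auto
qed auto

lemma happy_subset: "happy M g t \<subseteq> {1..M}" by (cases t) auto

lemma happy_distinct: "i \<in> happy M g t \<Longrightarrow> j \<in> happy M g t \<Longrightarrow> i \<noteq> j \<Longrightarrow> position M g t i \<noteq> position M g t j"
  by (cases t) (auto simp del: position.simps)

lemma one_step_law:
  fixes F :: "nat \<Rightarrow> real"
  assumes n: "0 < n" and g: "\<And>i s. i \<in> {1..M} \<Longrightarrow> s \<in> {1..t} \<Longrightarrow> g i s \<in> {1..n}"
  shows "measure_pmf.expectation (uniform_choices_pmf n {1..M})
     (\<lambda>x. F (card (unhappy M (\<lambda>i s. if s = Suc t then x i else g i s) (Suc t)))) = next_round n M F (card (unhappy M g t))"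
proof -
  define A where "A = happy M g t"
  define J where "J = unhappy M g t"
  define p where "p = position M g t"
  have AJ: "A \<subseteq> {1..M}" "J \<subseteq> {1..M}" "A \<inter> J = {}" "A \<union> J = {1..M}" "finite A" "finite J"
    using happy_subset[of M g t] finite_subset[OF happy_subset[of M g t]] by (auto simp: A_def J_def unhappy_def)
  have cA: "card A = M - card J"
    using card_Un_disjoint[OF AJ(5,6,3)] unfolding AJ(4) by simp
  have pr: "p i \<in> {1..n}" if "i \<in> {1..M}" for i
    unfolding p_def by (rule position_range[OF n g that])
  have inj: "inj_on p A" unfolding inj_on_def p_def A_def using happy_distinct by metis
  define x' where "x' x = (\<lambda>i. if i \<in> J then x i else p i)" for x :: "nat \<Rightarrow> nat"
  have unh: "card (unhappy M (\<lambda>i s. if s = Suc t then x i else g i s) (Suc t)) = M - card (singles n (A \<union> J) (x' x))"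
    if x: "\<And>i. i \<in> {1..M} \<Longrightarrow> x i \<in> {1..n}" for x
  proof -
    let ?g = "\<lambda>i s. if s = Suc t then x i else g i s"
    have h: "happy M ?g t = A" unfolding A_def by (rule position_cong(2)) auto
    have "position M ?g t i = p i" if "i \<in> {1..M}" for i unfolding p_def by (rule position_cong(1)[OF _ that]) auto
    then have pos: "position M ?g (Suc t) i = x' x i" if "i \<in> {1..M}" for i
      using that h AJ by (auto simp: x'_def)
    have "happy M ?g (Suc t) = {i \<in> {1..M}. \<forall>j\<in>{1..M}. j \<noteq> i \<longrightarrow> x' x i \<noteq> x' x j}"
      using pos by (auto simp del: position.simps)
    then have "card (happy M ?g (Suc t)) = card (singles n (A \<union> J) (x' x))"
      unfolding AJ(4) by (subst card_singles) (use pr x AJ in \<open>auto simp: x'_def\<close>)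
    then show ?thesis
      unfolding unhappy_def using happy_subset[of M ?g "Suc t"] by (subst card_Diff_subset) (auto intro: finite_subset)
  qed
  have "measure_pmf.expectation (uniform_choices_pmf n {1..M}) (\<lambda>x. F (card (unhappy M (\<lambda>i s. if s = Suc t then x i else g i s) (Suc t))))
     = measure_pmf.expectation (uniform_choices_pmf n {1..M}) (\<lambda>x. F (M - card (singles n (A \<union> J) (x' x))))"
  proof (rule integral_cong_AE)
    show "AE x in measure_pmf (uniform_choices_pmf n {1..M}).
       F (card (unhappy M (\<lambda>i s. if s = Suc t then x i else g i s) (Suc t))) = F (M - card (singles n (A \<union> J) (x' x)))"
    proof (rule AE_pmfI)
      fix x assume "x \<in> set_pmf (uniform_choices_pmf n {1..M})"
      then have "\<And>i. i \<in> {1..M} \<Longrightarrow> x i \<in> {1..n}"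
        using n by (subst (asm) set_Pi_pmf) (auto simp: PiE_dflt_def set_pmf_of_set)
      then show "F (card (unhappy M (\<lambda>i s. if s = Suc t then x i else g i s) (Suc t))) = F (M - card (singles n (A \<union> J) (x' x)))"
        by (simp only: unh)
    qed
  qed auto
  also have "\<dots> = measure_pmf.expectation (uniform_choices_pmf n J) (\<lambda>x. F (M - card (singles n (A \<union> J) (x' x))))"
  proof -
    have "x' (\<lambda>i. if i \<in> J then f i else 0) = x' f" for f by (auto simp: x'_def fun_eq_iff)
    then show ?thesis
      unfolding Pi_pmf_subset[OF finite_atLeastAtMost AJ(2)] integral_map_pmf by (simp only:)
  qed
  also have "\<dots> = (jump n ^^ card J) (\<lambda>e s. F (M - s)) (card (empties n A p)) (card (singles n A p))"
    unfolding x'_def by (rule layer_expectation[OF AJ(6,5,3) n, where \<Phi> = "\<lambda>e s. F (M - s)"])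
  also have "card (singles n A p) = card A"
  proof -
    have "{i \<in> A. \<forall>j\<in>A. j \<noteq> i \<longrightarrow> p i \<noteq> p j} = A" using inj by (auto dest: inj_onD)
    moreover have "p ` A \<subseteq> {1..n}" using pr AJ(1) by auto
    ultimately show ?thesis using card_singles[OF AJ(5), of p n] by simp
  qed
  also have "card (empties n A p) = n - card A"
  proof -
    have "empties n A p = {1..n} - p ` A" by (auto simp: empties_def)
    moreover have "p ` A \<subseteq> {1..n}" using pr AJ(1) by auto
    ultimately show ?thesis using card_image[OF inj] AJ(5) by (simp add: card_Diff_subset)
  qed
  finally show ?thesis unfolding next_round_def J_def[symmetric] cA .
qed

lemma unhappy_cong:
  assumes "\<And>i s. i \<in> {1..M} \<Longrightarrow> s \<in> {1..t} \<Longrightarrow> g i s = g' i s"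
  shows "unhappy M g t = unhappy M g' t"
  using position_cong(2)[of M t g g', OF assms] by (simp add: unhappy_def)

text \<open>
  The choices of the next round are independent of the past, so one more round applies the transition operator.
\<close>

lemma (in settling) law_of_unhappy:
  "measure_pmf.expectation (uniform_choices_pmf n ({1..M} \<times> {1..t})) (\<lambda>c. F (card (unhappy M (curry c) t))) = avg t F"
proof (induction t arbitrary: F)
  case 0
  then show ?case by (simp add: unhappy_def avg_0)
next
  case (Suc t)
  let ?I = "{1..M} \<times> {1..t}" and ?L = "{1..M} \<times> {Suc t}"
  let ?G = "\<lambda>f x i s. if s = Suc t then x i else curry f i s"
  have I: "{1..M} \<times> {1..Suc t} = ?I \<union> ?L" by auto
  have fin: "finite ?I" "finite ?L" "?I \<inter> ?L = {}" by auto
  (* Pairs outside the new layer must be sent outside the particle set; 0 is not a particle. *)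
  define k where "k = (\<lambda>(i, s). if s = Suc t then i else (0 :: nat))"
  have L: "uniform_choices_pmf n ?L = map_pmf (\<lambda>x. x \<circ> k) (uniform_choices_pmf n {1..M})"
    by (rule Pi_pmf_bij_betw) (auto simp: k_def bij_betw_def inj_on_def image_def split: if_splits)
  have fs: "finite (set_pmf (uniform_choices_pmf n ?I))" "finite (set_pmf (uniform_choices_pmf n {1..M}))"
    by (intro finite_set_uniform n_pos finite_cartesian_product finite_atLeastAtMost)+
  have "uniform_choices_pmf n ({1..M} \<times> {1..Suc t})
     = bind_pmf (uniform_choices_pmf n ?I) (\<lambda>f. bind_pmf (uniform_choices_pmf n {1..M})
        (\<lambda>x. return_pmf (\<lambda>q. if q \<in> ?I then f q else x (k q))))"
    unfolding I Pi_pmf_union[OF fin] L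
    by (simp add: pair_pmf_def map_pmf_def bind_assoc_pmf bind_return_pmf o_def)
  then have "measure_pmf.expectation (uniform_choices_pmf n ({1..M} \<times> {1..Suc t})) (\<lambda>c. F (card (unhappy M (curry c) (Suc t))))
     = measure_pmf.expectation (uniform_choices_pmf n ?I) (\<lambda>f. measure_pmf.expectation (uniform_choices_pmf n {1..M})
        (\<lambda>x. F (card (unhappy M (curry (\<lambda>q. if q \<in> ?I then f q else x (k q))) (Suc t)))))"
    by (simp only: expectation_bind_bind_return[OF fs])
  also have "\<dots> = measure_pmf.expectation (uniform_choices_pmf n ?I) (\<lambda>f. measure_pmf.expectation (uniform_choices_pmf n {1..M})
        (\<lambda>x. F (card (unhappy M (?G f x) (Suc t)))))"
  proof -
    have "unhappy M (curry (\<lambda>q. if q \<in> ?I then f q else x (k q))) (Suc t) = unhappy M (?G f x) (Suc t)" for f x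
      by (rule unhappy_cong) (auto simp: k_def)
    then show ?thesis by (simp only:)
  qed
  also have "\<dots> = measure_pmf.expectation (uniform_choices_pmf n ?I) (\<lambda>f. next_round n M F (card (unhappy M (curry f) t)))"
  proof (rule integral_cong_AE)
    show "AE f in measure_pmf (uniform_choices_pmf n ?I).
      measure_pmf.expectation (uniform_choices_pmf n {1..M}) (\<lambda>x. F (card (unhappy M (?G f x) (Suc t)))) = next_round n M F (card (unhappy M (curry f) t))"
    proof (rule AE_pmfI)
      fix f assume "f \<in> set_pmf (uniform_choices_pmf n ?I)"
      then have "\<And>q. q \<in> ?I \<Longrightarrow> f q \<in> {1..n}"
        using n_pos by (subst (asm) set_Pi_pmf) (auto simp: PiE_dflt_def set_pmf_of_set)
      then show "measure_pmf.expectation (uniform_choices_pmf n {1..M}) (\<lambda>x. F (card (unhappy M (?G f x) (Suc t)))) = next_round n M F (card (unhappy M (curry f) t))"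
        by (intro one_step_law[OF n_pos]) auto
    qed
  qed auto
  also have "\<dots> = avg (Suc t) F" unfolding avg_Suc by (rule Suc.IH)
  finally show ?case .
qed

section \<open>Dispersion times and their limit law\<close>

lemma unhappy_0: "unhappy M g 0 = {1..M}" by (simp add: unhappy_def)

text \<open>
  If all particles are happy, they all stay, at distinct vertices. The time \<open>s = 0\<close> is separate: nobody is happy
  then, whatever the positions.
\<close>

lemma settled_stays:
  assumes "unhappy M g s = {}" "1 \<le> M"
  shows "unhappy M g (Suc s) = {}"
proof (cases s)
  case 0
  then show ?thesis using assms by (simp add: unhappy_0)
next
  case (Suc r)
  have h: "happy M g s = {1..M}" using assms(1) happy_subset[of M g s] by (auto simp: unhappy_def)
  have "position M g (Suc s) i = position M g s i" if "i \<in> {1..M}" for i using that h by simp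
  then have "happy M g (Suc s) = happy M g s" unfolding Suc happy.simps by (auto simp del: position.simps)
  then show ?thesis using h by (simp add: unhappy_def)
qed

lemma dispersion_time_le:
  assumes "2 \<le> M"
  shows "dispersion_time M g \<le> enat t \<longleftrightarrow> card (unhappy M g t) = 0"
proof
  have fin: "finite (unhappy M g s)" for s by (simp add: unhappy_def)
  assume le: "dispersion_time M g \<le> enat t"
  define A where "A = enat ` {t. card (unhappy M g t) = 0}"
  have T: "dispersion_time M g = Inf A" by (simp add: dispersion_time_def A_def)
  have "A \<noteq> {}"
  proof
    assume "A = {}"
    then show False using le unfolding T by (simp add: Inf_enat_def)
  qed
  then have "Inf A \<in> A" unfolding Inf_enat_def using LeastI_ex[of "\<lambda>x. x \<in> A"] by auto
  then obtain s where s: "card (unhappy M g s) = 0" "enat s \<le> enat t"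
    using le unfolding T A_def by auto
  have "s \<le> t" using s by simp
  then have "unhappy M g t = {}"
  proof (induction t rule: dec_induct)
    case base then show ?case using s fin by simp
  next
    case (step r) then show ?case using assms by (intro settled_stays) auto
  qed
  then show "card (unhappy M g t) = 0" by simp
next
  assume "card (unhappy M g t) = 0"
  then show "dispersion_time M g \<le> enat t" unfolding dispersion_time_def by (intro Inf_lower) auto
qed

text \<open>
  Independence and uniformity give every possible assignment of the finitely many choices in \<open>I\<close> the same
  probability, as under the product distribution.
\<close>

lemma (in dispersion_process) choices_law:
  fixes I :: "(nat \<times> nat) set"
  assumes I: "finite I" "I \<noteq> {}" "I \<subseteq> {1..M} \<times> {1..}" and n: "0 < n"
  shows "measure \<Omega> {\<omega> \<in> space \<Omega>. \<Phi> (\<lambda>q. if q \<in> I then G (fst q) (snd q) \<omega> else 0)}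
     = measure_pmf.prob (uniform_choices_pmf n I) {c. \<Phi> c}"
proof -
  define X where "X = (\<lambda>(i, t). G i t)"
  have ind: "indep_vars (\<lambda>_. count_space {1..n}) X I"
    unfolding X_def by (rule indep_vars_subset[OF indep_choices I(3)])
  have meas: "X q \<in> measurable \<Omega> (count_space {1..n})" if "q \<in> I" for q
    using ind that unfolding indep_vars_def by auto
  have rng: "X q \<omega> \<in> {1..n}" if "q \<in> I" "\<omega> \<in> space \<Omega>" for q \<omega>
    using measurable_space[OF meas[OF that(1)] that(2)] by simp
  have one: "prob (X q -` {v} \<inter> space \<Omega>) = 1 / real n" if "q \<in> I" "v \<in> {1..n}" for q v
  proof -
    have "prob (X q -` {v} \<inter> space \<Omega>) = measure (distr \<Omega> (count_space {1..n}) (X q)) {v}"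
      using meas[OF that(1)] that(2) by (subst measure_distr) auto
    also have "distr \<Omega> (count_space {1..n}) (X q) = uniform_count_measure {1..n}"
      using I(3) that(1) uniform_choices[of "fst q" "snd q"] by (auto simp: X_def case_prod_beta)
    also have "measure (uniform_count_measure {1..n}) {v} = 1 / real n"
      using that(2) by (subst measure_uniform_count_measure) auto
    finally show ?thesis .
  qed
  define cyl where "cyl c = (\<Inter>q\<in>I. X q -` {c q} \<inter> space \<Omega>)" for c :: "nat \<times> nat \<Rightarrow> nat"
  have sp: "set_pmf (uniform_choices_pmf n I) = PiE_dflt I 0 (\<lambda>_. {1..n})"
    using I(1) n by (subst set_Pi_pmf) (auto simp: o_def set_pmf_of_set)
  define C where "C = {c. \<Phi> c} \<inter> set_pmf (uniform_choices_pmf n I)"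
  have finC: "finite C" unfolding C_def using finite_set_uniform[OF I(1) n] by simp
  have cI: "c q \<in> {1..n}" if "c \<in> C" "q \<in> I" for c q
    using that unfolding C_def sp PiE_dflt_def by (cases q) auto
  have cyl_events: "cyl c \<in> events" if "c \<in> C" for c
    unfolding cyl_def
  proof (rule sets.finite_INT[OF I(1,2)])
    fix q assume "q \<in> I"
    then show "X q -` {c q} \<inter> space \<Omega> \<in> events" using meas cI[OF that] by (auto intro!: measurable_sets)
  qed
  have prob_cyl: "prob (cyl c) = pmf (uniform_choices_pmf n I) c" if "c \<in> C" for c
  proof -
    have "prob (cyl c) = (\<Prod>q\<in>I. prob (X q -` {c q} \<inter> space \<Omega>))"
      unfolding cyl_def by (rule indep_varsD[OF ind I(2,1)]) (use cI[OF that] in auto)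
    also have "\<dots> = (\<Prod>q\<in>I. pmf (pmf_of_set {1..n}) (c q))"
      using one cI[OF that] n by (intro prod.cong refl) (auto simp: pmf_of_set)
    also have "\<dots> = pmf (uniform_choices_pmf n I) c"
      using that I(1) unfolding C_def sp by (subst pmf_Pi') (auto simp: PiE_dflt_def)
    finally show ?thesis .
  qed
  have "{\<omega> \<in> space \<Omega>. \<Phi> (\<lambda>q. if q \<in> I then G (fst q) (snd q) \<omega> else 0)} = (\<Union>c\<in>C. cyl c)"
  proof (intro set_eqI iffI)
    fix \<omega> assume w: "\<omega> \<in> {\<omega> \<in> space \<Omega>. \<Phi> (\<lambda>q. if q \<in> I then G (fst q) (snd q) \<omega> else 0)}"
    define c where "c = (\<lambda>q. if q \<in> I then G (fst q) (snd q) \<omega> else 0)"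
    have "c \<in> C" unfolding C_def sp using w rng by (auto simp: c_def PiE_dflt_def X_def case_prod_beta)
    moreover have "\<omega> \<in> cyl c" unfolding cyl_def using w I(2) by (auto simp: c_def X_def case_prod_beta)
    ultimately show "\<omega> \<in> (\<Union>c\<in>C. cyl c)" by blast
  next
    fix \<omega> assume "\<omega> \<in> (\<Union>c\<in>C. cyl c)"
    then obtain c where c: "c \<in> C" "\<omega> \<in> cyl c" by blast
    then have w: "\<omega> \<in> space \<Omega>" "\<And>q. q \<in> I \<Longrightarrow> X q \<omega> = c q" using I(2) unfolding cyl_def by auto
    have "(\<lambda>q. if q \<in> I then G (fst q) (snd q) \<omega> else 0) = c"
      using w(2) c(1) unfolding C_def sp by (auto simp: PiE_dflt_def fun_eq_iff X_def case_prod_beta)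
    then show "\<omega> \<in> {\<omega> \<in> space \<Omega>. \<Phi> (\<lambda>q. if q \<in> I then G (fst q) (snd q) \<omega> else 0)}"
      using w(1) c(1) unfolding C_def by auto
  qed
  moreover have "prob (\<Union>c\<in>C. cyl c) = (\<Sum>c\<in>C. prob (cyl c))"
  proof (rule finite_measure_finite_Union[OF finC])
    show "cyl ` C \<subseteq> events" using cyl_events by blast
    show "disjoint_family_on cyl C"
      unfolding disjoint_family_on_def
    proof (intro ballI impI)
      fix c c' assume cc: "c \<in> C" "c' \<in> C" "c \<noteq> c'"
      have "\<exists>q\<in>I. c q \<noteq> c' q"
      proof (rule ccontr)
        assume "\<not> ?thesis"
        then have "c = c'" using cc(1,2) unfolding C_def sp by (auto simp: PiE_dflt_def fun_eq_iff)
        then show False using cc by simp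
      qed
      then show "cyl c \<inter> cyl c' = {}" unfolding cyl_def by auto
    qed
  qed
  moreover have "(\<Sum>c\<in>C. prob (cyl c)) = measure_pmf.prob (uniform_choices_pmf n I) C"
    using prob_cyl finC by (simp add: measure_measure_pmf_finite)
  moreover have "measure_pmf.prob (uniform_choices_pmf n I) C = measure_pmf.prob (uniform_choices_pmf n I) {c. \<Phi> c}"
    unfolding C_def by (rule measure_Int_set_pmf)
  ultimately show ?thesis by simp
qed

lemma (in dispersion_process) prob_settled:
  assumes "settling n M"
  shows "measure \<Omega> {\<omega> \<in> space \<Omega>. card (unhappy M (\<lambda>i s. G i s \<omega>) t) = 0} = settling.settled n M t"
proof -
  interpret settling n M by (rule assms)
  show ?thesis
  proof (cases "t = 0")
    case True
    then show ?thesis using M_pos by (simp add: unhappy_0 settled_0)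
  next
    case False
    let ?I = "{1..M} \<times> {1..t}"
    have "unhappy M (\<lambda>i s. G i s \<omega>) t = unhappy M (curry (\<lambda>q. if q \<in> ?I then G (fst q) (snd q) \<omega> else 0)) t" for \<omega>
      by (rule unhappy_cong) auto
    then have "measure \<Omega> {\<omega> \<in> space \<Omega>. card (unhappy M (\<lambda>i s. G i s \<omega>) t) = 0}
       = measure \<Omega> {\<omega> \<in> space \<Omega>. card (unhappy M (curry (\<lambda>q. if q \<in> ?I then G (fst q) (snd q) \<omega> else 0)) t) = 0}"
      by (simp only:)
    also have "\<dots> = measure_pmf.prob (uniform_choices_pmf n ?I) {c. card (unhappy M (curry c) t) = 0}"
      by (rule choices_law) (use False M_pos n_pos in auto)
    also have "\<dots> = measure_pmf.expectation (uniform_choices_pmf n ?I) (indicator {c. card (unhappy M (curry c) t) = 0})"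
      by simp
    also have "indicator {c. card (unhappy M (curry c) t) = 0} = (\<lambda>c. if card (unhappy M (curry c) t) = 0 then 1 else 0 :: real)"
      by (auto simp: fun_eq_iff indicator_def)
    also have "measure_pmf.expectation (uniform_choices_pmf n ?I) \<dots> = settled t"
      unfolding settled_def using law_of_unhappy[of t "\<lambda>v. if v = 0 then 1 else 0"] by (simp only:)
    finally show ?thesis .
  qed
qed

lemma (in dispersion_process) rescaled_time_distribution:
  assumes "settling n M" and s: "0 < s"
  shows "measure \<Omega> {\<omega> \<in> space \<Omega>. ereal s * ereal_of_enat (dispersion_time M (\<lambda>i t. G i t \<omega>)) \<le> ereal x}
     = (if x < 0 then 0 else settling.settled n M (nat \<lfloor>x / s\<rfloor>))"
proof -
  have ev: "ereal s * ereal_of_enat T \<le> ereal x \<longleftrightarrow> 0 \<le> x \<and> T \<le> enat (nat \<lfloor>x / s\<rfloor>)" for T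
  proof (cases T)
    case (enat t)
    have "s * real t \<le> x \<longleftrightarrow> 0 \<le> x \<and> t \<le> nat \<lfloor>x / s\<rfloor>"
    proof (cases "0 \<le> x")
      case True
      have "s * real t \<le> x \<longleftrightarrow> real t \<le> x / s" using s by (simp add: field_simps)
      also have "\<dots> \<longleftrightarrow> t \<le> nat \<lfloor>x / s\<rfloor>" using True s by (simp add: le_nat_iff le_floor_iff)
      finally show ?thesis using True by simp
    next
      case False
      then have "\<not> s * real t \<le> x" using s by (meson less_imp_le mult_nonneg_nonneg of_nat_0_le_iff order_trans)
      then show ?thesis using False by simp
    qed
    then show ?thesis using enat by simp
  next
    case infinity
    then show ?thesis using s by simp
  qed
  show ?thesis
  proof (cases "x < 0")
    case False
    then have "{\<omega> \<in> space \<Omega>. ereal s * ereal_of_enat (dispersion_time M (\<lambda>i t. G i t \<omega>)) \<le> ereal x}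
      = {\<omega> \<in> space \<Omega>. card (unhappy M (\<lambda>i t. G i t \<omega>) (nat \<lfloor>x / s\<rfloor>)) = 0}"
      unfolding ev dispersion_time_le[OF two_particles] by auto
    then show ?thesis using prob_settled[OF assms(1)] False by simp
  qed (simp add: ev)
qed

text \<open>
  The modulus of \<open>\<Sum>j<K. exp (i j (y - x))\<close> is \<open>K\<close> at \<open>y = x\<close>. Integrating its square bounds \<open>K^2\<close> times the atom at \<open>x\<close>
  by the double sum of the moduli of \<open>char N (j - k)\<close>. If the characteristic function is small off a bounded set, that
  sum is \<open>o(K^2)\<close>.
\<close>

lemma no_atom_of_char_decay:
  assumes N: "real_distribution N"
    and decay: "\<And>\<epsilon>. 0 < \<epsilon> \<Longrightarrow> \<exists>b. \<forall>\<theta>. b \<le> \<bar>\<theta>\<bar> \<longrightarrow> cmod (char N \<theta>) \<le> \<epsilon>"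
  shows "measure N {x} = 0"
proof -
  interpret real_distribution N by (rule N)
  have "measure N {x} \<le> \<epsilon>" if eps: "0 < \<epsilon>" for \<epsilon>
  proof -
    obtain b where b: "\<And>\<theta>. b \<le> \<bar>\<theta>\<bar> \<Longrightarrow> cmod (char N \<theta>) \<le> \<epsilon> / 2" using decay[of "\<epsilon> / 2"] eps by auto
    obtain B :: nat where B: "b \<le> real B" using real_arch_simple by blast
    have near: "measure N {x} * (real K)\<^sup>2 \<le> real K * (2 * real B + real K * (\<epsilon> / 2))" for K :: nat
    proof -
      define D where "D y = (\<Sum>j<K. iexp (real j * (y - x)))" for y
      have cnj_iexp: "cnj (iexp a) = iexp (- a)" for a by (simp add: exp_cnj)
      have Dsq: "complex_of_real ((cmod (D y))\<^sup>2) = (\<Sum>j<K. \<Sum>k<K. iexp ((real j - real k) * (y - x)))" for y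
      proof -
        have "complex_of_real ((cmod (D y))\<^sup>2) = D y * cnj (D y)" by (rule complex_norm_square)
        also have "\<dots> = (\<Sum>j<K. \<Sum>k<K. iexp (real j * (y - x)) * cnj (iexp (real k * (y - x))))"
          by (simp add: D_def sum_product)
        also have "\<dots> = (\<Sum>j<K. \<Sum>k<K. iexp ((real j - real k) * (y - x)))"
          unfolding cnj_iexp exp_add[symmetric]
          by (intro sum.cong refl arg_cong[of _ _ exp]) (simp add: algebra_simps)
        finally show ?thesis .
      qed
      have meas: "(\<lambda>y. (cmod (D y))\<^sup>2) \<in> borel_measurable N" unfolding D_def by measurable
      have Db: "cmod (D y) \<le> real K" for y
      proof -
        have "cmod (D y) \<le> (\<Sum>j<K. cmod (iexp (real j * (y - x))))" unfolding D_def by (rule norm_sum)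
        then show ?thesis by simp
      qed
      have int: "integrable N (\<lambda>y. (cmod (D y))\<^sup>2)"
        by (rule integrable_const_bound[where B = "(real K)\<^sup>2"]) (use Db meas in \<open>auto intro: power_mono\<close>)
      have "measure N {x} * (real K)\<^sup>2 = (LINT y|N. (real K)\<^sup>2 * indicator {x} y)" by simp
      also have "\<dots> \<le> (LINT y|N. (cmod (D y))\<^sup>2)"
      proof (rule integral_mono)
        show "(real K)\<^sup>2 * indicator {x} y \<le> (cmod (D y))\<^sup>2" for y
          by (cases "y = x") (auto simp: D_def)
      qed (use int in \<open>auto simp: emeasure_eq_measure\<close>)
      also have "\<dots> = cmod (LINT y|N. complex_of_real ((cmod (D y))\<^sup>2))"
        unfolding integral_complex_of_real norm_of_real
        by (intro abs_of_nonneg[symmetric] Bochner_Integration.integral_nonneg) auto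
      also have "(LINT y|N. complex_of_real ((cmod (D y))\<^sup>2)) = (\<Sum>j<K. \<Sum>k<K. LINT y|N. iexp ((real j - real k) * (y - x)))"
        unfolding Dsq
      proof (subst Bochner_Integration.integral_sum)
        show "integrable N (\<lambda>y. \<Sum>k<K. iexp ((real j - real k) * (y - x)))" for j
          by (intro Bochner_Integration.integrable_sum integrable_const_bound[where B = 1]) auto
        show "(\<Sum>j<K. (LINT y|N. (\<Sum>k<K. iexp ((real j - real k) * (y - x))))) = (\<Sum>j<K. \<Sum>k<K. LINT y|N. iexp ((real j - real k) * (y - x)))"
          by (intro sum.cong refl Bochner_Integration.integral_sum integrable_const_bound[where B = 1]) auto
      qed
      also have "\<dots> = (\<Sum>j<K. \<Sum>k<K. iexp (- ((real j - real k) * x)) * char N (real j - real k))"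
      proof (intro sum.cong refl)
        fix j k
        have "(LINT y|N. iexp ((real j - real k) * (y - x))) = (LINT y|N. iexp (- ((real j - real k) * x)) * iexp ((real j - real k) * y))"
          by (intro Bochner_Integration.integral_cong refl) (simp add: exp_add[symmetric] algebra_simps)
        then show "(LINT y|N. iexp ((real j - real k) * (y - x))) = iexp (- ((real j - real k) * x)) * char N (real j - real k)"
          by (simp add: char_def)
      qed
      also have "cmod \<dots> \<le> (\<Sum>j<K. \<Sum>k<K. cmod (char N (real j - real k)))"
        by (intro sum_norm_le order_trans[OF norm_sum] sum_mono) (simp add: norm_mult)
      also have "\<dots> \<le> (\<Sum>j<K. 2 * real B + real K * (\<epsilon> / 2))"
      proof (rule sum_mono)
        fix j
        have "(\<Sum>k<K. cmod (char N (real j - real k))) \<le> (\<Sum>k<K. (if k \<in> {j - B..<j + B} then 1 else 0) + \<epsilon> / 2)"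
        proof (rule sum_mono)
          fix k
          show "cmod (char N (real j - real k)) \<le> (if k \<in> {j - B..<j + B} then 1 else 0) + \<epsilon> / 2"
          proof (cases "k \<in> {j - B..<j + B}")
            case True
            then show ?thesis using cmod_char_le_1[of "real j - real k"] eps by simp
          next
            case False
            then have "real B \<le> \<bar>real j - real k\<bar>" by auto
            then show ?thesis using b[of "real j - real k"] B False by simp
          qed
        qed
        also have "\<dots> = real (card ({..<K} \<inter> {j - B..<j + B})) + real K * (\<epsilon> / 2)"
        proof -
          have "{..<K} \<inter> {k. j - B \<le> k \<and> k < j + B} = {..<K} \<inter> {j - B..<j + B}" by auto
          then show ?thesis by (simp add: sum.distrib sum.If_cases)
        qed
        also have "real (card ({..<K} \<inter> {j - B..<j + B})) \<le> 2 * real B"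
        proof -
          have "card ({..<K} \<inter> {j - B..<j + B}) \<le> card {j - B..<j + B}" by (rule card_mono) auto
          then show ?thesis by simp
        qed
        finally show "(\<Sum>k<K. cmod (char N (real j - real k))) \<le> 2 * real B + real K * (\<epsilon> / 2)" by simp
      qed
      also have "\<dots> = real K * (2 * real B + real K * (\<epsilon> / 2))" by simp
      finally show ?thesis .
    qed
    obtain K :: nat where K: "4 * real B / \<epsilon> + 1 \<le> real K" using real_arch_simple by blast
    have Kp: "0 < real K"
    proof -
      have "0 \<le> 4 * real B / \<epsilon>" using eps by simp
      then show ?thesis using K by linarith
    qed
    have "2 * real B \<le> real K * (\<epsilon> / 2)" using K eps by (simp add: field_simps)
    then have "real K * (2 * real B + real K * (\<epsilon> / 2)) \<le> real K * (real K * \<epsilon>)" using Kp by (intro mult_left_mono) auto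
    then have "measure N {x} * (real K)\<^sup>2 \<le> \<epsilon> * (real K)\<^sup>2" using near[of K] by (simp add: power2_eq_square mult_ac)
    then show ?thesis using Kp by simp
  qed
  then have "measure N {x} \<le> 0" by (rule field_le_epsilon[of "measure N {x}" 0, simplified])
  then show ?thesis by (simp add: measure_le_0_iff)
qed

context critical_sequence
begin

text \<open>
  Tightness follows from the bound on the expected absorption time. The finitely many \<open>n\<close> for which the chain
  is not yet well behaved receive a Dirac measure.
\<close>

lemma rescaled_laws:
  "\<exists>R. tight R \<and> (\<forall>n. real_distribution (R n)) \<and>
     (\<forall>\<^sub>F n in sequentially. settling n (M n) \<and> 0 < h n \<and>
        (\<forall>x. cdf (R n) x = (if x < 0 then 0 else settling.settled n (M n) (nat \<lfloor>x / h n\<rfloor>))) \<and>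
        R n = settling.law n (M n) (h n))"
proof -
  obtain B where B: "0 < B" and ev: "\<forall>\<^sub>F n in sequentially. settling n (M n) \<and> settling.settled n (M n) \<longlonglongrightarrow> 1 \<and>
     (\<forall>N. real N * h n * (1 - settling.settled n (M n) N) \<le> B)" using eventually_settled by blast
  define good where "good n \<longleftrightarrow> settling n (M n) \<and> settling.settled n (M n) \<longlonglongrightarrow> 1 \<and>
     (\<forall>N. real N * h n * (1 - settling.settled n (M n) N) \<le> B)" for n
  define R where "R n = (if good n then settling.law n (M n) (h n) else return borel 0)" for n
  have hp: "0 < h n" "h n \<le> 1" if "good n" for n
  proof -
    interpret settling n "M n" using that by (simp add: good_def)
    show "0 < h n" using n_pos by (simp add: h_def)
    have "1 \<le> sqrt (real n)" using n_pos by simp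
    then show "h n \<le> 1" using n_pos by (simp add: h_def powr_minus_divide powr_half_sqrt)
  qed
  have rd: "real_distribution (R n)" for n
  proof (cases "good n")
    case True
    interpret settling n "M n" using True by (simp add: good_def)
    show ?thesis using True real_distribution_law by (simp add: R_def good_def)
  next
    case False
    have "prob_space (return borel (0::real))" by (rule prob_space_return) simp
    then show ?thesis using False by (simp add: R_def real_distribution_def real_distribution_axioms_def)
  qed
  have cdfR: "cdf (R n) x = (if x < 0 then 0 else settling.settled n (M n) (nat \<lfloor>x / h n\<rfloor>))" if "good n" for n x
  proof -
    interpret settling n "M n" using that by (simp add: good_def)
    show ?thesis using that cdf_law[of "h n" x] hp[OF that] by (simp add: R_def good_def)
  qed
  have "tight R"
    unfolding tight_def
  proof (intro conjI allI impI)
    fix \<epsilon> :: real assume eps: "0 < \<epsilon>"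
    (* Rounding to whole rounds costs at most h n, which is at most 1, so b leaves room for it. *)
    define b where "b = B / \<epsilon> + 2"
    have b2: "2 < b" using eps B by (simp add: b_def)
    have "1 - \<epsilon> < measure (R n) {-1<..b}" for n
    proof (cases "good n")
      case True
      interpret settling n "M n" using True by (simp add: good_def)
      interpret L: real_distribution "R n" by (rule rd)
      define k where "k = nat \<lfloor>b / h n\<rfloor>"
      have "measure (R n) {-1<..b} = cdf (R n) b - cdf (R n) (-1)" using b2 by (subst L.cdf_diff_eq) auto
      also have "\<dots> = settled k" unfolding cdfR[OF True] k_def using b2 by simp
      finally have e: "measure (R n) {-1<..b} = settled k" .
      have "b / h n - 1 < real k"
      proof -
        have "0 \<le> b / h n" using b2 hp[OF True] by simp
        then show ?thesis unfolding k_def by linarith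
      qed
      then have "(b / h n - 1) * h n < real k * h n" using hp[OF True] by (intro mult_strict_right_mono) auto
      then have kb: "B / \<epsilon> < real k * h n" using hp[OF True] by (simp add: left_diff_distrib b_def)
      have "real k * h n * (1 - settled k) \<le> B" using True by (simp add: good_def)
      moreover have "B < \<epsilon> * (real k * h n)" using kb eps by (simp add: pos_divide_less_eq mult.commute)
      ultimately have "real k * h n * (1 - settled k) < (real k * h n) * \<epsilon>" by (simp add: mult_ac)
      moreover have "0 < real k * h n" using kb B eps by (meson divide_pos_pos less_trans)
      ultimately have "1 - settled k < \<epsilon>" by (simp add: mult_less_cancel_left_pos)
      then show ?thesis using e by linarith
    next
      case False
      then show ?thesis using eps b2 by (simp add: R_def measure_return indicator_def)
    qed
    then show "\<exists>a b. a < b \<and> (\<forall>n. 1 - \<epsilon> < measure (R n) {a<..b})" using b2 by (intro exI[of _ "-1"] exI[of _ b]) auto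
  qed (rule rd)
  moreover have "\<forall>\<^sub>F n in sequentially. settling n (M n) \<and> 0 < h n \<and>
        (\<forall>x. cdf (R n) x = (if x < 0 then 0 else settling.settled n (M n) (nat \<lfloor>x / h n\<rfloor>))) \<and>
        R n = settling.law n (M n) (h n)"
    using ev unfolding good_def[symmetric]
    by eventually_elim (use hp cdfR in \<open>auto simp: R_def good_def\<close>)
  ultimately show ?thesis using rd by blast
qed

end

lemma critical_sequence_exists: "\<exists>M. critical_sequence \<alpha> M"
proof -
  define M where "M n = nat \<lfloor>real n / 2 + \<alpha> * sqrt (real n)\<rfloor>" for n
  have ev: "\<forall>\<^sub>F n in sequentially. 0 \<le> real n / 2 + \<alpha> * sqrt (real n)" by real_asymp
  have "(\<lambda>n. (2 * real (M n) - real n) / sqrt (real n)) \<longlonglongrightarrow> 2 * \<alpha>"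
  proof (rule real_tendsto_sandwich)
    show "(\<lambda>n. 2 * \<alpha> - 2 / sqrt (real n)) \<longlonglongrightarrow> 2 * \<alpha>" "(\<lambda>n. 2 * \<alpha>) \<longlonglongrightarrow> 2 * \<alpha>" by real_asymp+
    show "\<forall>\<^sub>F n in sequentially. 2 * \<alpha> - 2 / sqrt (real n) \<le> (2 * real (M n) - real n) / sqrt (real n)"
      using ev eventually_gt_at_top[of 0]
    proof eventually_elim
      case (elim n)
      have "real n / 2 + \<alpha> * sqrt (real n) - 1 \<le> real (M n)" unfolding M_def using elim by linarith
      then have "(2 * \<alpha> * sqrt (real n) - 2) / sqrt (real n) \<le> (2 * real (M n) - real n) / sqrt (real n)"
        by (intro divide_right_mono) auto
      then show ?case using elim by (simp add: diff_divide_distrib)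
    qed
    show "\<forall>\<^sub>F n in sequentially. (2 * real (M n) - real n) / sqrt (real n) \<le> 2 * \<alpha>"
      using ev eventually_gt_at_top[of 0]
    proof eventually_elim
      case (elim n)
      have "real (M n) \<le> real n / 2 + \<alpha> * sqrt (real n)" unfolding M_def using elim by linarith
      then have "(2 * real (M n) - real n) / sqrt (real n) \<le> (2 * \<alpha> * sqrt (real n)) / sqrt (real n)"
        by (intro divide_right_mono) auto
      then show ?case using elim by simp
    qed
  qed
  then show ?thesis by (auto simp: critical_sequence_def)
qed

theorem theorem1p1:
  fixes \<alpha> :: real
  shows "\<exists>(N :: real measure) (T :: real \<Rightarrow> real).
    prob_space N \<and> T \<in> borel_measurable N \<and>
    continuous_on UNIV (cdf (distr N borel T)) \<and>
    (AE x in N. 0 < T x) \<and>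
    (\<forall>(M :: nat \<Rightarrow> nat) (\<Omega> :: nat \<Rightarrow> 'a measure) (G :: nat \<Rightarrow> nat \<Rightarrow> nat \<Rightarrow> 'a \<Rightarrow> nat).
      (\<lambda>n. real (M n) - (real n / 2 + \<alpha> * real n powr (1/2))) \<in> o(\<lambda>n. real n powr (1/2)) \<longrightarrow>
      (\<forall>\<^sub>F n in sequentially. dispersion_process (\<Omega> n) n (M n) (G n)) \<longrightarrow>
      weak_conv
        (\<lambda>n x. measure (\<Omega> n) {\<omega> \<in> space (\<Omega> n).
          ereal (real n powr (-1/2)) *
            ereal_of_enat (dispersion_time (M n) (\<lambda>i t. G n i t \<omega>)) \<le> ereal x})
        (cdf (distr N borel T)))"
proof -
  obtain X Y :: "real \<Rightarrow> real \<Rightarrow> real" and \<kappa> where k: "0 < \<kappa>" and XY: "\<And>\<theta>.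
     generator_solution \<alpha> (X \<theta>) (\<lambda>x. \<theta> * Y \<theta> x) \<and> generator_solution \<alpha> (Y \<theta>) (\<lambda>x. - \<theta> * X \<theta> x) \<and>
     (X \<theta> \<longlongrightarrow> 1) at_top \<and> (Y \<theta> \<longlongrightarrow> 0) at_top \<and>
     1 \<le> (X \<theta> 0)\<^sup>2 + (Y \<theta> 0)\<^sup>2 \<and> \<kappa> * \<theta>\<^sup>2 \<le> ((X \<theta> 0)\<^sup>2 + (Y \<theta> 0)\<^sup>2)\<^sup>2"
    using characteristic_solutions[of \<alpha>] by blast
  define cf where "cf \<theta> = 1 / Complex (X \<theta> 0) (Y \<theta> 0)" for \<theta>
  have lim: "(\<lambda>n. char (settling.law n (M n) (critical_sequence.h n)) \<theta>) \<longlonglongrightarrow> cf \<theta>" if "critical_sequence \<alpha> M" for M \<theta>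
    unfolding cf_def by (rule critical_sequence.char_limit[OF that]) (use XY[of \<theta>] in auto)
  have laws: "\<exists>R. tight R \<and> (\<forall>n. real_distribution (R n)) \<and> (\<forall>\<theta>. (\<lambda>n. char (R n) \<theta>) \<longlonglongrightarrow> cf \<theta>) \<and>
     (\<forall>\<^sub>F n in sequentially. settling n (M n) \<and> 0 < critical_sequence.h n \<and>
        (\<forall>x. cdf (R n) x = (if x < 0 then 0 else settling.settled n (M n) (nat \<lfloor>x / critical_sequence.h n\<rfloor>))))"
    if crit: "critical_sequence \<alpha> M" for M
  proof -
    obtain R where R: "tight R" "\<And>n. real_distribution (R n)"
      "\<forall>\<^sub>F n in sequentially. settling n (M n) \<and> 0 < critical_sequence.h n \<and>
        (\<forall>x. cdf (R n) x = (if x < 0 then 0 else settling.settled n (M n) (nat \<lfloor>x / critical_sequence.h n\<rfloor>))) \<and>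
        R n = settling.law n (M n) (critical_sequence.h n)"
      using critical_sequence.rescaled_laws[OF crit] by blast
    have "(\<lambda>n. char (R n) \<theta>) \<longlonglongrightarrow> cf \<theta>" for \<theta>
      by (rule Lim_transform_eventually[OF lim[OF crit]]) (use R(3) in \<open>auto elim!: eventually_mono\<close>)
    then show ?thesis using R by (intro exI[of _ R]) (auto elim: eventually_mono)
  qed
  (* Some admissible sequence is needed to produce the limit law; its characteristic function cf does not depend on it. *)
  obtain M0 where M0: "critical_sequence \<alpha> M0" using critical_sequence_exists by blast
  obtain R0 where R0: "tight R0" "\<And>n. real_distribution (R0 n)" "\<And>\<theta>. (\<lambda>n. char (R0 n) \<theta>) \<longlonglongrightarrow> cf \<theta>"
    "\<forall>\<^sub>F n in sequentially. settling n (M0 n) \<and> 0 < critical_sequence.h n \<and>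
        (\<forall>x. cdf (R0 n) x = (if x < 0 then 0 else settling.settled n (M0 n) (nat \<lfloor>x / critical_sequence.h n\<rfloor>)))"
    using laws[OF M0] by blast
  obtain r N where r: "strict_mono (r :: nat \<Rightarrow> nat)" and N: "real_distribution N" and wc: "weak_conv_m (R0 \<circ> id \<circ> r) N"
    using tight_imp_convergent_subsubsequence[OF R0(1) strict_mono_id] by blast
  interpret N: real_distribution N by (rule N)
  have charN: "char N \<theta> = cf \<theta>" for \<theta>
  proof (rule LIMSEQ_unique)
    show "(\<lambda>n. char ((R0 \<circ> id \<circ> r) n) \<theta>) \<longlonglongrightarrow> char N \<theta>"
      by (rule levy_continuity1[OF _ N wc]) (simp add: R0(2))
    show "(\<lambda>n. char ((R0 \<circ> id \<circ> r) n) \<theta>) \<longlonglongrightarrow> cf \<theta>"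
      using LIMSEQ_subseq_LIMSEQ[OF R0(3) r] by (simp add: o_def)
  qed
  have noatom: "measure N {x} = 0" for x
  proof (rule no_atom_of_char_decay[OF N])
    fix \<epsilon> :: real assume eps: "0 < \<epsilon>"
    define b where "b = 1 / (\<epsilon>\<^sup>2 * sqrt \<kappa>)"
    have "cmod (char N \<theta>) \<le> \<epsilon>" if b: "b \<le> \<bar>\<theta>\<bar>" for \<theta>
    proof -
      define q where "q = (X \<theta> 0)\<^sup>2 + (Y \<theta> 0)\<^sup>2"
      have q1: "1 \<le> q" and q2: "\<kappa> * \<theta>\<^sup>2 \<le> q\<^sup>2" using XY[of \<theta>] by (auto simp: q_def)
      have "1 / \<epsilon>\<^sup>2 = sqrt \<kappa> * b" using k eps by (simp add: b_def)
      also have "\<dots> \<le> sqrt \<kappa> * \<bar>\<theta>\<bar>" using b k by (intro mult_left_mono) auto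
      also have "\<dots> = sqrt (\<kappa> * \<theta>\<^sup>2)" by (simp add: real_sqrt_mult)
      also have "\<dots> \<le> sqrt (q\<^sup>2)" using q2 by (rule real_sqrt_le_mono)
      also have "\<dots> = q" using q1 by simp
      finally have "sqrt (1 / \<epsilon>\<^sup>2) \<le> sqrt q" by simp
      then have e: "1 / \<epsilon> \<le> sqrt q" using eps by (simp add: real_sqrt_divide)
      have "cmod (char N \<theta>) = 1 / sqrt q"
        unfolding charN cf_def q_def by (simp add: norm_divide complex_norm)
      also have "\<dots> \<le> \<epsilon>" using e eps q1 by (simp add: field_simps)
      finally show ?thesis .
    qed
    then show "\<exists>b. \<forall>\<theta>. b \<le> \<bar>\<theta>\<bar> \<longrightarrow> cmod (char N \<theta>) \<le> \<epsilon>" by blast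
  qed
  have cont: "isCont (cdf N) x" for x using N.isCont_cdf noatom by simp
  have id: "distr N borel (\<lambda>x. x) = N" 
  proof -
    have "distr N borel (\<lambda>x. x) = distr N N (\<lambda>x. x)" by (rule distr_cong) (auto simp: N.events_eq_borel)
    then show ?thesis by simp
  qed
  (* Absorption takes at least one round, since all M particles are unhappy at time 0. *)
  have "cdf N 0 = 0"
  proof (rule LIMSEQ_unique)
    show "(\<lambda>n. cdf ((R0 \<circ> id \<circ> r) n) 0) \<longlonglongrightarrow> cdf N 0"
      using wc cont unfolding weak_conv_m_def weak_conv_def by blast
    have "\<forall>\<^sub>F n in sequentially. 0 = cdf (R0 n) 0"
      using R0(4)
    proof eventually_elim
      case (elim n)
      interpret settling n "M0 n" using elim by simp
      show ?case using elim settled_0 by simp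
    qed
    then have "(\<lambda>n. cdf (R0 n) 0) \<longlonglongrightarrow> 0" by (rule Lim_transform_eventually[OF tendsto_const])
    then show "(\<lambda>n. cdf ((R0 \<circ> id \<circ> r) n) 0) \<longlonglongrightarrow> 0"
      using LIMSEQ_subseq_LIMSEQ[OF _ r] by (fastforce simp: o_def)
  qed
  then have "N.prob {..0} = 0" by (simp add: cdf_def)
  then have pos: "AE x in N. 0 < x"
    by (intro AE_I[of _ _ "{..0}"]) (auto simp: N.emeasure_eq_measure)
  show ?thesis
  proof (intro exI[of _ N] exI[of _ "\<lambda>x. x"] conjI allI impI)
    show "prob_space N" by (rule N.prob_space_axioms)
    show "(\<lambda>x. x) \<in> borel_measurable N" by simp
    show "continuous_on UNIV (cdf (distr N borel (\<lambda>x. x)))" unfolding id using cont by (simp add: continuous_on_eq_continuous_at)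
    show "AE x in N. 0 < x" by (rule pos)
    fix M :: "nat \<Rightarrow> nat" and \<Omega> :: "nat \<Rightarrow> 'a measure" and G :: "nat \<Rightarrow> nat \<Rightarrow> nat \<Rightarrow> 'a \<Rightarrow> nat"
    assume o: "(\<lambda>n. real (M n) - (real n / 2 + \<alpha> * real n powr (1/2))) \<in> o(\<lambda>n. real n powr (1/2))"
      and disp: "\<forall>\<^sub>F n in sequentially. dispersion_process (\<Omega> n) n (M n) (G n)"
    have crit: "critical_sequence \<alpha> M"
    proof
      have "(\<lambda>n. (real (M n) - (real n / 2 + \<alpha> * real n powr (1/2))) / real n powr (1/2)) \<longlonglongrightarrow> 0"
        using smalloD_tendsto[OF o] .
      then have "(\<lambda>n. 2 * \<alpha> + 2 * ((real (M n) - (real n / 2 + \<alpha> * real n powr (1/2))) / real n powr (1/2))) \<longlonglongrightarrow> 2 * \<alpha> + 2 * 0"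
        by (intro tendsto_intros)
      moreover have "\<forall>\<^sub>F n in sequentially. 2 * \<alpha> + 2 * ((real (M n) - (real n / 2 + \<alpha> * real n powr (1/2))) / real n powr (1/2))
         = (2 * real (M n) - real n) / sqrt (real n)"
        using eventually_gt_at_top[of 0] by eventually_elim (simp add: powr_half_sqrt field_simps)
      ultimately show "(\<lambda>n. (2 * real (M n) - real n) / sqrt (real n)) \<longlonglongrightarrow> 2 * \<alpha>"
        using Lim_transform_eventually by fastforce
    qed
    obtain R where R: "\<And>n. real_distribution (R n)" "\<And>\<theta>. (\<lambda>n. char (R n) \<theta>) \<longlonglongrightarrow> cf \<theta>"
      "\<forall>\<^sub>F n in sequentially. settling n (M n) \<and> 0 < critical_sequence.h n \<and>
        (\<forall>x. cdf (R n) x = (if x < 0 then 0 else settling.settled n (M n) (nat \<lfloor>x / critical_sequence.h n\<rfloor>)))"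
      using laws[OF crit] by blast
    have "weak_conv_m R N" by (rule levy_continuity[OF R(1) N]) (simp add: charN R(2))
    then have cdfs: "(\<lambda>n. cdf (R n) x) \<longlonglongrightarrow> cdf N x" for x
      using cont unfolding weak_conv_m_def weak_conv_def by blast
    have eq: "\<forall>\<^sub>F n in sequentially. cdf (R n) x = measure (\<Omega> n) {\<omega> \<in> space (\<Omega> n).
          ereal (real n powr (-1/2)) * ereal_of_enat (dispersion_time (M n) (\<lambda>i t. G n i t \<omega>)) \<le> ereal x}" for x
      using R(3) disp
    proof eventually_elim
      case (elim n)
      interpret D: dispersion_process "\<Omega> n" n "M n" "G n" by (rule elim(2))
      show ?case using elim(1) D.rescaled_time_distribution[of "critical_sequence.h n" x]
        by (simp add: critical_sequence.h_def[OF crit])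
    qed
    show "weak_conv
        (\<lambda>n x. measure (\<Omega> n) {\<omega> \<in> space (\<Omega> n).
          ereal (real n powr (-1/2)) *
            ereal_of_enat (dispersion_time (M n) (\<lambda>i t. G n i t \<omega>)) \<le> ereal x})
        (cdf (distr N borel (\<lambda>x. x)))"
      unfolding id weak_conv_def using Lim_transform_eventually[OF cdfs eq] by blast
  qed
qed

end
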